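(* For any class $\mathscr{C}$ of graphs of bounded treewidth, the problem $\mathrm{MC}(\mathrm{MSO}_2[{<}\text{-inv}],\mathscr{C})$ is fixed-parameter tractable.
   Context: $\mathrm{MSO}_2$ is monadic second-order logic on graphs with quantification over vertices, edges, sets of vertices and sets of edges. A formula $\phi$ over the signature of graphs extended by a binary symbol $<$ is order-invariant if for every graph $G$ and all linear orders $<_1,<_2$ of $V(G)$, $(G,<_1)\models\phi$ iff $(G,<_2)\models\phi$; for such $\phi$ write $G\models_{\mathrm{ord\text{-}inv}}\phi$ if $(G,<)\models\phi$ for some (equivalently every) linear order $<$ of $V(G)$. The parameterised problem $\mathrm{MC}(\mathrm{MSO}_2[{<}\text{-inv}],\mathscr{C})$ has as input a graph $G\in\mathscr{C}$ and an order-invariant $\mathrm{MSO}_2$ sentence $\phi$ over $\{E,<\}$, parameter $|\phi|$, and asks whether $G\models_{\mathrm{ord\text{-}inv}}\phi$. It is fixed-parameter tractable if it can be decided in time $f(|\phi|)\cdot\|G\|^{O(1)}$ for some function $f$. *)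

theory Defs
  imports Main
begin

section \<open>Finite simple graphs and treewidth\<close>

record 'v graph =
  verts :: "'v set"
  edges :: "'v set set"

definition wf_graph :: "'v graph \<Rightarrow> bool" where
  "wf_graph G \<longleftrightarrow> finite (verts G) \<and> edges G \<subseteq> {e. e \<subseteq> verts G \<and> card e = 2}"

definition connected_graph :: "'v graph \<Rightarrow> bool" where
  "connected_graph G \<longleftrightarrow> verts G \<noteq> {} \<and>
     (\<forall>u\<in>verts G. \<forall>v\<in>verts G. (u, v) \<in> {(x, y). {x, y} \<in> edges G}\<^sup>*)"

definition is_cycle :: "'v graph \<Rightarrow> 'v list \<Rightarrow> bool" where
  "is_cycle G c \<longleftrightarrow> 3 \<le> length c \<and> distinct c \<and>
     (\<forall>i<length c. {c ! i, c ! (Suc i mod length c)} \<in> edges G)"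

definition is_tree :: "'v graph \<Rightarrow> bool" where
  "is_tree T \<longleftrightarrow> wf_graph T \<and> connected_graph T \<and> (\<nexists>c. is_cycle T c)"

definition induced_subgraph :: "'v graph \<Rightarrow> 'v set \<Rightarrow> 'v graph" where
  "induced_subgraph G S = \<lparr>verts = verts G \<inter> S, edges = {e \<in> edges G. e \<subseteq> S}\<rparr>"

text \<open>Every finite tree is isomorphic to one with nodes in \<^typ>\<open>nat\<close>, so fixing the node type of
  the decomposition tree is harmless.\<close>

definition tree_decomposition :: "'v graph \<Rightarrow> nat graph \<Rightarrow> (nat \<Rightarrow> 'v set) \<Rightarrow> bool" where
  "tree_decomposition G T \<beta> \<longleftrightarrow>
     is_tree T \<and>
     (\<Union>t\<in>verts T. \<beta> t) = verts G \<and>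
     (\<forall>e\<in>edges G. \<exists>t\<in>verts T. e \<subseteq> \<beta> t) \<and>
     (\<forall>v\<in>verts G. connected_graph (induced_subgraph T {t. v \<in> \<beta> t}))"

text \<open>Natural-number subtraction: the empty graph gets treewidth 0 rather than -1.\<close>

definition width :: "nat graph \<Rightarrow> (nat \<Rightarrow> 'v set) \<Rightarrow> nat" where
  "width T \<beta> = Max ((\<lambda>t. card (\<beta> t)) ` verts T) - 1"

definition treewidth :: "'v graph \<Rightarrow> nat" where
  "treewidth G = (LEAST k. \<exists>T \<beta>. tree_decomposition G T \<beta> \<and> width T \<beta> = k)"

definition bounded_treewidth :: "'v graph set \<Rightarrow> bool" where
  "bounded_treewidth C \<longleftrightarrow> (\<exists>k. \<forall>G\<in>C. treewidth G \<le> k)"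


section \<open>\<open>MSO\<^sub>2\<close> over \<open>{E, <}\<close> and order-invariance\<close>

text \<open>Each of the four sorts (vertices, edges, sets of vertices, sets of edges) has its own
  variables, named by natural numbers. The constructors \<open>Ex_V\<close>, \<open>Ex_E\<close>, \<open>Ex_VS\<close>, \<open>Ex_ES\<close>
  quantify over the respective sort. In \<open>Inc x e\<close> the vertex variable comes first; in
  \<open>Mem_V x X\<close> and \<open>Mem_E e F\<close> the set variable comes second. The remaining connectives and the
  universal quantifiers are the usual abbreviations.\<close>

datatype mso2 =
    Eq_V nat nat | Eq_E nat nat
  | Adj nat nat | Inc nat nat | Less nat nat
  | Mem_V nat nat | Mem_E nat nat
  | Neg mso2 | Conj mso2 mso2
  | Ex_V nat mso2 | Ex_E nat mso2 | Ex_VS nat mso2 | Ex_ES nat mso2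

fun holds ::
  "'v graph \<Rightarrow> ('v \<times> 'v) set \<Rightarrow>
   (nat \<Rightarrow> 'v) \<Rightarrow> (nat \<Rightarrow> 'v set) \<Rightarrow> (nat \<Rightarrow> 'v set) \<Rightarrow> (nat \<Rightarrow> 'v set set) \<Rightarrow> mso2 \<Rightarrow> bool"
where
  "holds G lt a b A B (Eq_V x y) \<longleftrightarrow> a x = a y"
| "holds G lt a b A B (Eq_E e f) \<longleftrightarrow> b e = b f"
| "holds G lt a b A B (Adj x y) \<longleftrightarrow> {a x, a y} \<in> edges G"
| "holds G lt a b A B (Inc x e) \<longleftrightarrow> a x \<in> b e"
| "holds G lt a b A B (Less x y) \<longleftrightarrow> (a x, a y) \<in> lt"
| "holds G lt a b A B (Mem_V x X) \<longleftrightarrow> a x \<in> A X"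
| "holds G lt a b A B (Mem_E e F) \<longleftrightarrow> b e \<in> B F"
| "holds G lt a b A B (Neg \<phi>) \<longleftrightarrow> \<not> holds G lt a b A B \<phi>"
| "holds G lt a b A B (Conj \<phi> \<psi>) \<longleftrightarrow> holds G lt a b A B \<phi> \<and> holds G lt a b A B \<psi>"
| "holds G lt a b A B (Ex_V x \<phi>) \<longleftrightarrow> (\<exists>v\<in>verts G. holds G lt (a(x := v)) b A B \<phi>)"
| "holds G lt a b A B (Ex_E e \<phi>) \<longleftrightarrow> (\<exists>d\<in>edges G. holds G lt a (b(e := d)) A B \<phi>)"
| "holds G lt a b A B (Ex_VS X \<phi>) \<longleftrightarrow> (\<exists>S. S \<subseteq> verts G \<and> holds G lt a b (A(X := S)) B \<phi>)"
| "holds G lt a b A B (Ex_ES F \<phi>) \<longleftrightarrow> (\<exists>S. S \<subseteq> edges G \<and> holds G lt a b A (B(F := S)) \<phi>)"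

datatype mso2_var = V_var nat | E_var nat | VS_var nat | ES_var nat

fun free_vars :: "mso2 \<Rightarrow> mso2_var set" where
  "free_vars (Eq_V x y) = {V_var x, V_var y}"
| "free_vars (Eq_E e f) = {E_var e, E_var f}"
| "free_vars (Adj x y) = {V_var x, V_var y}"
| "free_vars (Inc x e) = {V_var x, E_var e}"
| "free_vars (Less x y) = {V_var x, V_var y}"
| "free_vars (Mem_V x X) = {V_var x, VS_var X}"
| "free_vars (Mem_E e F) = {E_var e, ES_var F}"
| "free_vars (Neg \<phi>) = free_vars \<phi>"
| "free_vars (Conj \<phi> \<psi>) = free_vars \<phi> \<union> free_vars \<psi>"
| "free_vars (Ex_V x \<phi>) = free_vars \<phi> - {V_var x}"
| "free_vars (Ex_E e \<phi>) = free_vars \<phi> - {E_var e}"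
| "free_vars (Ex_VS X \<phi>) = free_vars \<phi> - {VS_var X}"
| "free_vars (Ex_ES F \<phi>) = free_vars \<phi> - {ES_var F}"

definition sentence :: "mso2 \<Rightarrow> bool" where
  "sentence \<phi> \<longleftrightarrow> free_vars \<phi> = {}"

text \<open>The initial assignments are irrelevant for sentences.\<close>

definition satisfies :: "'v graph \<Rightarrow> ('v \<times> 'v) set \<Rightarrow> mso2 \<Rightarrow> bool" where
  "satisfies G lt \<phi> \<longleftrightarrow>
     holds G lt (\<lambda>_. undefined) (\<lambda>_. undefined) (\<lambda>_. undefined) (\<lambda>_. undefined) \<phi>"

definition vertex_order :: "'v graph \<Rightarrow> ('v \<times> 'v) set \<Rightarrow> bool" where
  "vertex_order G lt \<longleftrightarrow> lt \<subseteq> verts G \<times> verts G \<and> strict_linear_order_on (verts G) lt"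

text \<open>Quantifying over graphs with vertices in \<^typ>\<open>nat\<close> covers all finite graphs up to
  isomorphism.\<close>

definition order_invariant :: "mso2 \<Rightarrow> bool" where
  "order_invariant \<phi> \<longleftrightarrow>
     (\<forall>(G :: nat graph) lt1 lt2. wf_graph G \<longrightarrow> vertex_order G lt1 \<longrightarrow> vertex_order G lt2 \<longrightarrow>
        (satisfies G lt1 \<phi> \<longleftrightarrow> satisfies G lt2 \<phi>))"

definition models_ord_inv :: "'v graph \<Rightarrow> mso2 \<Rightarrow> bool" where
  "models_ord_inv G \<phi> \<longleftrightarrow> (\<exists>lt. vertex_order G lt \<and> satisfies G lt \<phi>)"

text \<open>The length of a formula written over a finite alphabet, where the variable with number
  \<open>x\<close> is a letter followed by \<open>x\<close> strokes.\<close>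

fun formula_length :: "mso2 \<Rightarrow> nat" where
  "formula_length (Eq_V x y) = 1 + Suc x + Suc y"
| "formula_length (Eq_E e f) = 1 + Suc e + Suc f"
| "formula_length (Adj x y) = 1 + Suc x + Suc y"
| "formula_length (Inc x e) = 1 + Suc x + Suc e"
| "formula_length (Less x y) = 1 + Suc x + Suc y"
| "formula_length (Mem_V x X) = 1 + Suc x + Suc X"
| "formula_length (Mem_E e F) = 1 + Suc e + Suc F"
| "formula_length (Neg \<phi>) = 1 + formula_length \<phi>"
| "formula_length (Conj \<phi> \<psi>) = 1 + formula_length \<phi> + formula_length \<psi>"
| "formula_length (Ex_V x \<phi>) = 1 + Suc x + formula_length \<phi>"
| "formula_length (Ex_E e \<phi>) = 1 + Suc e + formula_length \<phi>"
| "formula_length (Ex_VS X \<phi>) = 1 + Suc X + formula_length \<phi>"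
| "formula_length (Ex_ES F \<phi>) = 1 + Suc F + formula_length \<phi>"


section \<open>Random access machines\<close>

text \<open>RAM programs in goto-free form, with uniform cost. The state consists of finitely many
  registers used by the program and an unbounded memory, all holding natural numbers. As
  addition and truncated subtraction are the only arithmetic operations, numbers have length
  linear in the running time and the input, so uniform cost is polynomially related to Turing
  machine time.\<close>

datatype ram =
    Set_Const nat nat     \<comment> \<open>\<open>r\<^sub>i := c\<close>\<close>
  | Add nat nat nat       \<comment> \<open>\<open>r\<^sub>i := r\<^sub>j + r\<^sub>k\<close>\<close>
  | Sub nat nat nat       \<comment> \<open>\<open>r\<^sub>i := r\<^sub>j - r\<^sub>k\<close>, truncated\<close>
  | Load nat nat          \<comment> \<open>\<open>r\<^sub>i := mem[r\<^sub>j]\<close>\<close>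
  | Store nat nat         \<comment> \<open>\<open>mem[r\<^sub>i] := r\<^sub>j\<close>\<close>
  | Seq ram ram
  | If_Nonzero nat ram ram
  | While_Nonzero nat ram

text \<open>\<open>exec p (r, m) t (r', m')\<close>: started with registers \<open>r\<close> and memory \<open>m\<close>, the program \<open>p\<close>
  halts after exactly \<open>t\<close> steps with \<open>r'\<close> and \<open>m'\<close>.\<close>

type_synonym ram_state = "(nat \<Rightarrow> nat) \<times> (nat \<Rightarrow> nat)"

inductive exec :: "ram \<Rightarrow> ram_state \<Rightarrow> nat \<Rightarrow> ram_state \<Rightarrow> bool" where
  Set_Const: "exec (Set_Const i c) (r, m) 1 (r(i := c), m)"
| Add: "exec (Add i j k) (r, m) 1 (r(i := r j + r k), m)"
| Sub: "exec (Sub i j k) (r, m) 1 (r(i := r j - r k), m)"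
| Load: "exec (Load i j) (r, m) 1 (r(i := m (r j)), m)"
| Store: "exec (Store i j) (r, m) 1 (r, m(r i := r j))"
| Seq: "exec p s t s' \<Longrightarrow> exec q s' t' s'' \<Longrightarrow> exec (Seq p q) s (t + t') s''"
| If_True: "fst s i \<noteq> 0 \<Longrightarrow> exec p s t s' \<Longrightarrow> exec (If_Nonzero i p q) s (1 + t) s'"
| If_False: "fst s i = 0 \<Longrightarrow> exec q s t s' \<Longrightarrow> exec (If_Nonzero i p q) s (1 + t) s'"
| While_True: "fst s i \<noteq> 0 \<Longrightarrow> exec p s t s' \<Longrightarrow> exec (While_Nonzero i p) s' t' s'' \<Longrightarrow>
    exec (While_Nonzero i p) s (1 + t + t') s''"
| While_False: "fst s i = 0 \<Longrightarrow> exec (While_Nonzero i p) s 1 s"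

lemma exec_deterministic:
  "exec p s t1 s1 \<Longrightarrow> exec p s t2 s2 \<Longrightarrow> t2 = t1 \<and> s2 = s1"
proof (induction arbitrary: t2 s2 rule: exec.induct)
  case (Seq p s t s' q t' s'')
  from Seq.prems show ?case
    by cases (metis Seq.IH)
next
  case (If_True s i p t s' q)
  from If_True.prems show ?case
    by cases (use If_True.hyps If_True.IH in blast)+
next
  case (If_False s i q t s' p)
  from If_False.prems show ?case
    by cases (use If_False.hyps If_False.IH in blast)+
next
  case (While_True s i p t s' t' s'')
  note IH = While_True.IH and nz = While_True.hyps(1)
  from While_True.prems show ?case
  proof cases
    case (While_True u u' u'')
    then show ?thesis by (metis IH)
  next
    case While_False
    with nz show ?thesis by blast
  qed
next
  case (While_False s i p)
  from While_False.prems show ?case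
    by cases (use While_False.hyps in blast)+
qed (erule exec.cases; simp)+

definition ram_init :: "nat list \<Rightarrow> ram_state" where
  "ram_init xs = ((\<lambda>_. 0)(0 := length xs), (\<lambda>i. if i < length xs then xs ! i else 0))"

text \<open>Register 0 holds the input length at the start and the verdict at the end.\<close>

definition ram_accepts_in :: "ram \<Rightarrow> nat list \<Rightarrow> nat \<Rightarrow> bool" where
  "ram_accepts_in p xs t \<longleftrightarrow> (\<exists>s. exec p (ram_init xs) t s \<and> fst s 0 \<noteq> 0)"

definition ram_rejects_in :: "ram \<Rightarrow> nat list \<Rightarrow> nat \<Rightarrow> bool" where
  "ram_rejects_in p xs t \<longleftrightarrow> (\<exists>s. exec p (ram_init xs) t s \<and> fst s 0 = 0)"


section \<open>Fixed-parameter tractability\<close>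

text \<open>A parameterised problem on a set of admissible instances. The relation \<open>pp_code\<close> says
  which words encode an instance; an instance may have several encodings (different orders of
  its vertices and edges), and an algorithm must be correct on all of them. Nothing is required
  on words that encode no admissible instance.\<close>

record 'i param_problem =
  pp_instances :: "'i set"
  pp_code :: "'i \<Rightarrow> nat list \<Rightarrow> bool"
  pp_yes :: "'i \<Rightarrow> bool"
  pp_param :: "'i \<Rightarrow> nat"
  pp_size :: "'i \<Rightarrow> nat"

definition fpt :: "'i param_problem \<Rightarrow> bool" where
  "fpt P \<longleftrightarrow>
     (\<exists>p (f :: nat \<Rightarrow> nat) c. \<forall>I\<in>pp_instances P. \<forall>xs. pp_code P I xs \<longrightarrow>
        (\<exists>t \<le> f (pp_param P I) * pp_size P I ^ c.
           if pp_yes P I then ram_accepts_in p xs t else ram_rejects_in p xs t))"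


section \<open>The model-checking problem\<close>

text \<open>Prefix notation, hence self-delimiting.\<close>

fun formula_code :: "mso2 \<Rightarrow> nat list" where
  "formula_code (Eq_V x y) = [0, x, y]"
| "formula_code (Eq_E e f) = [1, e, f]"
| "formula_code (Adj x y) = [2, x, y]"
| "formula_code (Inc x e) = [3, x, e]"
| "formula_code (Less x y) = [4, x, y]"
| "formula_code (Mem_V x X) = [5, x, X]"
| "formula_code (Mem_E e F) = [6, e, F]"
| "formula_code (Neg \<phi>) = 7 # formula_code \<phi>"
| "formula_code (Conj \<phi> \<psi>) = 8 # formula_code \<phi> @ formula_code \<psi>"
| "formula_code (Ex_V x \<phi>) = 9 # x # formula_code \<phi>"
| "formula_code (Ex_E e \<phi>) = 10 # e # formula_code \<phi>"
| "formula_code (Ex_VS X \<phi>) = 11 # X # formula_code \<phi>"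
| "formula_code (Ex_ES F \<phi>) = 12 # F # formula_code \<phi>"

text \<open>Edge-list representation: number of vertices, number of edges, then each edge exactly once
  as a pair of vertex numbers, with respect to some enumeration \<open>vs\<close> of the vertices.\<close>

definition graph_code :: "'v graph \<Rightarrow> nat list \<Rightarrow> bool" where
  "graph_code G xs \<longleftrightarrow>
     (\<exists>vs es. distinct vs \<and> set vs = verts G \<and>
        (\<forall>(i, j)\<in>set es. i < length vs \<and> j < length vs) \<and>
        distinct (map (\<lambda>(i, j). {vs ! i, vs ! j}) es) \<and>
        set (map (\<lambda>(i, j). {vs ! i, vs ! j}) es) = edges G \<and>
        xs = length vs # length es # concat (map (\<lambda>(i, j). [i, j]) es))"

text \<open>The summand 1 keeps a bound of the form \<open>f k * n ^ c\<close> positive for the empty graph.\<close>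

definition graph_size :: "'v graph \<Rightarrow> nat" where
  "graph_size G = 1 + card (verts G) + card (edges G)"

definition MC_ord_inv :: "nat graph set \<Rightarrow> (nat graph \<times> mso2) param_problem" where
  "MC_ord_inv C = \<lparr>
     pp_instances = {(G, \<phi>). G \<in> C \<and> sentence \<phi> \<and> order_invariant \<phi>},
     pp_code = (\<lambda>(G, \<phi>) xs. \<exists>ys. graph_code G ys \<and> xs = formula_code \<phi> @ ys),
     pp_yes = (\<lambda>(G, \<phi>). models_ord_inv G \<phi>),
     pp_param = (\<lambda>(G, \<phi>). formula_length \<phi>),
     pp_size = (\<lambda>(G, \<phi>). graph_size G)\<rparr>"

end

(*
The program decides the formula by dynamic programming over pairs (S, v), where S is a tuple of at
most k+1 vertices and v names a component C of G - S. For each component it computes the state of a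
finite automaton for the formula on some labelled term whose leaves are the vertices of C and the
edges meeting C, a label recording the slots of S an element is adjacent to. Reading the leaves from
left to right orders the vertices of C, and joining two terms concatenates their orders, so "<" is
just another relation the automaton handles. The automaton sees a different order for every way in
which the table is filled, but the state at the root belongs to some linear order of V(G), and by
order-invariance any of them gives the answer.

A tree decomposition never has to be computed: a decomposition of width k yields a chordal
supergraph with a proper (k+1)-colouring and a perfect elimination order, and this certificate
guarantees that the table fills up within n rounds, the colour of a vertex being its slot.

The automaton is built from the formula (complement, product, powerset) in time depending on the
formula only, and the dynamic program needs time polynomial in the sizes of the graph and of the
automaton tables.
*)

theory Submission imports Defs "HOL-Library.Nat_Bijection" begin

section \<open>Functional programs on the RAM\<close>

text \<open>Only some function of the formula length times a polynomial is asked for, and there are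
  finitely many formulas of each length. Any cost that depends on the formula alone can therefore be
  summed into \<open>f\<close>. The automaton grows exponentially with every quantifier, but its
  construction needs no time analysis, just a terminating program; only the parser and the dynamic
  program need genuine bounds. The number \<open>K = k + 1\<close> of slots depends on the class
  alone, so running through all \<open>K\<close>-tuples of vertices is a polynomial factor, and
  exhaustive search replaces the choice of good separators. Soundness and completeness are kept
  apart: a table entry is justified by an explicit term whatever the search did, and the certificate
  is used only to show that entries exist. Hence the program never sees the elimination order or the
  colouring. Edges are leaves of their own, tied to vertices by incidence; this turns edge-set
  quantifiers into set quantifiers over leaves. A concrete RAM program is required. The algorithm is
  therefore written as folds over lists, and closure rules turn such functions into
  programs.\<close>

declare split_paired_All [simp del] split_paired_Ex [simp del]

text \<open>Calling convention: data live in an immutable heap of two-word cells, register 0 points to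
  the first free memory cell, and a program working at register \<open>k\<close> finds its argument there, leaves
  its result there and does not touch the registers between 0 and \<open>k\<close>.\<close>

definition frame :: "nat \<Rightarrow> ram_state \<Rightarrow> ram_state \<Rightarrow> bool" where
  "frame k s s' \<longleftrightarrow> fst s 0 \<le> fst s' 0 \<and> (\<forall>a<fst s 0. snd s' a = snd s a) \<and>
     (\<forall>i. 0 < i \<and> i < k \<longrightarrow> fst s' i = fst s i)"

lemma frame_refl [simp]: "frame k s s"
  by (simp add: frame_def)

lemma frame_trans: "frame k s s' \<Longrightarrow> frame k' s' s'' \<Longrightarrow> k \<le> k' \<Longrightarrow> frame k s s''"
  by (auto simp: frame_def)

lemma frame_mono: "frame k' s s' \<Longrightarrow> k \<le> k' \<Longrightarrow> frame k s s'"
  by (auto simp: frame_def)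

lemma frame_reg: "frame k s s' \<Longrightarrow> 0 < i \<Longrightarrow> i < k \<Longrightarrow> fst s' i = fst s i"
  by (auto simp: frame_def)

lemma frame_pos: "frame k s s' \<Longrightarrow> 0 < fst s 0 \<Longrightarrow> 0 < fst s' 0"
  by (auto simp: frame_def)

section \<open>Representation of values on the heap\<close>

definition yields :: "ram \<Rightarrow> ram_state \<Rightarrow> nat \<Rightarrow> nat \<Rightarrow> (ram_state \<Rightarrow> nat \<Rightarrow> bool) \<Rightarrow> bool" where
  "yields p s k c X \<longleftrightarrow> (\<exists>t s'. exec p s t s' \<and> t \<le> c \<and> frame k s s' \<and> X s' (fst s' k))"

lemma yieldsI: "exec p s t s' \<Longrightarrow> t \<le> c \<Longrightarrow> frame k s s' \<Longrightarrow> X s' (fst s' k) \<Longrightarrow> yields p s k c X"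
  by (auto simp: yields_def)

lemma yieldsE:
  assumes "yields p s k c X"
  obtains t s' where "exec p s t s'" "t \<le> c" "frame k s s'" "X s' (fst s' k)"
  using assms by (auto simp: yields_def)

text \<open>Besides persistence under heap growth, each single value must be producible by some
  program. Hence every element of the type may serve as a program constant; the default
  \<open>hd []\<close> in \<open>TC_hd\<close> and the precomputed tables of the atomic automata
  rely on this.\<close>

class rep =
  fixes rep :: "ram_state \<Rightarrow> nat \<Rightarrow> 'a \<Rightarrow> bool"
  assumes rep_frame: "rep s v x \<Longrightarrow> frame k s s' \<Longrightarrow> rep s' v x"
    and rep_const: "\<exists>P c. \<forall>k\<ge>1. \<forall>s. 0 < fst s 0 \<longrightarrow>
      yields (P k) s k c (\<lambda>s v. rep s v x)"

lemma exec_Set: "exec (Set_Const i c) s 1 ((fst s)(i := c), snd s)"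
  by (metis exec.Set_Const prod.collapse)

lemma exec_Add: "exec (Add i j k) s 1 ((fst s)(i := fst s j + fst s k), snd s)"
  by (metis exec.Add prod.collapse)

lemma exec_Sub: "exec (Sub i j k) s 1 ((fst s)(i := fst s j - fst s k), snd s)"
  by (metis exec.Sub prod.collapse)

lemma exec_Load: "exec (Load i j) s 1 ((fst s)(i := snd s (fst s j)), snd s)"
  by (metis exec.Load prod.collapse)

lemma exec_Store: "exec (Store i j) s 1 (fst s, (snd s)(fst s i := fst s j))"
  by (metis exec.Store prod.collapse)

lemma exec_eq: "exec p s t s' \<Longrightarrow> t = T \<Longrightarrow> s' = S \<Longrightarrow> exec p s T S"
  by simp

lemma exec_Seq': "exec p s t s' \<Longrightarrow> exec q s' t' s'' \<Longrightarrow> T = t + t' \<Longrightarrow> exec (Seq p q) s T s''"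
  by (auto intro: exec.intros)

definition copy :: "nat \<Rightarrow> nat \<Rightarrow> ram" where
  "copy i j = Seq (Set_Const i 0) (Add i i j)"

lemma exec_copy: "i \<noteq> j \<Longrightarrow> exec (copy i j) s 2 ((fst s)(i := fst s j), snd s)"
  unfolding copy_def
  apply (rule exec_Seq')
    apply (rule exec_Set)
   apply (rule exec_eq, rule exec_Add)
    apply (auto simp: fun_eq_iff)
  done

text \<open>Register \<open>c\<close> is scratch space; it may not coincide with \<open>b\<close>, which is read after \<open>c\<close> is set.\<close>

definition cell :: "nat \<Rightarrow> nat \<Rightarrow> nat \<Rightarrow> nat \<Rightarrow> ram" where
  "cell d a b c = Seq (Store 0 a) (Seq (Set_Const c 1) (Seq (Add 0 0 c) (Seq (Store 0 b)
     (Seq (Add 0 0 c) (Seq (Add c c c) (Sub d 0 c))))))"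

text \<open>The free pointer has already moved when the address of the new cell is needed; the
  address is recovered as the new pointer minus 2, the value left in \<open>c\<close>. As
  \<open>a\<close> is stored first and \<open>d\<close> is written last, the two may
  coincide.\<close>

lemma exec_cell:
  assumes "c \<noteq> 0" "c \<noteq> b" "b \<noteq> 0" "d \<noteq> 0"
  shows "exec (cell d a b c) s 7
    ((fst s)(0 := fst s 0 + 2, c := 2, d := fst s 0),
     (snd s)(fst s 0 := fst s a, fst s 0 + 1 := fst s b))"
  unfolding cell_def
  apply (rule exec_Seq', rule exec_Store)
   apply (rule exec_Seq', rule exec_Set)
    apply (rule exec_Seq', rule exec_Add)
     apply (rule exec_Seq', rule exec_Store)
      apply (rule exec_Seq', rule exec_Add)
       apply (rule exec_Seq', rule exec_Add)
        apply (rule exec_eq, rule exec_Sub)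
         using assms
         apply (auto simp: fun_eq_iff)
  done

instantiation nat :: rep
begin
definition rep_nat :: "ram_state \<Rightarrow> nat \<Rightarrow> nat \<Rightarrow> bool" where
  "rep_nat s v x \<longleftrightarrow> v = x"
instance
proof
  fix x :: nat
  have "yields (Set_Const k x) s k 1 (\<lambda>s v. rep s v x)" if "k \<ge> 1" for k s
    by (rule yieldsI, rule exec_Set) (use that in \<open>auto simp: frame_def rep_nat_def\<close>)
  then show "\<exists>P c. \<forall>k\<ge>1. \<forall>s. 0 < fst s 0 \<longrightarrow>
      yields (P k) s k c (\<lambda>s v. rep s v x)"
    by (intro exI[of _ "\<lambda>k. Set_Const k x"] exI[of _ 1]) simp
qed (auto simp: rep_nat_def)
end

instantiation bool :: rep
begin
definition rep_bool :: "ram_state \<Rightarrow> nat \<Rightarrow> bool \<Rightarrow> bool" where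
  "rep_bool s v x \<longleftrightarrow> v = of_bool x"
instance
proof
  fix x :: bool
  have "yields (Set_Const k (of_bool x)) s k 1 (\<lambda>s v. rep s v x)" if "k \<ge> 1" for k s
    by (rule yieldsI, rule exec_Set) (use that in \<open>auto simp: frame_def rep_bool_def\<close>)
  then show "\<exists>P c. \<forall>k\<ge>1. \<forall>s. 0 < fst s 0 \<longrightarrow>
      yields (P k) s k c (\<lambda>s v. rep s v x)"
    by (intro exI[of _ "\<lambda>k. Set_Const k (of_bool x)"] exI[of _ 1]) simp
qed (auto simp: rep_bool_def)
end

text \<open>Address 0 is excluded so that the value 0 can stand for the empty list. Lying below the
  free pointer is what protects both words under \<open>frame\<close>.\<close>

definition cell_at :: "ram_state \<Rightarrow> nat \<Rightarrow> bool" where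
  "cell_at s v \<longleftrightarrow> 0 < v \<and> v + 1 < fst s 0"

lemma cell_at_frame: "cell_at s v \<Longrightarrow> frame k s s' \<Longrightarrow>
    cell_at s' v \<and> snd s' v = snd s v \<and> snd s' (v + 1) = snd s (v + 1)"
  by (auto simp: cell_at_def frame_def)

text \<open>Stated for arbitrary predicates instead of \<open>rep\<close>, because the induction for
  lists applies it to a tail before lists are an instance of the class.\<close>

lemma cell_const:
  fixes X Y :: "ram_state \<Rightarrow> nat \<Rightarrow> bool"
  assumes PX: "\<exists>P c. \<forall>k\<ge>1. \<forall>s. 0 < fst s 0 \<longrightarrow> yields (P k) s k c X"
    and PY: "\<exists>P c. \<forall>k\<ge>1. \<forall>s. 0 < fst s 0 \<longrightarrow> yields (P k) s k c Y"
    and X: "\<And>s v k s'. X s v \<Longrightarrow> frame k s s' \<Longrightarrow> X s' v"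
    and Y: "\<And>s v k s'. Y s v \<Longrightarrow> frame k s s' \<Longrightarrow> Y s' v"
  shows "\<exists>P c. \<forall>k\<ge>1. \<forall>s. 0 < fst s 0 \<longrightarrow>
      yields (P k) s k c (\<lambda>s v. cell_at s v \<and> X s (snd s v) \<and> Y s (snd s (v + 1)))"
proof -
  obtain P c where P: "\<forall>k\<ge>1. \<forall>s. 0 < fst s 0 \<longrightarrow> yields (P k) s k c X"
    using PX by (elim exE)
  obtain Q d where Q: "\<forall>k\<ge>1. \<forall>s. 0 < fst s 0 \<longrightarrow> yields (Q k) s k d Y"
    using PY by (elim exE)
  have "yields (Seq (P k) (Seq (Q (k+1)) (cell k k (k+1) (k+2)))) s k (c + d + 7)
      (\<lambda>s v. cell_at s v \<and> X s (snd s v) \<and> Y s (snd s (v + 1)))"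
    if k: "k \<ge> 1" and h: "0 < fst s 0" for k s
  proof -
    obtain t1 s1 where 1: "exec (P k) s t1 s1" "t1 \<le> c" "frame k s s1" "X s1 (fst s1 k)"
      using P k h by (blast elim: yieldsE)
    have h1: "0 < fst s1 0" using 1(3) h by (rule frame_pos)
    have "yields (Q (k+1)) s1 (k+1) d Y" using Q h1 by simp
    then obtain t2 s2 where 2: "exec (Q (k+1)) s1 t2 s2" "t2 \<le> d" "frame (k+1) s1 s2"
        "Y s2 (fst s2 (k+1))"
      by (rule yieldsE)
    have h2: "0 < fst s2 0" using 2(3) h1 by (rule frame_pos)
    let ?s3 = "((fst s2)(0 := fst s2 0 + 2, k+2 := 2, k := fst s2 0),
        (snd s2)(fst s2 0 := fst s2 k, fst s2 0 + 1 := fst s2 (k+1)))"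
    have 3: "exec (cell k k (k+1) (k+2)) s2 7 ?s3"
      by (rule exec_cell) (use k in auto)
    have f3: "frame k s2 ?s3" using k by (auto simp: frame_def)
    have x2: "X s2 (fst s2 k)"
      using X[OF 1(4) 2(3)] frame_reg[OF 2(3), of k] k by simp
    have f: "frame k s ?s3"
      using frame_trans[OF frame_trans[OF 1(3) 2(3)] f3] by simp
    show ?thesis
    proof (rule yieldsI[OF exec.Seq[OF 1(1) exec.Seq[OF 2(1) 3]] _ f], goal_cases)
      case 1 show ?case using \<open>t1 \<le> c\<close> \<open>t2 \<le> d\<close> by simp
    next
      case 2
      have "cell_at ?s3 (fst ?s3 k)" using h2 k by (simp add: cell_at_def)
      moreover have "X ?s3 (snd ?s3 (fst ?s3 k))"
        using X[OF x2 f3] k by simp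
      moreover have "Y ?s3 (snd ?s3 (fst ?s3 k + 1))"
        using Y[OF \<open>Y s2 (fst s2 (k+1))\<close> f3] k by simp
      ultimately show ?case by blast
    qed
  qed
  then show ?thesis
    by (intro exI[of _ "\<lambda>k. Seq (P k) (Seq (Q (k+1)) (cell k k (k+1) (k+2)))"] exI[of _ "c+d+7"]) simp
qed

instantiation prod :: (rep, rep) rep
begin
definition rep_prod :: "ram_state \<Rightarrow> nat \<Rightarrow> 'a \<times> 'b \<Rightarrow> bool" where
  "rep_prod s v x \<longleftrightarrow> cell_at s v \<and> rep s (snd s v) (fst x) \<and> rep s (snd s (v + 1)) (snd x)"
instance
proof
  fix s s' v k and x :: "'a \<times> 'b"
  assume "rep s v x" and f: "frame k s s'"
  then show "rep s' v x"
    using cell_at_frame[OF _ f, of v] rep_frame[OF _ f, where 'a='a] rep_frame[OF _ f, where 'a='b]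
    by (auto simp: rep_prod_def)
next
  fix x :: "'a \<times> 'b"
  show "\<exists>P c. \<forall>k\<ge>1. \<forall>s. 0 < fst s 0 \<longrightarrow>
      yields (P k) s k c (\<lambda>s v. rep s v x)"
    unfolding rep_prod_def
    by (rule cell_const[OF rep_const rep_const]) (auto intro: rep_frame)
qed
end

instantiation list :: (rep) rep
begin
primrec rep_list :: "ram_state \<Rightarrow> nat \<Rightarrow> 'a list \<Rightarrow> bool" where
  "rep_list s v [] \<longleftrightarrow> v = 0"
| "rep_list s v (x # xs) \<longleftrightarrow> cell_at s v \<and> rep s (snd s v) x \<and> rep_list s (snd s (v + 1)) xs"
instance
proof
  fix s s' v k and x :: "'a list"
  assume "rep s v x" and f: "frame k s s'"
  then show "rep s' v x"
  proof (induction x arbitrary: v)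
    case (Cons y ys)
    then show ?case
      using cell_at_frame[OF _ f, of v] rep_frame[OF _ f] by auto
  qed simp
next
  have stable: "rep s' v x" if "rep s v x" "frame k s s'" for s s' v k and x :: "'a list"
    using that(1)
  proof (induction x arbitrary: v)
    case (Cons y ys)
    then show ?case
      using cell_at_frame[OF _ that(2), of v] rep_frame[OF _ that(2)] by auto
  qed simp
  fix x :: "'a list"
  show "\<exists>P c. \<forall>k\<ge>1. \<forall>s. 0 < fst s 0 \<longrightarrow>
      yields (P k) s k c (\<lambda>s v. rep s v x)"
  proof (induction x)
    case Nil
    show ?case using rep_const[of "0::nat"] by (simp add: rep_nat_def)
  next
    case (Cons a x)
    show ?case
      unfolding rep_list.simps
      by (rule cell_const[OF rep_const Cons]) (auto intro: rep_frame stable)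
  qed
qed
end

section \<open>Time-bounded computability and its closure under basic operations\<close>

definition implements :: "(nat \<Rightarrow> ram) \<Rightarrow> ('a::rep \<Rightarrow> bool) \<Rightarrow> ('a \<Rightarrow> 'b::rep) \<Rightarrow> ('a \<Rightarrow> nat) \<Rightarrow> bool" where
  "implements P D f \<tau> \<longleftrightarrow> (\<forall>k\<ge>1. \<forall>s x. 0 < fst s 0 \<longrightarrow> D x \<longrightarrow> rep s (fst s k) x \<longrightarrow>
     yields (P k) s k (\<tau> x) (\<lambda>s v. rep s v (f x)))"

lemma implementsD: "implements P D f \<tau> \<Longrightarrow> k \<ge> 1 \<Longrightarrow> 0 < fst s 0 \<Longrightarrow> D x \<Longrightarrow> rep s (fst s k) x \<Longrightarrow>
    yields (P k) s k (\<tau> x) (\<lambda>s v. rep s v (f x))"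
  unfolding implements_def by simp

text \<open>Computability on \<open>D\<close> by one program within time \<open>\<tau>\<close>. The
  closure rules act on HOL functions, so that algorithms can be stated and verified as ordinary
  functions.\<close>

definition TC :: "('a::rep \<Rightarrow> bool) \<Rightarrow> ('a \<Rightarrow> 'b::rep) \<Rightarrow> ('a \<Rightarrow> nat) \<Rightarrow> bool" where
  "TC D f \<tau> \<longleftrightarrow> (\<exists>P. implements P D f \<tau>)"

lemma TCI:
  assumes "\<And>k s x. k \<ge> 1 \<Longrightarrow> 0 < fst s 0 \<Longrightarrow> D x \<Longrightarrow> rep s (fst s k) x \<Longrightarrow>
     yields (P k) s k (\<tau> x) (\<lambda>s v. rep s v (f x))"
  shows "TC D f \<tau>"
  unfolding TC_def implements_def by (intro exI[of _ P] allI impI assms)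

lemma TCE:
  assumes "TC D f \<tau>"
  obtains P where "implements P D f \<tau>"
  using assms unfolding TC_def by (elim exE)

lemma TC_mono:
  assumes f: "TC D f \<tau>" and D: "\<And>x. E x \<Longrightarrow> D x" and le: "\<And>x. E x \<Longrightarrow> \<tau> x \<le> \<sigma> x"
    and eq: "\<And>x. E x \<Longrightarrow> f x = g x"
  shows "TC E g \<sigma>"
proof -
  obtain P where "implements P D f \<tau>" using f by (rule TCE)
  note P = implementsD[OF this]
  show ?thesis
  proof (rule TCI[where P=P])
    fix k s x assume a: "k \<ge> (1::nat)" "0 < fst s 0" "E x" "rep s (fst s k) x"
    obtain t s' where 1: "exec (P k) s t s'" "t \<le> \<tau> x" "frame k s s'" "rep s' (fst s' k) (f x)"
      using P[OF a(1,2), of x] D[OF a(3)] a(4) by (auto elim: yieldsE)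
    show "yields (P k) s k (\<sigma> x) (\<lambda>s v. rep s v (g x))"
      by (rule yieldsI[OF 1(1) _ 1(3)]) (use 1 le[OF a(3)] eq[OF a(3)] in auto)
  qed
qed

lemma TC_id: "TC D (\<lambda>x. x) (\<lambda>_. 1)"
  \<comment> \<open>A write to the free register \<open>k+1\<close> stands in for a skip
    instruction.\<close>
  by (rule TCI[where P="\<lambda>k. Set_Const (k+1) 0"], rule yieldsI, rule exec_Set)
    (auto simp: frame_def intro: rep_frame[where k=0])

lemma TC_const: "\<exists>c. TC D (\<lambda>_. a) (\<lambda>_. c)"
proof -
  obtain P c where P: "\<forall>k\<ge>1. \<forall>s. 0 < fst s 0 \<longrightarrow> yields (P k) s k c (\<lambda>s v. rep s v a)"
    using rep_const[of a] by (elim exE)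
  then show ?thesis
    by (intro exI[of _ c] TCI[where P=P]) simp
qed

lemma TC_comp:
  assumes f: "TC D f \<tau>" and g: "TC E g \<sigma>" and DE: "\<And>x. D x \<Longrightarrow> E (f x)"
  shows "TC D (\<lambda>x. g (f x)) (\<lambda>x. \<tau> x + \<sigma> (f x))"
proof -
  obtain P where "implements P D f \<tau>" using f by (rule TCE)
  note P = implementsD[OF this]
  obtain Q where "implements Q E g \<sigma>" using g by (rule TCE)
  note Q = implementsD[OF this]
  show ?thesis
  proof (rule TCI[where P="\<lambda>k. Seq (P k) (Q k)"])
    fix k s x assume a: "k \<ge> (1::nat)" "0 < fst s 0" "D x" "rep s (fst s k) x"
    obtain t1 s1 where 1: "exec (P k) s t1 s1" "t1 \<le> \<tau> x" "frame k s s1" "rep s1 (fst s1 k) (f x)"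
      using P[OF a] by (rule yieldsE)
    obtain t2 s2 where 2: "exec (Q k) s1 t2 s2" "t2 \<le> \<sigma> (f x)" "frame k s1 s2" "rep s2 (fst s2 k) (g (f x))"
      using Q[OF a(1) frame_pos[OF 1(3) a(2)] DE[OF a(3)] 1(4)] by (rule yieldsE)
    show "yields (Seq (P k) (Q k)) s k (\<tau> x + \<sigma> (f x)) (\<lambda>s v. rep s v (g (f x)))"
      by (rule yieldsI[OF exec.Seq[OF 1(1) 2(1)]]) (use 1 2 frame_trans[OF 1(3) 2(3)] in auto)
  qed
qed

text \<open>The argument stays in register \<open>k\<close> while \<open>f\<close> works at
  \<open>k+1\<close> and \<open>g\<close> at \<open>k+2\<close>, each on a copy; the 4 pays for the
  two copies.\<close>

lemma TC_binary:
  assumes f: "TC D f \<tau>" and g: "TC D g \<sigma>"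
    and Q: "\<And>k s x y. k \<ge> 1 \<Longrightarrow> 0 < fst s 0 \<Longrightarrow> rep s (fst s (k+1)) x \<Longrightarrow> rep s (fst s (k+2)) y \<Longrightarrow>
      yields (Q k) s k c (\<lambda>s v. rep s v (h x y))"
  shows "TC D (\<lambda>x. h (f x) (g x)) (\<lambda>x. \<tau> x + \<sigma> x + c + 4)"
proof -
  obtain P where "implements P D f \<tau>" using f by (rule TCE)
  note P = implementsD[OF this]
  obtain R where "implements R D g \<sigma>" using g by (rule TCE)
  note R = implementsD[OF this]
  show ?thesis
  proof (rule TCI[where P="\<lambda>k. Seq (copy (k+1) k) (Seq (P (k+1)) (Seq (copy (k+2) k) (Seq (R (k+2)) (Q k))))"])
    fix k s x assume a: "k \<ge> (1::nat)" "0 < fst s 0" "D x" "rep s (fst s k) x"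
    let ?s1 = "((fst s)(k+1 := fst s k), snd s)"
    have e1: "exec (copy (k+1) k) s 2 ?s1" by (rule exec_copy) simp
    have f1: "frame (k+1) s ?s1" by (simp add: frame_def)
    have x1: "rep ?s1 (fst s k) x" by (rule rep_frame[OF a(4) f1])
    have "yields (P (k+1)) ?s1 (k+1) (\<tau> x) (\<lambda>s v. rep s v (f x))"
      by (rule P) (use a x1 in auto)
    then obtain t2 s2 where 2: "exec (P (k+1)) ?s1 t2 s2" "t2 \<le> \<tau> x" "frame (k+1) ?s1 s2"
        "rep s2 (fst s2 (k+1)) (f x)" by (rule yieldsE)
    let ?s3 = "((fst s2)(k+2 := fst s2 k), snd s2)"
    have e3: "exec (copy (k+2) k) s2 2 ?s3" by (rule exec_copy) simp
    have f3: "frame (k+2) s2 ?s3" by (simp add: frame_def)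
    have r3: "fst ?s3 (k+2) = fst s k" using frame_reg[OF 2(3), of k] a(1) by simp
    have x3: "rep ?s3 (fst ?s3 (k+2)) x"
      unfolding r3 by (rule rep_frame[OF rep_frame[OF x1 2(3)] f3])
    have y3: "rep ?s3 (fst s2 (k+1)) (f x)" by (rule rep_frame[OF 2(4) f3])
    have h3: "0 < fst ?s3 0" using frame_pos[OF 2(3)] a(1,2) by simp
    have "yields (R (k+2)) ?s3 (k+2) (\<sigma> x) (\<lambda>s v. rep s v (g x))"
      by (rule R) (use a x3 h3 in auto)
    then obtain t4 s4 where 4: "exec (R (k+2)) ?s3 t4 s4" "t4 \<le> \<sigma> x" "frame (k+2) ?s3 s4"
        "rep s4 (fst s4 (k+2)) (g x)" by (rule yieldsE)
    have r4: "fst s4 (k+1) = fst s2 (k+1)" using frame_reg[OF 4(3), of "k+1"] by simp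
    have y4: "rep s4 (fst s4 (k+1)) (f x)" unfolding r4 by (rule rep_frame[OF y3 4(3)])
    obtain t5 s5 where 5: "exec (Q k) s4 t5 s5" "t5 \<le> c" "frame k s4 s5"
        "rep s5 (fst s5 k) (h (f x) (g x))"
      using Q[OF a(1) frame_pos[OF 4(3) h3] y4 4(4)] by (rule yieldsE)
    have fr: "frame k s s5"
      using frame_trans[OF frame_trans[OF frame_trans[OF frame_trans[OF f1 2(3)] f3] 4(3), of] _, of k] 
        frame_mono[OF f1, of k] frame_mono[OF 2(3), of k] frame_mono[OF f3, of k] frame_mono[OF 4(3), of k] 5(3)
      by (meson frame_trans le_add1 order_refl)
    show "yields (Seq (copy (k+1) k) (Seq (P (k+1)) (Seq (copy (k+2) k) (Seq (R (k+2)) (Q k))))) s k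
        (\<tau> x + \<sigma> x + c + 4) (\<lambda>s v. rep s v (h (f x) (g x)))"
      by (rule yieldsI[where s'=s5, OF exec.Seq[OF e1 exec.Seq[OF 2(1) exec.Seq[OF e3 exec.Seq[OF 4(1) 5(1)]]]]])
        (use 2 4 5 fr in auto)
  qed
qed

lemma TC_cell:
  assumes f: "TC D f \<tau>" and g: "TC D g \<sigma>"
    and h: "\<And>s v x y. cell_at s v \<Longrightarrow> rep s (snd s v) x \<Longrightarrow> rep s (snd s (v + 1)) y \<Longrightarrow> rep s v (h x y)"
  shows "TC D (\<lambda>x. h (f x) (g x)) (\<lambda>x. \<tau> x + \<sigma> x + 11)"
proof -
  have "yields (cell k (k+1) (k+2) (k+3)) s k 7 (\<lambda>s v. rep s v (h x y))"
    if a: "k \<ge> 1" "0 < fst s 0" "rep s (fst s (k+1)) x" "rep s (fst s (k+2)) y" for k s x y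
  proof -
    let ?s3 = "((fst s)(0 := fst s 0 + 2, k+3 := 2, k := fst s 0),
        (snd s)(fst s 0 := fst s (k+1), fst s 0 + 1 := fst s (k+2)))"
    have e: "exec (cell k (k+1) (k+2) (k+3)) s 7 ?s3"
      by (rule exec_cell) (use a in auto)
    have f: "frame k s ?s3" using a by (auto simp: frame_def)
    have "rep ?s3 (fst ?s3 k) (h x y)"
    proof (rule h)
      show "cell_at ?s3 (fst ?s3 k)" using a by (simp add: cell_at_def)
      show "rep ?s3 (snd ?s3 (fst ?s3 k)) x" using rep_frame[OF a(3) f] by simp
      show "rep ?s3 (snd ?s3 (fst ?s3 k + 1)) y" using rep_frame[OF a(4) f] a by simp
    qed
    then show ?thesis using f by (intro yieldsI[OF e]) auto
  qed
  from TC_binary[OF f g this] show ?thesis by (simp add: add.assoc)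
qed

lemma TC_Pair: "TC D f \<tau> \<Longrightarrow> TC D g \<sigma> \<Longrightarrow> TC D (\<lambda>x. (f x, g x)) (\<lambda>x. \<tau> x + \<sigma> x + 11)"
  by (rule TC_cell[where h=Pair]) (auto simp: rep_prod_def)

lemma TC_Cons: "TC D f \<tau> \<Longrightarrow> TC D g \<sigma> \<Longrightarrow> TC D (\<lambda>x. f x # g x) (\<lambda>x. \<tau> x + \<sigma> x + 11)"
  by (rule TC_cell[where h=Cons]) auto

lemma TC_add: "TC D f \<tau> \<Longrightarrow> TC D g \<sigma> \<Longrightarrow> TC D (\<lambda>x. f x + g x :: nat) (\<lambda>x. \<tau> x + \<sigma> x + 1 + 4)"
  by (rule TC_binary[where h="(+)" and Q="\<lambda>k. Add k (k+1) (k+2)"], assumption+, rule yieldsI, rule exec_Add)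
    (auto simp: frame_def rep_nat_def)

lemma TC_sub: "TC D f \<tau> \<Longrightarrow> TC D g \<sigma> \<Longrightarrow> TC D (\<lambda>x. f x - g x :: nat) (\<lambda>x. \<tau> x + \<sigma> x + 1 + 4)"
  by (rule TC_binary[where h="(-)" and Q="\<lambda>k. Sub k (k+1) (k+2)"], assumption+, rule yieldsI, rule exec_Sub)
    (auto simp: frame_def rep_nat_def)

lemma TC_fst0: "TC (\<lambda>_. True) (fst :: 'a::rep \<times> 'b::rep \<Rightarrow> 'a) (\<lambda>_. 1)"
proof (rule TCI[where P="\<lambda>k. Load k k"])
  fix k s and x :: "'a \<times> 'b"
  assume a: "k \<ge> (1::nat)" "rep s (fst s k) x"
  have f: "frame k s ((fst s)(k := snd s (fst s k)), snd s)" using a(1) by (simp add: frame_def)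
  show "yields (Load k k) s k 1 (\<lambda>s v. rep s v (fst x))"
    by (rule yieldsI[OF exec_Load _ f])
      (use a rep_frame[OF _ f, of "snd s (fst s k)" "fst x"] in \<open>auto simp: rep_prod_def\<close>)
qed

lemma exec_next:
  assumes "i \<noteq> j" shows "exec (Seq (Set_Const j 1) (Seq (Add i i j) (Load i i))) s 3
    ((fst s)(j := 1, i := snd s (fst s i + 1)), snd s)"
  apply (rule exec_Seq', rule exec_Set)
   apply (rule exec_Seq', rule exec_Add)
    apply (rule exec_eq, rule exec_Load)
     using assms
     apply (auto simp: fun_eq_iff)
  done

lemma TC_snd0: "TC (\<lambda>_. True) (snd :: 'a::rep \<times> 'b::rep \<Rightarrow> 'b) (\<lambda>_. 3)"
proof (rule TCI[where P="\<lambda>k. Seq (Set_Const (k+1) 1) (Seq (Add k k (k+1)) (Load k k))"])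
  fix k s and x :: "'a \<times> 'b"
  assume a: "k \<ge> (1::nat)" "rep s (fst s k) x"
  let ?s = "((fst s)(k+1 := 1, k := snd s (fst s k + 1)), snd s)"
  have f: "frame k s ?s" using a(1) by (simp add: frame_def)
  have e: "exec (Seq (Set_Const (k+1) 1) (Seq (Add k k (k+1)) (Load k k))) s 3 ?s"
    by (rule exec_next) simp
  show "yields (Seq (Set_Const (k+1) 1) (Seq (Add k k (k+1)) (Load k k))) s k 3 (\<lambda>s v. rep s v (snd x))"
    by (rule yieldsI[OF e _ f])
      (use a rep_frame[OF _ f, of "snd s (fst s k + 1)" "snd x"] in \<open>auto simp: rep_prod_def\<close>)
qed

lemma TC_fst: "TC D f \<tau> \<Longrightarrow> TC D (\<lambda>x. fst (f x)) (\<lambda>x. \<tau> x + 1)"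
  using TC_comp[OF _ TC_fst0] by blast

lemma TC_snd: "TC D f \<tau> \<Longrightarrow> TC D (\<lambda>x. snd (f x)) (\<lambda>x. \<tau> x + 3)"
  using TC_comp[OF _ TC_snd0] by blast

lemma rep_list_zero: "rep s v (x :: 'a::rep list) \<Longrightarrow> v = 0 \<longleftrightarrow> x = []"
  by (cases x) (auto simp: cell_at_def)

lemma TC_if:
  assumes b: "TC D b \<tau>" and f: "TC (\<lambda>x. D x \<and> b x) f \<sigma>" and g: "TC (\<lambda>x. D x \<and> \<not> b x) g \<sigma>'"
  shows "TC D (\<lambda>x. if b x then f x else g x) (\<lambda>x. \<tau> x + (if b x then \<sigma> x else \<sigma>' x) + 3)"
proof -
  obtain P where "implements P D b \<tau>" using b by (rule TCE)
  note P = implementsD[OF this]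
  obtain Q where "implements Q (\<lambda>x. D x \<and> b x) f \<sigma>" using f by (rule TCE)
  note Q = implementsD[OF this]
  obtain R where "implements R (\<lambda>x. D x \<and> \<not> b x) g \<sigma>'" using g by (rule TCE)
  note R = implementsD[OF this]
  show ?thesis
  proof (rule TCI[where P="\<lambda>k. Seq (copy (k+1) k) (Seq (P (k+1)) (If_Nonzero (k+1) (Q k) (R k)))"])
    fix k s x assume a: "k \<ge> (1::nat)" "0 < fst s 0" "D x" "rep s (fst s k) x"
    let ?s1 = "((fst s)(k+1 := fst s k), snd s)"
    have e1: "exec (copy (k+1) k) s 2 ?s1" by (rule exec_copy) simp
    have f1: "frame (k+1) s ?s1" by (simp add: frame_def)
    have x1: "rep ?s1 (fst s k) x" by (rule rep_frame[OF a(4) f1])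
    have "yields (P (k+1)) ?s1 (k+1) (\<tau> x) (\<lambda>s v. rep s v (b x))"
      by (rule P) (use a x1 in auto)
    then obtain t2 s2 where 2: "exec (P (k+1)) ?s1 t2 s2" "t2 \<le> \<tau> x" "frame (k+1) ?s1 s2"
        "rep s2 (fst s2 (k+1)) (b x)" by (rule yieldsE)
    have r2: "fst s2 k = fst s k" using frame_reg[OF 2(3), of k] a(1) by simp
    have x2: "rep s2 (fst s2 k) x" unfolding r2 by (rule rep_frame[OF x1 2(3)])
    have h2: "0 < fst s2 0" using frame_pos[OF 2(3)] a(1,2) by simp
    have f2: "frame k s s2" using frame_trans[OF f1 2(3)] frame_mono by (metis le_add1 order_refl)
    show "yields (Seq (copy (k+1) k) (Seq (P (k+1)) (If_Nonzero (k+1) (Q k) (R k)))) s k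
        (\<tau> x + (if b x then \<sigma> x else \<sigma>' x) + 3) (\<lambda>s v. rep s v (if b x then f x else g x))"
    proof (cases "b x")
      case True
      obtain t3 s3 where 3: "exec (Q k) s2 t3 s3" "t3 \<le> \<sigma> x" "frame k s2 s3" "rep s3 (fst s3 k) (f x)"
        using Q[OF a(1) h2 _ x2] a(3) True by (blast elim: yieldsE)
      have e3: "exec (If_Nonzero (k+1) (Q k) (R k)) s2 (1 + t3) s3"
        by (rule exec.If_True) (use 2(4) 3 True in \<open>auto simp: rep_bool_def\<close>)
      show ?thesis
        by (rule yieldsI[OF exec.Seq[OF e1 exec.Seq[OF 2(1) e3]]])
          (use True 2 3 frame_trans[OF f2 3(3)] in auto)
    next
      case False
      obtain t3 s3 where 3: "exec (R k) s2 t3 s3" "t3 \<le> \<sigma>' x" "frame k s2 s3" "rep s3 (fst s3 k) (g x)"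
        using R[OF a(1) h2 _ x2] a(3) False by (blast elim: yieldsE)
      have e3: "exec (If_Nonzero (k+1) (Q k) (R k)) s2 (1 + t3) s3"
        by (rule exec.If_False) (use 2(4) 3 False in \<open>auto simp: rep_bool_def\<close>)
      show ?thesis
        by (rule yieldsI[OF exec.Seq[OF e1 exec.Seq[OF 2(1) e3]]])
          (use False 2 3 frame_trans[OF f2 3(3)] in auto)
    qed
  qed
qed

lemma TC_eq0: "TC (\<lambda>_. True) (\<lambda>x::nat. x = 0) (\<lambda>_. 2)"
proof (rule TCI[where P="\<lambda>k. If_Nonzero k (Set_Const k 0) (Set_Const k 1)"])
  fix k s and x :: nat
  assume a: "k \<ge> (1::nat)" "rep s (fst s k) x"
  show "yields (If_Nonzero k (Set_Const k 0) (Set_Const k 1)) s k 2 (\<lambda>s v. rep s v (x = 0))"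
  proof (cases "x = 0")
    case True
    have "exec (If_Nonzero k (Set_Const k 0) (Set_Const k 1)) s (1 + 1) ((fst s)(k := 1), snd s)"
      by (rule exec.If_False[OF _ exec_Set]) (use a True in \<open>simp add: rep_nat_def\<close>)
    then show ?thesis
      by (rule yieldsI) (use a True in \<open>auto simp: rep_bool_def frame_def\<close>)
  next
    case False
    have "exec (If_Nonzero k (Set_Const k 0) (Set_Const k 1)) s (1 + 1) ((fst s)(k := 0), snd s)"
      by (rule exec.If_True[OF _ exec_Set]) (use a False in \<open>simp add: rep_nat_def\<close>)
    then show ?thesis
      by (rule yieldsI) (use a False in \<open>auto simp: rep_bool_def frame_def\<close>)
  qed
qed

text \<open>A list is empty iff its pointer is 0, so the program for \<open>x = 0\<close> works
  verbatim on the pointer.\<close>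

lemma TC_null0: "TC (\<lambda>_. True) (\<lambda>x::'a::rep list. x = []) (\<lambda>_. 2)"
proof -
  obtain P where "implements P (\<lambda>_. True) (\<lambda>x::nat. x = 0) (\<lambda>_. 2)" using TC_eq0 by (rule TCE)
  note P = implementsD[OF this]
  show ?thesis
  proof (rule TCI[where P=P])
    fix k s and x :: "'a list" assume a: "k \<ge> (1::nat)" "0 < fst s 0" "rep s (fst s k) x"
    show "yields (P k) s k 2 (\<lambda>s v. rep s v (x = []))"
      using P[OF a(1,2), of "fst s k"] rep_list_zero[OF a(3)] by (simp add: rep_nat_def)
  qed
qed

lemma TC_tl0: "TC (\<lambda>_. True) (tl :: 'a::rep list \<Rightarrow> 'a list) (\<lambda>_. 5)"
proof (rule TCI[where P="\<lambda>k. If_Nonzero k (Seq (Set_Const (k+1) 1) (Seq (Add k k (k+1)) (Load k k))) (Set_Const k 0)"])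
  fix k s and x :: "'a list"
  assume a: "k \<ge> (1::nat)" "rep s (fst s k) x"
  let ?p = "If_Nonzero k (Seq (Set_Const (k+1) 1) (Seq (Add k k (k+1)) (Load k k))) (Set_Const k 0)"
  show "yields ?p s k 5 (\<lambda>s v. rep s v (tl x))"
  proof (cases x)
    case Nil
    have "exec ?p s (1 + 1) ((fst s)(k := 0), snd s)"
      by (rule exec.If_False[OF _ exec_Set]) (use a Nil in simp)
    then show ?thesis
      by (rule yieldsI) (use a Nil in \<open>auto simp: frame_def\<close>)
  next
    case (Cons y ys)
    let ?s = "((fst s)(k+1 := 1, k := snd s (fst s k + 1)), snd s)"
    have f: "frame k s ?s" using a(1) by (simp add: frame_def)
    have e: "exec (Seq (Set_Const (k+1) 1) (Seq (Add k k (k+1)) (Load k k))) s 3 ?s"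
      by (rule exec_next) simp
    have "exec ?p s (1 + 3) ?s"
      by (rule exec.If_True[OF _ e]) (use a Cons in \<open>auto simp: cell_at_def\<close>)
    then show ?thesis
      by (rule yieldsI[OF _ _ f])
        (use a Cons rep_frame[OF _ f, of "snd s (fst s k + 1)" ys] in auto)
  qed
qed

lemma TC_hd0: "TC (\<lambda>x. x \<noteq> []) (hd :: 'a::rep list \<Rightarrow> 'a) (\<lambda>_. 1)"
proof (rule TCI[where P="\<lambda>k. Load k k"])
  fix k s and x :: "'a list"
  assume a: "k \<ge> (1::nat)" "rep s (fst s k) x" "x \<noteq> []"
  have f: "frame k s ((fst s)(k := snd s (fst s k)), snd s)" using a(1) by (simp add: frame_def)
  have "rep s (snd s (fst s k)) (hd x)" using a(2,3) by (cases x) auto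
  from rep_frame[OF this f]
  show "yields (Load k k) s k 1 (\<lambda>s v. rep s v (hd x))"
    by (intro yieldsI[OF exec_Load _ f]) auto
qed

text \<open>On the empty list the program loads the fixed value \<open>hd []\<close> as a constant.
  Making \<open>hd\<close> total in this way spares side conditions in all later rules.\<close>

lemma TC_hd:
  fixes f :: "'x::rep \<Rightarrow> 'a::rep list"
  assumes "TC D f \<tau>" shows "\<exists>c. TC D (\<lambda>x. hd (f x)) (\<lambda>x. \<tau> x + c)"
proof -
  obtain c where c: "TC (\<lambda>x::'a list. True \<and> x = []) (\<lambda>_. hd [] :: 'a) (\<lambda>_. c)" using TC_const by blast
  have 1: "TC (\<lambda>x::'a list. True \<and> x \<noteq> []) hd (\<lambda>_. 1)"
    by (rule TC_mono[OF TC_hd0]) auto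
  have "TC (\<lambda>_. True) (hd :: 'a list \<Rightarrow> 'a) (\<lambda>_. c + 6)"
    by (rule TC_mono[OF TC_if[OF TC_null0 c 1]]) auto
  from TC_comp[OF assms this] show ?thesis by blast
qed

section \<open>Loops over lists\<close>

text \<open>Per element, the data movement in \<open>fold_body\<close> costs 20 and the loop test 1;
  22 leaves a margin.\<close>

primrec fold_cost :: "('s \<Rightarrow> 'e \<Rightarrow> 's) \<Rightarrow> ('s \<Rightarrow> 'e \<Rightarrow> nat) \<Rightarrow> 's \<Rightarrow> 'e list \<Rightarrow> nat" where
  "fold_cost g c s [] = 0"
| "fold_cost g c s (e # es) = c s e + 22 + fold_cost g c (g s e) es"

text \<open>The condition is imposed only on the pairs of state and element that the fold really
  meets, so that invariants of the state can restrict the domain of the step function.\<close>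

primrec fold_inv :: "('s \<Rightarrow> 'e \<Rightarrow> 's) \<Rightarrow> ('s \<Rightarrow> 'e \<Rightarrow> bool) \<Rightarrow> 's \<Rightarrow> 'e list \<Rightarrow> bool" where
  "fold_inv g I s [] \<longleftrightarrow> True"
| "fold_inv g I s (e # es) \<longleftrightarrow> I s e \<and> fold_inv g I (g s e) es"

text \<open>Registers: \<open>k\<close> holds the environment, \<open>k+1\<close> the accumulator,
  \<open>k+2\<close> the rest of the list. The triple \<open>((x, s), e)\<close> is assembled at
  \<open>k+3\<close>, with \<open>k+4\<close> for the element and \<open>k+5\<close> as scratch
  space.\<close>

definition fold_body :: "(nat \<Rightarrow> ram) \<Rightarrow> nat \<Rightarrow> ram" where
  "fold_body P k = Seq (cell (k+3) k (k+1) (k+5)) (Seq (Load (k+4) (k+2))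
     (Seq (cell (k+3) (k+3) (k+4) (k+5)) (Seq (P (k+3)) (Seq (copy (k+1) (k+3))
     (Seq (Set_Const (k+3) 1) (Seq (Add (k+2) (k+2) (k+3)) (Load (k+2) (k+2))))))))"

lemma fold_step:
  fixes g :: "('x::rep \<times> 's::rep) \<times> 'e::rep \<Rightarrow> 's"
  assumes P: "implements P D g \<tau>"
    and k: "k \<ge> 1" and h: "0 < fst s 0" and D: "D ((x, a), e)"
    and x: "rep s (fst s k) x" and a: "rep s (fst s (k+1)) a" and l: "rep s (fst s (k+2)) (e # es)"
  shows "\<exists>t s'. exec (fold_body P k) s t s' \<and> t \<le> \<tau> ((x, a), e) + 20 \<and> frame (k+1) s s' \<and>
    rep s' (fst s' (k+1)) (g ((x, a), e)) \<and> rep s' (fst s' (k+2)) es"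
proof -
  have c: "cell_at s (fst s (k+2))" and e: "rep s (snd s (fst s (k+2))) e"
    and es: "rep s (snd s (fst s (k+2) + 1)) es" using l by auto
  let ?s1 = "((fst s)(0 := fst s 0 + 2, k+5 := 2, k+3 := fst s 0),
      (snd s)(fst s 0 := fst s k, fst s 0 + 1 := fst s (k+1)))"
  have e1: "exec (cell (k+3) k (k+1) (k+5)) s 7 ?s1" by (rule exec_cell) auto
  have f1: "frame (k+3) s ?s1" using k by (auto simp: frame_def)
  have xa1: "rep ?s1 (fst ?s1 (k+3)) (x, a)"
    using rep_frame[OF x f1] rep_frame[OF a f1] h by (simp add: rep_prod_def cell_at_def)
  let ?s2 = "((fst ?s1)(k+4 := snd ?s1 (fst ?s1 (k+2))), snd ?s1)"
  have e2: "exec (Load (k+4) (k+2)) ?s1 1 ?s2" by (rule exec_Load)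
  have f2: "frame (k+4) ?s1 ?s2" by (simp add: frame_def)
  have c1: "snd ?s1 (fst s (k+2)) = snd s (fst s (k+2))" "snd ?s1 (fst s (k+2) + 1) = snd s (fst s (k+2) + 1)"
    using cell_at_frame[OF c f1] by auto
  have r2: "fst ?s2 (k+4) = snd s (fst s (k+2))" using c1(1) by simp
  have ee2: "rep ?s2 (fst ?s2 (k+4)) e"
    unfolding r2 by (rule rep_frame[OF rep_frame[OF e f1] f2])
  have xa2: "rep ?s2 (fst ?s2 (k+3)) (x, a)"
    using rep_frame[OF xa1 f2] by simp
  have f02: "frame (k+3) s ?s2" by (rule frame_trans[OF f1 f2]) simp
  have c2: "snd ?s2 (fst s (k+2)) = snd s (fst s (k+2))" "snd ?s2 (fst s (k+2) + 1) = snd s (fst s (k+2) + 1)"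
    using cell_at_frame[OF c f02] by auto
  obtain s2 where s2: "s2 = ?s2" by simp
  note e2 = e2[folded s2] and f2 = f2[folded s2] and ee2 = ee2[folded s2] and xa2 = xa2[folded s2]
    and f02 = f02[folded s2]
  have h2: "0 < fst s2 0" using frame_pos[OF f02 h] .
  let ?s3 = "((fst s2)(0 := fst s2 0 + 2, k+5 := 2, k+3 := fst s2 0),
      (snd s2)(fst s2 0 := fst s2 (k+3), fst s2 0 + 1 := fst s2 (k+4)))"
  have e3: "exec (cell (k+3) (k+3) (k+4) (k+5)) s2 7 ?s3" by (rule exec_cell) auto
  have f3: "frame (k+3) s2 ?s3" using k by (auto simp: frame_def)
  have xae: "rep ?s3 (fst ?s3 (k+3)) ((x, a), e)"
    using rep_frame[OF xa2 f3] rep_frame[OF ee2 f3] h2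
    by (subst rep_prod_def) (simp add: cell_at_def)
  have h3: "0 < fst ?s3 0" by simp
  have "yields (P (k+3)) ?s3 (k+3) (\<tau> ((x, a), e)) (\<lambda>s v. rep s v (g ((x, a), e)))"
    by (rule implementsD[OF P _ h3 D xae]) simp
  then obtain t4 s4 where 4: "exec (P (k+3)) ?s3 t4 s4" "t4 \<le> \<tau> ((x, a), e)" "frame (k+3) ?s3 s4"
      "rep s4 (fst s4 (k+3)) (g ((x, a), e))" by (rule yieldsE)
  have f04: "frame (k+3) s s4"
    using frame_trans[OF frame_trans[OF f02 f3] 4(3)] by simp
  let ?s5 = "((fst s4)(k+1 := fst s4 (k+3)), snd s4)"
  have e5: "exec (copy (k+1) (k+3)) s4 2 ?s5" by (rule exec_copy) simp
  let ?s6 = "((fst ?s5)(k+3 := 1, k+2 := snd ?s5 (fst ?s5 (k+2) + 1)), snd ?s5)"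
  have e6: "exec (Seq (Set_Const (k+3) 1) (Seq (Add (k+2) (k+2) (k+3)) (Load (k+2) (k+2)))) ?s5 3 ?s6"
    by (rule exec_next) simp
  have f46: "frame (k+1) s4 ?s6" by (simp add: frame_def)
  have f06: "frame (k+1) s ?s6"
    using frame_trans[OF frame_mono[OF f04] f46] by simp
  have r6: "fst ?s6 (k+2) = snd s (fst s (k+2) + 1)"
    using cell_at_frame[OF c f04] frame_reg[OF f04, of "k+2"] by simp
  show ?thesis
    unfolding fold_body_def
  proof (intro exI conjI)
    show "exec (Seq (cell (k+3) k (k+1) (k+5)) (Seq (Load (k+4) (k+2))
     (Seq (cell (k+3) (k+3) (k+4) (k+5)) (Seq (P (k+3)) (Seq (copy (k+1) (k+3))
     (Seq (Set_Const (k+3) 1) (Seq (Add (k+2) (k+2) (k+3)) (Load (k+2) (k+2))))))))) s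
      (7 + (1 + (7 + (t4 + (2 + 3))))) ?s6"
      by (intro exec.Seq[OF e1] exec.Seq[OF e2] exec.Seq[OF e3] exec.Seq[OF 4(1)] exec.Seq[OF e5] e6)
    show "7 + (1 + (7 + (t4 + (2 + 3)))) \<le> \<tau> ((x, a), e) + 20" using 4(2) by simp
    show "frame (k+1) s ?s6" by (rule f06)
    show "rep ?s6 (fst ?s6 (k+1)) (g ((x, a), e))"
      using rep_frame[OF 4(4) f46] by simp
    show "rep ?s6 (fst ?s6 (k+2)) es"
      unfolding r6 by (rule rep_frame[OF es f06])
  qed
qed

text \<open>The list is evaluated before the loop starts, so termination comes for free. Apart from
  \<open>TC_upt0\<close> and the reading of the input, all iteration goes through this rule.\<close>

lemma TC_foldl:
  fixes g :: "'x::rep \<Rightarrow> 's::rep \<Rightarrow> 'e::rep \<Rightarrow> 's"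
  assumes i: "TC D i \<tau>i" and l: "TC D l \<tau>l"
    and g: "TC E (\<lambda>y. g (fst (fst y)) (snd (fst y)) (snd y)) \<tau>"
    and inv: "\<And>x. D x \<Longrightarrow> fold_inv (g x) (\<lambda>s e. E ((x, s), e)) (i x) (l x)"
  shows "TC D (\<lambda>x. foldl (g x) (i x) (l x))
    (\<lambda>x. \<tau>i x + \<tau>l x + fold_cost (g x) (\<lambda>s e. \<tau> ((x, s), e)) (i x) (l x) + 8)"
proof -
  let ?g = "\<lambda>y. g (fst (fst y)) (snd (fst y)) (snd y)"
  obtain I where "implements I D i \<tau>i" using i by (rule TCE)
  note I = implementsD[OF this]
  obtain L where "implements L D l \<tau>l" using l by (rule TCE)
  note L = implementsD[OF this]
  obtain P where "implements P E ?g \<tau>" using g by (rule TCE)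
  note P = this
  have loop: "\<exists>t s'. exec (While_Nonzero (k+2) (fold_body P k)) s t s' \<and>
      t \<le> fold_cost (g x) (\<lambda>s e. \<tau> ((x, s), e)) a es + 1 \<and> frame (k+1) s s' \<and>
      rep s' (fst s' (k+1)) (foldl (g x) a es)"
    if "k \<ge> 1" "0 < fst s 0" "fold_inv (g x) (\<lambda>s e. E ((x, s), e)) a es"
      "rep s (fst s k) x" "rep s (fst s (k+1)) a" "rep s (fst s (k+2)) es" for k s x a es
    using that(2-)
  proof (induction es arbitrary: s a)
    case Nil
    have "exec (While_Nonzero (k+2) (fold_body P k)) s 1 s"
      by (rule exec.While_False) (use Nil in simp)
    then show ?case using Nil by (intro exI[of _ 1] exI[of _ s]) auto
  next
    case (Cons e es)
    obtain t1 s1 where 1: "exec (fold_body P k) s t1 s1" "t1 \<le> \<tau> ((x, a), e) + 20" "frame (k+1) s s1"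
        "rep s1 (fst s1 (k+1)) (g x a e)" "rep s1 (fst s1 (k+2)) es"
      using fold_step[OF P \<open>k \<ge> 1\<close> Cons.prems(1) _ Cons.prems(3-5)] Cons.prems(2) by auto
    have "rep s1 (fst s1 k) x"
      using rep_frame[OF Cons.prems(3) 1(3)] frame_reg[OF 1(3), of k] \<open>k \<ge> 1\<close> by simp
    then obtain t2 s2 where 2: "exec (While_Nonzero (k+2) (fold_body P k)) s1 t2 s2"
      "t2 \<le> fold_cost (g x) (\<lambda>s e. \<tau> ((x, s), e)) (g x a e) es + 1" "frame (k+1) s1 s2"
      "rep s2 (fst s2 (k+1)) (foldl (g x) (g x a e) es)"
      using Cons.IH[OF frame_pos[OF 1(3) Cons.prems(1)] _ _ 1(4,5)] Cons.prems(2) by auto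
    have "exec (While_Nonzero (k+2) (fold_body P k)) s (1 + t1 + t2) s2"
      by (rule exec.While_True[OF _ 1(1) 2(1)]) (use Cons.prems in \<open>auto simp: cell_at_def\<close>)
    moreover have "frame (k+1) s s2" using frame_trans[OF 1(3) 2(3)] by simp
    ultimately show ?case using 1(2) 2(2,4) by (intro exI[of _ "1 + t1 + t2"] exI[of _ s2]) auto
  qed
  show ?thesis
  proof (rule TCI[where P="\<lambda>k. Seq (copy (k+1) k) (Seq (I (k+1)) (Seq (copy (k+2) k) (Seq (L (k+2))
      (Seq (While_Nonzero (k+2) (fold_body P k)) (copy k (k+1))))))"])
    fix k s x assume a: "k \<ge> (1::nat)" "0 < fst s 0" "D x" "rep s (fst s k) x"
    let ?s1 = "((fst s)(k+1 := fst s k), snd s)"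
    have e1: "exec (copy (k+1) k) s 2 ?s1" by (rule exec_copy) simp
    have f1: "frame (k+1) s ?s1" by (simp add: frame_def)
    have x1: "rep ?s1 (fst s k) x" by (rule rep_frame[OF a(4) f1])
    have "yields (I (k+1)) ?s1 (k+1) (\<tau>i x) (\<lambda>s v. rep s v (i x))"
      by (rule I) (use a x1 in auto)
    then obtain t2 s2 where 2: "exec (I (k+1)) ?s1 t2 s2" "t2 \<le> \<tau>i x" "frame (k+1) ?s1 s2"
        "rep s2 (fst s2 (k+1)) (i x)" by (rule yieldsE)
    let ?s3 = "((fst s2)(k+2 := fst s2 k), snd s2)"
    have e3: "exec (copy (k+2) k) s2 2 ?s3" by (rule exec_copy) simp
    have f3: "frame (k+2) s2 ?s3" by (simp add: frame_def)
    have r3: "fst ?s3 (k+2) = fst s k" using frame_reg[OF 2(3), of k] a(1) by simp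
    have x3: "rep ?s3 (fst ?s3 (k+2)) x"
      unfolding r3 by (rule rep_frame[OF rep_frame[OF x1 2(3)] f3])
    have y3: "rep ?s3 (fst s2 (k+1)) (i x)" by (rule rep_frame[OF 2(4) f3])
    have h3: "0 < fst ?s3 0" using frame_pos[OF 2(3)] a(1,2) by simp
    have "yields (L (k+2)) ?s3 (k+2) (\<tau>l x) (\<lambda>s v. rep s v (l x))"
      by (rule L) (use a x3 h3 in auto)
    then obtain t4 s4 where 4: "exec (L (k+2)) ?s3 t4 s4" "t4 \<le> \<tau>l x" "frame (k+2) ?s3 s4"
        "rep s4 (fst s4 (k+2)) (l x)" by (rule yieldsE)
    have f04: "frame (k+1) s s4"
      using frame_trans[OF frame_trans[OF frame_trans[OF f1 2(3)] f3] 4(3)] by simp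
    have r4: "fst s4 (k+1) = fst s2 (k+1)" using frame_reg[OF 4(3), of "k+1"] by simp
    have y4: "rep s4 (fst s4 (k+1)) (i x)" unfolding r4 by (rule rep_frame[OF y3 4(3)])
    have x4: "rep s4 (fst s4 k) x"
      using rep_frame[OF a(4) f04] frame_reg[OF f04, of k] a(1) by simp
    obtain t5 s5 where 5: "exec (While_Nonzero (k+2) (fold_body P k)) s4 t5 s5"
        "t5 \<le> fold_cost (g x) (\<lambda>s e. \<tau> ((x, s), e)) (i x) (l x) + 1" "frame (k+1) s4 s5"
        "rep s5 (fst s5 (k+1)) (foldl (g x) (i x) (l x))"
      using loop[OF a(1) frame_pos[OF f04 a(2)] inv[OF a(3)] x4 y4 4(4)] by blast
    let ?s6 = "((fst s5)(k := fst s5 (k+1)), snd s5)"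
    have e6: "exec (copy k (k+1)) s5 2 ?s6" by (rule exec_copy) simp
    have f6: "frame k s5 ?s6" using a(1) by (simp add: frame_def)
    have f06: "frame k s ?s6"
      using frame_trans[OF frame_mono[OF frame_trans[OF f04 5(3)]] f6] by simp
    show "yields (Seq (copy (k+1) k) (Seq (I (k+1)) (Seq (copy (k+2) k) (Seq (L (k+2))
      (Seq (While_Nonzero (k+2) (fold_body P k)) (copy k (k+1))))))) s k
      (\<tau>i x + \<tau>l x + fold_cost (g x) (\<lambda>s e. \<tau> ((x, s), e)) (i x) (l x) + 8)
      (\<lambda>s v. rep s v (foldl (g x) (i x) (l x)))"
    proof (rule yieldsI[OF _ _ f06])
      show "exec (Seq (copy (k+1) k) (Seq (I (k+1)) (Seq (copy (k+2) k) (Seq (L (k+2))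
        (Seq (While_Nonzero (k+2) (fold_body P k)) (copy k (k+1))))))) s
        (2 + (t2 + (2 + (t4 + (t5 + 2))))) ?s6"
        by (intro exec.Seq[OF e1] exec.Seq[OF 2(1)] exec.Seq[OF e3] exec.Seq[OF 4(1)] exec.Seq[OF 5(1)] e6)
      show "rep ?s6 (fst ?s6 k) (foldl (g x) (i x) (l x))"
        using rep_frame[OF 5(4) f6] by simp
    qed (use 2(2) 4(2) 5(2) in simp)
  qed
qed

text \<open>Counting down while consing produces the list in ascending order. It turns a number into
  a list to fold over, which is how bounded iteration is expressed.\<close>

lemma TC_upt0: "TC (\<lambda>_. True) (\<lambda>n. [0..<n]) (\<lambda>n. 10 * n + 4)"
proof (rule TCI)
  let ?body = "\<lambda>k. Seq (Set_Const (k+2) 1) (Seq (Sub (k+1) (k+1) (k+2)) (cell k (k+1) k (k+3)))"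
  have loop: "\<exists>t s'. exec (While_Nonzero (k+1) (?body k)) s t s' \<and>
      t \<le> 10 * n + 1 \<and> frame k s s' \<and> rep s' (fst s' k) ([0..<n] @ xs)"
    if k: "k \<ge> 1" and "0 < fst s 0" "fst s (k+1) = n" "rep s (fst s k) xs" for k s n xs
    using that(2-)
  proof (induction n arbitrary: s xs)
    case 0
    have "exec (While_Nonzero (k+1) (?body k)) s 1 s"
      by (rule exec.While_False) (use 0 in simp)
    then show ?case using 0 by (intro exI[of _ 1] exI[of _ s]) auto
  next
    case (Suc n)
    let ?s1 = "((fst s)(k+2 := 1), snd s)"
    have e1: "exec (Set_Const (k+2) 1) s 1 ?s1" by (rule exec_Set)
    let ?s2 = "((fst ?s1)(k+1 := n), snd ?s1)"
    have e2: "exec (Sub (k+1) (k+1) (k+2)) ?s1 1 ?s2"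
      by (rule exec_eq, rule exec_Sub) (use Suc.prems(2) in \<open>auto simp: fun_eq_iff\<close>)
    let ?s3 = "((fst ?s2)(0 := fst ?s2 0 + 2, k+3 := 2, k := fst ?s2 0),
      (snd ?s2)(fst ?s2 0 := fst ?s2 (k+1), fst ?s2 0 + 1 := fst ?s2 k))"
    have e3: "exec (cell k (k+1) k (k+3)) ?s2 7 ?s3" by (rule exec_cell) (use k in auto)
    have f3: "frame k s ?s3" using k by (auto simp: frame_def)
    have r3: "rep ?s3 (fst ?s3 k) (n # xs)"
      using rep_frame[OF Suc.prems(3) f3] Suc.prems(1) k by (simp add: cell_at_def rep_nat_def)
    obtain t4 s4 where 4: "exec (While_Nonzero (k+1) (?body k)) ?s3 t4 s4" "t4 \<le> 10 * n + 1"
        "frame k ?s3 s4" "rep s4 (fst s4 k) ([0..<n] @ n # xs)"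
      using Suc.IH[OF _ _ r3] k by auto
    have "exec (While_Nonzero (k+1) (?body k)) s (1 + (1 + (1 + 7)) + t4) s4"
      by (rule exec.While_True[OF _ exec.Seq[OF e1 exec.Seq[OF e2 e3]] 4(1)]) (use Suc.prems in simp)
    then show ?case using 4(2,4) frame_trans[OF f3 4(3)]
      by (intro exI[of _ "(1 + (1 + (1 + 7)) + t4)"] exI[of _ s4]) auto
  qed
  fix k s and n :: nat assume a: "k \<ge> 1" "0 < fst s 0" "rep s (fst s k) n"
  let ?s1 = "((fst s)(k+1 := fst s k), snd s)"
  have e1: "exec (copy (k+1) k) s 2 ?s1" by (rule exec_copy) simp
  let ?s2 = "((fst ?s1)(k := 0), snd ?s1)"
  have e2: "exec (Set_Const k 0) ?s1 1 ?s2" by (rule exec_Set)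
  have f2: "frame k s ?s2" using a by (auto simp: frame_def)
  have "\<exists>t s'. exec (While_Nonzero (k+1) (?body k)) ?s2 t s' \<and>
      t \<le> 10 * n + 1 \<and> frame k ?s2 s' \<and> rep s' (fst s' k) ([0..<n] @ [])"
    by (rule loop) (use a in \<open>auto simp: rep_nat_def\<close>)
  then obtain t3 s3 where 3: "exec (While_Nonzero (k+1) (?body k)) ?s2 t3 s3"
      "t3 \<le> 10 * n + 1" "frame k ?s2 s3" "rep s3 (fst s3 k) [0..<n]" by auto
  show "yields (Seq (copy (k+1) k) (Seq (Set_Const k 0) (While_Nonzero (k+1) (?body k)))) s k (10 * n + 4)
      (\<lambda>s v. rep s v [0..<n])"
    by (rule yieldsI[OF exec.Seq[OF e1 exec.Seq[OF e2 3(1)]]]) (use 3 frame_trans[OF f2 3(3)] in auto)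
qed

section \<open>Computable and polynomial-time functions\<close>

text \<open>The base \<open>Suc (Z x)\<close> is positive, so exponents may be enlarged freely when
  two bounds are merged.\<close>

definition polyb :: "bool \<Rightarrow> ('a \<Rightarrow> bool) \<Rightarrow> ('a \<Rightarrow> nat) \<Rightarrow> ('a \<Rightarrow> nat) \<Rightarrow> bool" where
  "polyb b D Z \<tau> \<longleftrightarrow> (b \<longrightarrow> (\<exists>c d. \<forall>x. D x \<longrightarrow> \<tau> x \<le> c * Suc (Z x) ^ d))"

lemma polyb_const: "polyb b D Z (\<lambda>_. c)"
  unfolding polyb_def by (intro impI exI[of _ c] exI[of _ 0]) simp

lemma power_Suc_mono: "d \<le> e \<Longrightarrow> c * Suc n ^ d \<le> c * Suc n ^ e"
  by (rule mult_left_mono[OF power_increasing]) auto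

lemma polyb_add:
  assumes "polyb b D Z \<tau>" "polyb b D Z \<sigma>"
  shows "polyb b D Z (\<lambda>x. \<tau> x + \<sigma> x)"
  unfolding polyb_def
proof
  assume b
  then obtain c d c' d' where 1: "\<And>x. D x \<Longrightarrow> \<tau> x \<le> c * Suc (Z x) ^ d"
    and 2: "\<And>x. D x \<Longrightarrow> \<sigma> x \<le> c' * Suc (Z x) ^ d'"
    using assms unfolding polyb_def by blast
  show "\<exists>c d. \<forall>x. D x \<longrightarrow> \<tau> x + \<sigma> x \<le> c * Suc (Z x) ^ d"
  proof (intro exI allI impI)
    fix x assume x: "D x"
    have "\<tau> x + \<sigma> x \<le> c * Suc (Z x) ^ (d + d') + c' * Suc (Z x) ^ (d + d')"
      using 1[OF x] 2[OF x] power_Suc_mono[of d "d+d'" c "Z x"] power_Suc_mono[of d' "d+d'" c' "Z x"]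
      by linarith
    then show "\<tau> x + \<sigma> x \<le> (c + c') * Suc (Z x) ^ (d + d')" by (simp add: algebra_simps)
  qed
qed

lemma polyb_mono:
  assumes "polyb b D Z \<tau>" "\<And>x. b \<Longrightarrow> E x \<Longrightarrow> D (f x) \<and> \<sigma> x \<le> \<tau> (f x) \<and> Z (f x) \<le> W x"
  shows "polyb b E W \<sigma>"
  unfolding polyb_def
proof
  assume b
  then obtain c d where 1: "\<And>x. D x \<Longrightarrow> \<tau> x \<le> c * Suc (Z x) ^ d"
    using assms(1) unfolding polyb_def by blast
  show "\<exists>c d. \<forall>x. E x \<longrightarrow> \<sigma> x \<le> c * Suc (W x) ^ d"
  proof (intro exI allI impI)
    fix x assume "E x"
    note 2 = assms(2)[OF \<open>b\<close> this]
    have "\<sigma> x \<le> c * Suc (Z (f x)) ^ d" using 2 1[of "f x"] by linarith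
    also have "\<dots> \<le> c * Suc (W x) ^ d"
      using 2 by (intro mult_left_mono power_mono) auto
    finally show "\<sigma> x \<le> c * Suc (W x) ^ d" .
  qed
qed

lemma polyb_mult:
  assumes "polyb b D Z \<tau>" and l: "\<And>x. b \<Longrightarrow> D x \<Longrightarrow> n x \<le> Z x"
  shows "polyb b D Z (\<lambda>x. n x * \<tau> x)"
  unfolding polyb_def
proof
  assume b
  then obtain c d where 1: "\<And>x. D x \<Longrightarrow> \<tau> x \<le> c * Suc (Z x) ^ d"
    using assms(1) unfolding polyb_def by blast
  show "\<exists>c d. \<forall>x. D x \<longrightarrow> n x * \<tau> x \<le> c * Suc (Z x) ^ d"
  proof (intro exI allI impI)
    fix x assume x: "D x"
    have "n x * \<tau> x \<le> Suc (Z x) * (c * Suc (Z x) ^ d)"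
      using l[OF \<open>b\<close> x] 1[OF x] by (intro mult_mono) auto
    then show "n x * \<tau> x \<le> c * Suc (Z x) ^ Suc d" by (simp add: algebra_simps)
  qed
qed

text \<open>With \<open>b = False\<close> this is mere computability; with \<open>b = True\<close> the running time on the
  domain \<open>D\<close> is in addition polynomial in \<open>Z\<close>. Treating both at once avoids proving every
  closure rule twice.\<close>

definition PC :: "bool \<Rightarrow> ('a::rep \<Rightarrow> bool) \<Rightarrow> ('a \<Rightarrow> nat) \<Rightarrow> ('a \<Rightarrow> 'b::rep) \<Rightarrow> bool" where
  "PC b D Z f \<longleftrightarrow> (\<exists>\<tau>. TC D f \<tau> \<and> polyb b D Z \<tau>)"

lemma PCI: "TC D f \<tau> \<Longrightarrow> polyb b D Z \<tau> \<Longrightarrow> PC b D Z f"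
  by (auto simp: PC_def)

lemma PCE: assumes "PC b D Z f" obtains \<tau> where "TC D f \<tau>" "polyb b D Z \<tau>"
  using assms by (auto simp: PC_def)

named_theorems PC_rules

lemma PC_cong: "PC b D Z f \<Longrightarrow> (\<And>x. D x \<Longrightarrow> f x = g x) \<Longrightarrow> PC b D Z g"
  unfolding PC_def using TC_mono[of D f _ D _ g] by (metis order_refl)

text \<open>The measure of the intermediate result must not exceed the measure of the input; a
  polynomial relation would not do here. The measures of the dynamic program are therefore chosen
  generously as sums.\<close>

lemma PC_comp:
  assumes "PC b D Z f" "PC b E W g" "\<And>x. D x \<Longrightarrow> E (f x)" "\<And>x. b \<Longrightarrow> D x \<Longrightarrow> W (f x) \<le> Z x"
  shows "PC b D Z (\<lambda>x. g (f x))"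
proof -
  obtain \<tau> \<sigma> where 1: "TC D f \<tau>" "polyb b D Z \<tau>" and 2: "TC E g \<sigma>" "polyb b E W \<sigma>"
    using assms(1,2) by (elim PCE)
  have "polyb b D Z (\<lambda>x. \<sigma> (f x))"
    by (rule polyb_mono[OF 2(2), where f=f]) (use assms in auto)
  with 1(2) have "polyb b D Z (\<lambda>x. \<tau> x + \<sigma> (f x))" by (rule polyb_add)
  with TC_comp[OF 1(1) 2(1) assms(3)] show ?thesis by (rule PCI)
qed

lemma PC_id [PC_rules]: "PC b D Z (\<lambda>x. x)"
  by (rule PCI[OF TC_id polyb_const])

lemma PC_const [PC_rules]: "PC b D Z (\<lambda>_. a)"
  using TC_const[of D a] by (auto intro: PCI polyb_const)

lemma PC_binary:
  assumes "\<And>\<tau> \<sigma>. TC D f \<tau> \<Longrightarrow> TC D g \<sigma> \<Longrightarrow> TC D h (\<lambda>x. \<tau> x + \<sigma> x + c)"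
    and "PC b D Z f" "PC b D Z g"
  shows "PC b D Z h"
  using assms(2,3) by (elim PCE) (rule PCI, rule assms(1), auto intro: polyb_add polyb_const)

lemma PC_unary:
  assumes "\<And>\<tau>. TC D f \<tau> \<Longrightarrow> \<exists>c. TC D h (\<lambda>x. \<tau> x + c)" and f: "PC b D Z f"
  shows "PC b D Z h"
proof -
  obtain \<tau> where 1: "TC D f \<tau>" "polyb b D Z \<tau>" using f by (elim PCE)
  obtain c where "TC D h (\<lambda>x. \<tau> x + c)" using assms(1)[OF 1(1)] by blast
  then show ?thesis by (rule PCI) (intro polyb_add polyb_const 1)
qed

lemma PC_Pair [PC_rules]: "PC b D Z f \<Longrightarrow> PC b D Z g \<Longrightarrow> PC b D Z (\<lambda>x. (f x, g x))"
  by (rule PC_binary[OF TC_Pair])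

lemma PC_Cons [PC_rules]: "PC b D Z f \<Longrightarrow> PC b D Z g \<Longrightarrow> PC b D Z (\<lambda>x. f x # g x)"
  by (rule PC_binary[OF TC_Cons])

lemma PC_add [PC_rules]: "PC b D Z f \<Longrightarrow> PC b D Z g \<Longrightarrow> PC b D Z (\<lambda>x. f x + g x :: nat)"
  by (rule PC_binary[where f=f and g=g and c=5], rule TC_mono[OF TC_add, of D _ _ _ _ D]) auto

lemma PC_sub [PC_rules]: "PC b D Z f \<Longrightarrow> PC b D Z g \<Longrightarrow> PC b D Z (\<lambda>x. f x - g x :: nat)"
  by (rule PC_binary[where f=f and g=g and c=5], rule TC_mono[OF TC_sub, of D _ _ _ _ D]) auto

lemma PC_fst [PC_rules]: "PC b D Z f \<Longrightarrow> PC b D Z (\<lambda>x. fst (f x))"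
  by (rule PC_unary) (auto intro: TC_fst)

lemma PC_snd [PC_rules]: "PC b D Z f \<Longrightarrow> PC b D Z (\<lambda>x. snd (f x))"
  by (rule PC_unary) (auto intro: TC_snd)

lemma PC_hd [PC_rules]: "PC b D Z f \<Longrightarrow> PC b D Z (\<lambda>x. hd (f x))"
  by (rule PC_unary) (auto intro: TC_hd)

lemma PC_tl [PC_rules]: "PC b D Z f \<Longrightarrow> PC b D Z (\<lambda>x. tl (f x))"
  by (rule PC_comp[OF _ PCI[OF TC_tl0 polyb_const[of _ _ "\<lambda>_. 0"]]]) auto

lemma PC_null [PC_rules]: "PC b D Z f \<Longrightarrow> PC b D Z (\<lambda>x. f x = [])"
  by (rule PC_comp[OF _ PCI[OF TC_null0 polyb_const[of _ _ "\<lambda>_. 0"]]]) auto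

lemma PC_eq0: "PC b D Z f \<Longrightarrow> PC b D Z (\<lambda>x. f x = (0::nat))"
  by (rule PC_comp[OF _ PCI[OF TC_eq0 polyb_const[of _ _ "\<lambda>_. 0"]]]) auto

text \<open>Under truncated subtraction, \<open>f = g\<close> iff
  \<open>(f - g) + (g - f) = 0\<close>; the test for 0 is the only comparison of numbers programmed
  directly.\<close>

lemma PC_eq [PC_rules]: "PC b D Z f \<Longrightarrow> PC b D Z g \<Longrightarrow> PC b D Z (\<lambda>x. f x = (g x :: nat))"
  by (rule PC_cong[OF PC_eq0[OF PC_add[OF PC_sub PC_sub]], of _ _ _ f g g f]) auto

lemma PC_le [PC_rules]: "PC b D Z f \<Longrightarrow> PC b D Z g \<Longrightarrow> PC b D Z (\<lambda>x. f x \<le> (g x :: nat))"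
  by (rule PC_cong[OF PC_eq0[OF PC_sub], of _ _ _ f g]) auto

lemma PC_if [PC_rules]:
  assumes "PC b D Z c" "PC b (\<lambda>x. D x \<and> c x) Z f" "PC b (\<lambda>x. D x \<and> \<not> c x) Z g"
  shows "PC b D Z (\<lambda>x. if c x then f x else g x)"
proof -
  obtain \<tau> \<sigma> \<sigma>' where 1: "TC D c \<tau>" "polyb b D Z \<tau>"
    and 2: "TC (\<lambda>x. D x \<and> c x) f \<sigma>" "polyb b (\<lambda>x. D x \<and> c x) Z \<sigma>"
    and 3: "TC (\<lambda>x. D x \<and> \<not> c x) g \<sigma>'" "polyb b (\<lambda>x. D x \<and> \<not> c x) Z \<sigma>'"
    using assms by (elim PCE)
  have a: "polyb b D Z (\<lambda>x. if c x then \<sigma> x else 0)"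
    unfolding polyb_def
  proof
    assume b
    then obtain e d where "\<And>x. D x \<and> c x \<Longrightarrow> \<sigma> x \<le> e * Suc (Z x) ^ d"
      using 2(2) unfolding polyb_def by blast
    then show "\<exists>e d. \<forall>x. D x \<longrightarrow> (if c x then \<sigma> x else 0) \<le> e * Suc (Z x) ^ d"
      by (intro exI[of _ e] exI[of _ d]) auto
  qed
  have a': "polyb b D Z (\<lambda>x. if \<not> c x then \<sigma>' x else 0)"
    unfolding polyb_def
  proof
    assume b
    then obtain e d where "\<And>x. D x \<and> \<not> c x \<Longrightarrow> \<sigma>' x \<le> e * Suc (Z x) ^ d"
      using 3(2) unfolding polyb_def by blast
    then show "\<exists>e d. \<forall>x. D x \<longrightarrow> (if \<not> c x then \<sigma>' x else 0) \<le> e * Suc (Z x) ^ d"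
      by (intro exI[of _ e] exI[of _ d]) auto
  qed
  have "polyb b D Z (\<lambda>x. \<tau> x + (if c x then \<sigma> x else \<sigma>' x) + 3)"
    by (rule polyb_mono[OF polyb_add[OF polyb_add[OF 1(2) polyb_add[OF a a']] polyb_const[of _ _ _ 3]],
        where f="\<lambda>x. x"]) auto
  with TC_if[OF 1(1) 2(1) 3(1)] show ?thesis by (rule PCI)
qed

lemma PC_conj [PC_rules]:
  assumes "PC b D Z f" "PC b (\<lambda>x. D x \<and> f x) Z g" shows "PC b D Z (\<lambda>x. f x \<and> g x)"
  by (rule PC_cong[OF PC_if[OF assms PC_const[of _ _ _ False]]]) auto

lemma PC_disj [PC_rules]:
  assumes "PC b D Z f" "PC b (\<lambda>x. D x \<and> \<not> f x) Z g" shows "PC b D Z (\<lambda>x. f x \<or> g x)"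
  by (rule PC_cong[OF PC_if[OF assms(1) PC_const[of _ _ _ True] assms(2)]]) auto

lemma PC_not [PC_rules]: "PC b D Z f \<Longrightarrow> PC b D Z (\<lambda>x. \<not> f x)"
  by (rule PC_cong[OF PC_if[OF _ PC_const[of _ _ _ False] PC_const[of _ _ _ True]]]) auto

lemma PC_less [PC_rules]: "PC b D Z f \<Longrightarrow> PC b D Z g \<Longrightarrow> PC b D Z (\<lambda>x. f x < (g x :: nat))"
  by (rule PC_cong[OF PC_not[OF PC_le], of _ _ _ g f]) auto

lemma PC_upt [PC_rules]:
  assumes "PC b D Z f" "\<And>x. b \<Longrightarrow> D x \<Longrightarrow> f x \<le> Z x"
  shows "PC b D Z (\<lambda>x. [0..<f x])"
proof -
  obtain \<tau> where 1: "TC D f \<tau>" "polyb b D Z \<tau>" using assms(1) by (elim PCE)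
  have "polyb b D Z (\<lambda>x. f x * 10 + 4)"
    by (intro polyb_add polyb_mult polyb_const assms(2))
  then have "polyb b D Z (\<lambda>x. 10 * f x + 4)" by (simp add: mult.commute)
  with 1(2) have "polyb b D Z (\<lambda>x. \<tau> x + (10 * f x + 4))" by (rule polyb_add)
  with TC_comp[OF 1(1) TC_upt0] show ?thesis by (intro PCI) auto
qed

lemma fold_cost_bound:
  assumes "fold_inv g (\<lambda>s e. c s e \<le> B) s l"
  shows "fold_cost g c s l \<le> length l * (B + 22)"
  using assms by (induction l arbitrary: s) (auto, fastforce)

lemma fold_invI:
  assumes "I s" "\<And>s e. I s \<Longrightarrow> e \<in> set l \<Longrightarrow> I (g s e)" "\<And>s e. I s \<Longrightarrow> e \<in> set l \<Longrightarrow> J s e"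
  shows "fold_inv g J s l"
  using assms by (induction l arbitrary: s) auto

text \<open>A round is measured by the original input, not by the accumulator. Where the size of the
  accumulator influences the cost, the invariant \<open>I\<close> has to bound it.\<close>

lemma PC_foldl:
  fixes g :: "'x::rep \<Rightarrow> 's::rep \<Rightarrow> 'e::rep \<Rightarrow> 's"
  assumes i: "PC b D Z i" and l: "PC b D Z l"
    and g: "PC b (\<lambda>y. D (fst (fst y)) \<and> I (fst (fst y)) (snd (fst y)) \<and> snd y \<in> set (l (fst (fst y))))
       (\<lambda>y. Z (fst (fst y))) (\<lambda>y. g (fst (fst y)) (snd (fst y)) (snd y))"
    and len: "\<And>x. b \<Longrightarrow> D x \<Longrightarrow> length (l x) \<le> Z x"
    and I: "\<And>x. D x \<Longrightarrow> I x (i x)"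
      "\<And>x s e. D x \<Longrightarrow> I x s \<Longrightarrow> e \<in> set (l x) \<Longrightarrow> I x (g x s e)"
  shows "PC b D Z (\<lambda>x. foldl (g x) (i x) (l x))"
proof -
  obtain \<tau>i \<tau>l \<tau> where 1: "TC D i \<tau>i" "polyb b D Z \<tau>i" and 2: "TC D l \<tau>l" "polyb b D Z \<tau>l"
    and 3: "TC (\<lambda>y. D (fst (fst y)) \<and> I (fst (fst y)) (snd (fst y)) \<and> snd y \<in> set (l (fst (fst y))))
       (\<lambda>y. g (fst (fst y)) (snd (fst y)) (snd y)) \<tau>"
     "polyb b (\<lambda>y. D (fst (fst y)) \<and> I (fst (fst y)) (snd (fst y)) \<and> snd y \<in> set (l (fst (fst y))))
       (\<lambda>y. Z (fst (fst y))) \<tau>"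
    using i l g by (elim PCE)
  have "polyb b D Z (\<lambda>x. fold_cost (g x) (\<lambda>s e. \<tau> ((x, s), e)) (i x) (l x))"
    unfolding polyb_def
  proof
    assume b
    then obtain c d where c: "\<And>y. D (fst (fst y)) \<and> I (fst (fst y)) (snd (fst y)) \<and> snd y \<in> set (l (fst (fst y)))
       \<Longrightarrow> \<tau> y \<le> c * Suc (Z (fst (fst y))) ^ d"
      using 3(2) unfolding polyb_def by blast
    show "\<exists>c d. \<forall>x. D x \<longrightarrow> fold_cost (g x) (\<lambda>s e. \<tau> ((x, s), e)) (i x) (l x) \<le> c * Suc (Z x) ^ d"
    proof (intro exI allI impI)
      fix x assume x: "D x"
      let ?B = "c * Suc (Z x) ^ d"
      have "fold_inv (g x) (\<lambda>s e. \<tau> ((x, s), e) \<le> ?B) (i x) (l x)"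
        by (rule fold_invI[where I="I x"]) (use I x c[of "((x, s), e)" for s e] in auto)
      from fold_cost_bound[OF this]
      have "fold_cost (g x) (\<lambda>s e. \<tau> ((x, s), e)) (i x) (l x) \<le> length (l x) * (?B + 22)" .
      also have "\<dots> \<le> Suc (Z x) * ((c + 22) * Suc (Z x) ^ d)"
        using len[OF \<open>b\<close> x] by (intro mult_mono) (auto simp: algebra_simps)
      finally show "fold_cost (g x) (\<lambda>s e. \<tau> ((x, s), e)) (i x) (l x) \<le> (c + 22) * Suc (Z x) ^ Suc d"
        by (simp add: algebra_simps)
    qed
  qed
  then have "polyb b D Z (\<lambda>x. \<tau>i x + \<tau>l x + fold_cost (g x) (\<lambda>s e. \<tau> ((x, s), e)) (i x) (l x) + 8)"
    by (intro polyb_add polyb_const 1 2)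
  moreover have "TC D (\<lambda>x. foldl (g x) (i x) (l x))
     (\<lambda>x. \<tau>i x + \<tau>l x + fold_cost (g x) (\<lambda>s e. \<tau> ((x, s), e)) (i x) (l x) + 8)"
  proof (rule TC_foldl[OF 1(1) 2(1) 3(1)])
    fix x assume x: "D x"
    show "fold_inv (g x) (\<lambda>s e. D (fst (fst ((x, s), e))) \<and> I (fst (fst ((x, s), e))) (snd (fst ((x, s), e))) \<and>
       snd ((x, s), e) \<in> set (l (fst (fst ((x, s), e))))) (i x) (l x)"
      by (rule fold_invI[where I="I x"]) (use I x in auto)
  qed
  ultimately show ?thesis by (intro PCI)
qed

lemma PC_foldl' [PC_rules]:
  fixes g :: "'x::rep \<Rightarrow> 's::rep \<Rightarrow> 'e::rep \<Rightarrow> 's"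
  assumes "PC b D Z i" and "PC b D Z l"
    and "PC b (\<lambda>y. D (fst (fst y)) \<and> snd y \<in> set (l (fst (fst y))))
       (\<lambda>y. Z (fst (fst y))) (\<lambda>y. g (fst (fst y)) (snd (fst y)) (snd y))"
    and "\<And>x. b \<Longrightarrow> D x \<Longrightarrow> length (l x) \<le> Z x"
  shows "PC b D Z (\<lambda>x. foldl (g x) (i x) (l x))"
  by (rule PC_foldl[where I="\<lambda>_ _. True"]) (use assms in auto)

section \<open>List operations as folds\<close>

lemma PC_rev [PC_rules]:
  assumes "PC b D Z l" "\<And>x. b \<Longrightarrow> D x \<Longrightarrow> length (l x) \<le> Z x"
  shows "PC b D Z (\<lambda>x. rev (l x))"
proof -
  have eq: "foldl (\<lambda>a e. e # a) a xs = rev xs @ a" for a xs :: "'u list"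
    by (induction xs arbitrary: a) auto
  have "PC b D Z (\<lambda>x. foldl (\<lambda>a e. e # a) [] (l x))"
    by (intro PC_rules assms)
  then show ?thesis by (simp add: eq)
qed

text \<open>Only the left list is traversed; the right one is the initial accumulator and is shared,
  whence no bound on its length.\<close>

lemma PC_append [PC_rules]:
  assumes "PC b D Z l" "PC b D Z m" "\<And>x. b \<Longrightarrow> D x \<Longrightarrow> length (l x) \<le> Z x"
  shows "PC b D Z (\<lambda>x. l x @ m x)"
proof -
  have eq: "foldl (\<lambda>a e. e # a) a xs = rev xs @ a" for a xs :: "'u list"
    by (induction xs arbitrary: a) auto
  have "PC b D Z (\<lambda>x. foldl (\<lambda>a e. e # a) (m x) (rev (l x)))"
    by (intro PC_rules assms) (use assms in auto)
  then show ?thesis by (simp add: eq)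
qed

text \<open>The body of a fold receives \<open>((x, s), e)\<close>, whereas the function given to
  \<open>map\<close> or \<open>filter\<close> expects \<open>(x, e)\<close>; this projects the
  accumulator away.\<close>

lemma PC_env2:
  assumes "PC b (\<lambda>y. D (fst y) \<and> snd y \<in> set (l (fst y))) (\<lambda>y. Z (fst y)) (\<lambda>y. f (fst y) (snd y))"
  shows "PC b (\<lambda>y. D (fst (fst y)) \<and> snd y \<in> set (l (fst (fst y)))) (\<lambda>y. Z (fst (fst y)))
    (\<lambda>y. f (fst (fst y)) (snd y))"
  using PC_comp[OF _ assms, of "\<lambda>y. D (fst (fst y)) \<and> snd y \<in> set (l (fst (fst y)))"
    "\<lambda>y. Z (fst (fst y))" "\<lambda>y. (fst (fst y), snd y)"]
  by (simp add: PC_Pair PC_fst PC_snd PC_id)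

lemma PC_map [PC_rules]:
  assumes "PC b (\<lambda>y. D (fst y) \<and> snd y \<in> set (l (fst y))) (\<lambda>y. Z (fst y)) (\<lambda>y. f (fst y) (snd y))"
    and "PC b D Z l" "\<And>x. b \<Longrightarrow> D x \<Longrightarrow> length (l x) \<le> Z x"
  shows "PC b D Z (\<lambda>x. map (f x) (l x))"
proof -
  have eq: "foldl (\<lambda>a e. h e # a) a xs = rev (map h xs) @ a" for a xs and h :: "'u \<Rightarrow> 'v"
    by (induction xs arbitrary: a) auto
  have "PC b D Z (\<lambda>x. rev (foldl (\<lambda>a e. f x e # a) [] (l x)))"
    by (intro PC_rules assms PC_env2) (use assms in \<open>auto simp: eq\<close>)
  then show ?thesis by (simp add: eq)
qed

lemma PC_filter [PC_rules]:
  assumes "PC b (\<lambda>y. D (fst y) \<and> snd y \<in> set (l (fst y))) (\<lambda>y. Z (fst y)) (\<lambda>y. f (fst y) (snd y))"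
    and "PC b D Z l" "\<And>x. b \<Longrightarrow> D x \<Longrightarrow> length (l x) \<le> Z x"
  shows "PC b D Z (\<lambda>x. filter (f x) (l x))"
proof -
  have eq: "foldl (\<lambda>a e. if h e then e # a else a) a xs = rev (filter h xs) @ a" for a xs and h :: "'u \<Rightarrow> bool"
    by (induction xs arbitrary: a) auto
  have len: "length (filter h xs) \<le> z" if "length xs \<le> z" for h and xs :: "'u list" and z
    using length_filter_le[of h xs] that by linarith
  have "PC b D Z (\<lambda>x. rev (foldl (\<lambda>a e. if f x e then e # a else a) [] (l x)))"
  proof (rule PC_rev)
    show "PC b D Z (\<lambda>x. foldl (\<lambda>a e. if f x e then e # a else a) [] (l x))"
    proof (rule PC_foldl')
      show "PC b (\<lambda>y. D (fst (fst y)) \<and> snd y \<in> set (l (fst (fst y)))) (\<lambda>y. Z (fst (fst y)))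
        (\<lambda>y. if f (fst (fst y)) (snd y) then snd y # snd (fst y) else snd (fst y))"
        by (rule PC_if[OF PC_env2[OF assms(1)]]) (intro PC_rules)+
    qed (intro PC_rules assms | use assms in auto)+
  qed (use assms len in \<open>auto simp: eq\<close>)
  then show ?thesis by (simp add: eq)
qed

lemma PC_list_ex [PC_rules]:
  assumes "PC b (\<lambda>y. D (fst y) \<and> snd y \<in> set (l (fst y))) (\<lambda>y. Z (fst y)) (\<lambda>y. f (fst y) (snd y))"
    and "PC b D Z l" "\<And>x. b \<Longrightarrow> D x \<Longrightarrow> length (l x) \<le> Z x"
  shows "PC b D Z (\<lambda>x. list_ex (f x) (l x))"
proof -
  have eq: "(filter h xs \<noteq> []) = list_ex h xs" for h :: "'u \<Rightarrow> bool" and xs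
    by (induction xs) auto
  have "PC b D Z (\<lambda>x. filter (f x) (l x) \<noteq> [])"
    by (intro PC_rules assms) (use assms in auto)
  then show ?thesis by (simp add: eq)
qed

lemma PC_mem [PC_rules]:
  assumes "PC b D Z a" "PC b D Z l" "\<And>x. b \<Longrightarrow> D x \<Longrightarrow> length (l x) \<le> Z x"
  shows "PC b D Z (\<lambda>x. (a x :: nat) \<in> set (l x))"
proof -
  have eq: "(c \<in> set xs) = list_ex (\<lambda>e. e = c) xs" for c :: nat and xs
    by (induction xs) auto
  show ?thesis unfolding eq
    by (intro PC_rules assms PC_comp[OF PC_fst[OF PC_id] assms(1)]) (use assms in auto)
qed

lemma PC_length [PC_rules]:
  assumes "PC b D Z l" "\<And>x. b \<Longrightarrow> D x \<Longrightarrow> length (l x) \<le> Z x"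
  shows "PC b D Z (\<lambda>x. length (l x))"
proof -
  have eq: "foldl (\<lambda>a e. a + (1::nat)) a xs = length xs + a" for a and xs :: "'u list"
    by (induction xs arbitrary: a) auto
  have "PC b D Z (\<lambda>x. foldl (\<lambda>a e. a + (1::nat)) 0 (l x))"
    by (intro PC_rules assms) (use assms in auto)
  then show ?thesis unfolding eq by simp
qed

text \<open>Total list access: unlike \<open>(!)\<close>, its value outside the list is a fixed constant.\<close>

definition look :: "'a list \<Rightarrow> nat \<Rightarrow> 'a" where
  "look xs i = hd (drop i xs)"

lemma look_nth: "i < length xs \<Longrightarrow> look xs i = xs ! i"
  by (simp add: look_def hd_drop_conv_nth)

lemma look_map_upt [simp]: "i < n \<Longrightarrow> look (map f [0..<n]) i = f i"
  by (simp add: look_nth)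

text \<open>The element found is kept in a list of length at most one, so the fold can start without
  any element of the type, and a miss yields \<open>hd []\<close> as in \<open>look\<close>.\<close>

lemma look_foldl: "look xs i = hd (snd (foldl (\<lambda>s e. (Suc (fst s), if fst s = i then [e] else snd s)) (0, []) xs))"
proof -
  have "snd (foldl (\<lambda>s e. (Suc (fst s), if fst s = i then [e] else snd s)) (k, r) xs) =
      (if k \<le> i \<and> i - k < length xs then [xs ! (i - k)] else r)" for k and r :: "'a list"
  proof (induction xs arbitrary: k r)
    case (Cons x xs)
    show ?case
    proof (cases "k < i")
      case True
      then have "i - k = Suc (i - Suc k)" by simp
      then show ?thesis using Cons True by simp
    qed (use Cons in auto)
  qed simp
  then show ?thesis by (auto simp: look_def hd_drop_conv_nth)
qed

text \<open>The bound is on the list rather than on the index, which may be arbitrary.\<close>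

lemma PC_look [PC_rules]:
  assumes "PC b D Z l" "PC b D Z i" "\<And>x. b \<Longrightarrow> D x \<Longrightarrow> length (l x) \<le> Z x"
  shows "PC b D Z (\<lambda>x. look (l x) (i x))"
  unfolding look_foldl Suc_eq_plus1
  by (intro PC_rules assms PC_comp[OF PC_fst[OF PC_fst[OF PC_id]] assms(2)]) (use assms in auto)

lemma PC_list_update [PC_rules]:
  assumes "PC b D Z l" "PC b D Z i" "PC b D Z a" "\<And>x. b \<Longrightarrow> D x \<Longrightarrow> length (l x) \<le> Z x"
  shows "PC b D Z (\<lambda>x. (l x)[i x := a x])"
proof -
  have eq: "map (\<lambda>j. if j = i then c else look xs j) [0..<length xs] = xs[i := c]" for xs i and c :: 'u
    by (rule nth_equalityI) (auto simp: look_nth nth_list_update)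
  have "PC b D Z (\<lambda>x. map (\<lambda>j. if j = i x then a x else look (l x) j) [0..<length (l x)])"
    by (intro PC_rules assms PC_comp[OF PC_fst[OF PC_id] assms(1)] PC_comp[OF PC_fst[OF PC_id] assms(2)]
      PC_comp[OF PC_fst[OF PC_id] assms(3)])
      (use assms(4) in auto)
  then show ?thesis by (simp add: eq)
qed

lemma PC_eq_list [PC_rules]:
  assumes "PC b D Z l" "PC b D Z m" "\<And>x. b \<Longrightarrow> D x \<Longrightarrow> length (l x) \<le> Z x"
  shows "PC b D Z (\<lambda>x. l x = (m x :: nat list))"
proof -
  let ?g = "\<lambda>r e. (tl (fst r), snd r \<and> fst r \<noteq> [] \<and> hd (fst r) = e)"
  have eq: "(fst (foldl ?g (ys, t) xs) = [] \<and> snd (foldl ?g (ys, t) xs)) = (t \<and> xs = ys)" for t ys and xs :: "nat list"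
  proof (induction xs arbitrary: t ys)
    case (Cons x xs)
    then show ?case by (cases ys) auto
  qed auto
  have "PC b D Z (\<lambda>x. foldl ?g (m x, True) (l x))"
    by (intro PC_rules assms) (use assms in auto)
  then have "PC b D Z (\<lambda>x. (\<lambda>r. fst r = [] \<and> snd r) (foldl ?g (m x, True) (l x)))"
    by (rule PC_comp[where E="\<lambda>_. True" and W="\<lambda>_. 0"]) (auto intro!: PC_rules)
  then show ?thesis by (simp add: eq)
qed

section \<open>Terms and automata\<close>

text \<open>\<open>Lf \<kappa> i a\<close> is the element \<open>i\<close> of kind \<open>\<kappa>\<close> (0 for vertices, 1 for edges, 2 for no element at
  all), whose labels are coded by the bits of \<open>a\<close>. In \<open>Op j s t\<close> all elements of \<open>s\<close> labelled \<open>j\<close>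
  become adjacent to all elements of \<open>t\<close> and then lose this label; if only labels below \<open>K\<close> occur,
  \<open>Op K\<close> is plain concatenation. Adjacency stands for edges between vertices and for incidence
  between a vertex and an edge.\<close>

datatype trm = Lf nat nat nat | Op nat trm trm

fun elems :: "trm \<Rightarrow> (nat \<times> nat) set" where
  "elems (Lf \<kappa> i a) = (if \<kappa> < 2 then {(\<kappa>, i)} else {})"
| "elems (Op j s t) = elems s \<union> elems t"

fun dist :: "trm \<Rightarrow> bool" where
  "dist (Lf \<kappa> i a) \<longleftrightarrow> True"
| "dist (Op j s t) \<longleftrightarrow> dist s \<and> dist t \<and> elems s \<inter> elems t = {}"

fun ok_term :: "nat \<Rightarrow> trm \<Rightarrow> bool" where
  "ok_term K (Lf \<kappa> i a) \<longleftrightarrow> \<kappa> < 3 \<and> a < 2 ^ K"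
| "ok_term K (Op j s t) \<longleftrightarrow> j \<le> K \<and> ok_term K s \<and> ok_term K t"

fun lab :: "trm \<Rightarrow> nat \<times> nat \<Rightarrow> nat set" where
  "lab (Lf \<kappa> i a) x = set_decode a"
| "lab (Op j s t) x = (if x \<in> elems s then lab s x - {j} else lab t x)"

fun adjt :: "trm \<Rightarrow> ((nat \<times> nat) \<times> (nat \<times> nat)) set" where
  "adjt (Lf \<kappa> i a) = {}"
| "adjt (Op j s t) = adjt s \<union> adjt t \<union> {(x, y). x \<in> elems s \<and> j \<in> lab s x \<and> y \<in> elems t}
     \<union> {(y, x). x \<in> elems s \<and> j \<in> lab s x \<and> y \<in> elems t}"

fun bef :: "trm \<Rightarrow> ((nat \<times> nat) \<times> (nat \<times> nat)) set" where
  "bef (Lf \<kappa> i a) = {}"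
| "bef (Op j s t) = bef s \<union> bef t \<union> elems s \<times> elems t"

definition ids :: "nat \<Rightarrow> trm \<Rightarrow> nat set" where
  "ids \<kappa> t = {i. (\<kappa>, i) \<in> elems t}"

lemma ids_simps [simp]:
  "ids \<kappa> (Lf \<kappa>' i a) = (if \<kappa> = \<kappa>' \<and> \<kappa> < 2 then {i} else {})"
  "ids \<kappa> (Op j s t) = ids \<kappa> s \<union> ids \<kappa> t"
  by (auto simp: ids_def)

lemma finite_elems [simp]: "finite (elems t)"
  by (induction t) auto

lemma finite_ids [simp]: "finite (ids \<kappa> t)"
proof -
  have "ids \<kappa> t \<subseteq> snd ` elems t" by (force simp: ids_def)
  then show ?thesis by (rule finite_subset) simp
qed

lemma dist_ids: "dist (Op j s t) \<Longrightarrow> ids \<kappa> s \<inter> ids \<kappa> t = {}"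
  by (auto simp: ids_def)

lemma bef_elems: "bef t \<subseteq> elems t \<times> elems t"
  by (induction t) auto

text \<open>\<open>bef\<close> of an \<open>Op\<close> term is the ordered sum of the orders of its
  parts; that the parts share no element is what irreflexivity and transitivity rest on.\<close>

lemma bef_strict_linear_order:
  assumes "dist t"
  shows "trans (bef t)" "irrefl (bef t)"
    "x \<in> elems t \<Longrightarrow> y \<in> elems t \<Longrightarrow> x \<noteq> y \<Longrightarrow> (x, y) \<in> bef t \<or> (y, x) \<in> bef t"
  using assms
proof (induction t)
  case (Op j s t)
  note b = bef_elems[of s] bef_elems[of t]
  {
    case 1
    show ?case
    proof (rule transI)
      fix x y z assume "(x, y) \<in> bef (Op j s t)" "(y, z) \<in> bef (Op j s t)"
      then show "(x, z) \<in> bef (Op j s t)"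
        using transD[OF Op.IH(1), of x y z] transD[OF Op.IH(4), of x y z] 1 b
        by (simp, blast)
    qed
  next
    case 2 then show ?case using Op.IH(2,5) b unfolding irrefl_def by (simp, blast)
  next
    case 3 then show ?case using Op.IH(3,6) by (simp, blast)
  }
next
  case (Lf \<kappa> i a)
  {
    case 1 show ?case by (simp add: trans_def)
  next
    case 2 show ?case by (simp add: irrefl_def)
  next
    case 3 then show ?case by (cases "\<kappa> < 2") simp_all
  }
qed

section \<open>Semantics of formulas over terms\<close>

type_synonym asg = "nat \<Rightarrow> nat \<Rightarrow> nat set"

definition upd :: "asg \<Rightarrow> nat \<Rightarrow> nat \<Rightarrow> nat set \<Rightarrow> asg" where
  "upd \<alpha> \<kappa> p S = \<alpha>(\<kappa> := (\<alpha> \<kappa>)(p := S))"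

lemma upd_apply: "upd \<alpha> \<kappa> p S \<kappa>' q = (if \<kappa>' = \<kappa> \<and> q = p then S else \<alpha> \<kappa>' q)"
  by (auto simp: upd_def)

text \<open>With a singleton on the left, inclusion expresses membership, and equality if the right
  side is a singleton too; one automaton thus serves four kinds of atoms.\<close>

definition subt :: "trm \<Rightarrow> asg \<Rightarrow> nat \<Rightarrow> nat \<Rightarrow> nat \<Rightarrow> bool" where
  "subt t \<alpha> \<kappa> p q \<longleftrightarrow> ids \<kappa> t \<inter> \<alpha> \<kappa> p \<subseteq> \<alpha> \<kappa> q"

definition link :: "((nat \<times> nat) \<times> (nat \<times> nat)) set \<Rightarrow> asg \<Rightarrow> nat \<Rightarrow> nat \<Rightarrow> nat \<Rightarrow> nat \<Rightarrow> bool" where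
  "link R \<alpha> \<kappa> p \<kappa>' q \<longleftrightarrow> (\<exists>u\<in>\<alpha> \<kappa> p. \<exists>w\<in>\<alpha> \<kappa>' q. ((\<kappa>, u), (\<kappa>', w)) \<in> R)"

text \<open>Variables of the four sorts are numbered per kind of element (0 for vertices, 1 for edges):
  the first-order variable \<open>x\<close> gets the number \<open>2 * x\<close>, the set variable \<open>X\<close> gets \<open>2 * X + 1\<close>.
  First-order variables denote singletons.\<close>

fun sem :: "trm \<Rightarrow> asg \<Rightarrow> mso2 \<Rightarrow> bool" where
  "sem t \<alpha> (Eq_V x y) \<longleftrightarrow> subt t \<alpha> 0 (2 * x) (2 * y)"
| "sem t \<alpha> (Eq_E e f) \<longleftrightarrow> subt t \<alpha> 1 (2 * e) (2 * f)"
| "sem t \<alpha> (Adj x y) \<longleftrightarrow> link (adjt t) \<alpha> 0 (2 * x) 0 (2 * y)"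
| "sem t \<alpha> (Inc x e) \<longleftrightarrow> link (adjt t) \<alpha> 0 (2 * x) 1 (2 * e)"
| "sem t \<alpha> (Less x y) \<longleftrightarrow> link (bef t) \<alpha> 0 (2 * x) 0 (2 * y)"
| "sem t \<alpha> (Mem_V x X) \<longleftrightarrow> subt t \<alpha> 0 (2 * x) (2 * X + 1)"
| "sem t \<alpha> (Mem_E e F) \<longleftrightarrow> subt t \<alpha> 1 (2 * e) (2 * F + 1)"
| "sem t \<alpha> (Neg \<phi>) \<longleftrightarrow> \<not> sem t \<alpha> \<phi>"
| "sem t \<alpha> (Conj \<phi> \<psi>) \<longleftrightarrow> sem t \<alpha> \<phi> \<and> sem t \<alpha> \<psi>"
| "sem t \<alpha> (Ex_V x \<phi>) \<longleftrightarrow> (\<exists>i\<in>ids 0 t. sem t (upd \<alpha> 0 (2 * x) {i}) \<phi>)"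
| "sem t \<alpha> (Ex_E e \<phi>) \<longleftrightarrow> (\<exists>i\<in>ids 1 t. sem t (upd \<alpha> 1 (2 * e) {i}) \<phi>)"
| "sem t \<alpha> (Ex_VS X \<phi>) \<longleftrightarrow> (\<exists>S\<subseteq>ids 0 t. sem t (upd \<alpha> 0 (2 * X + 1) S) \<phi>)"
| "sem t \<alpha> (Ex_ES F \<phi>) \<longleftrightarrow> (\<exists>S\<subseteq>ids 1 t. sem t (upd \<alpha> 1 (2 * F + 1) S) \<phi>)"

definition represents :: "trm \<Rightarrow> (nat \<Rightarrow> 'v) \<Rightarrow> (nat \<Rightarrow> 'v set) \<Rightarrow> 'v graph \<Rightarrow> ('v \<times> 'v) set \<Rightarrow> bool" where
  "represents t V W G lt \<longleftrightarrow>
     inj_on V (ids 0 t) \<and> V ` ids 0 t = verts G \<and> inj_on W (ids 1 t) \<and> W ` ids 1 t = edges G \<and>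
     (\<forall>u\<in>ids 0 t. \<forall>w\<in>ids 0 t. ((0, u), (0, w)) \<in> adjt t \<longleftrightarrow> {V u, V w} \<in> edges G) \<and>
     (\<forall>u\<in>ids 0 t. \<forall>e\<in>ids 1 t. ((0, u), (1, e)) \<in> adjt t \<longleftrightarrow> V u \<in> W e) \<and>
     lt = {(V u, V w) | u w. u \<in> ids 0 t \<and> w \<in> ids 0 t \<and> ((0, u), (0, w)) \<in> bef t}"

fun agree :: "trm \<Rightarrow> (nat \<Rightarrow> 'v) \<Rightarrow> (nat \<Rightarrow> 'v set) \<Rightarrow> asg \<Rightarrow> (nat \<Rightarrow> 'v) \<Rightarrow> (nat \<Rightarrow> 'v set) \<Rightarrow>
    (nat \<Rightarrow> 'v set) \<Rightarrow> (nat \<Rightarrow> 'v set set) \<Rightarrow> mso2_var \<Rightarrow> bool" where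
  "agree t V W \<alpha> a b A B (V_var x) \<longleftrightarrow> (\<exists>i\<in>ids 0 t. \<alpha> 0 (2 * x) = {i} \<and> a x = V i)"
| "agree t V W \<alpha> a b A B (E_var e) \<longleftrightarrow> (\<exists>i\<in>ids 1 t. \<alpha> 1 (2 * e) = {i} \<and> b e = W i)"
| "agree t V W \<alpha> a b A B (VS_var X) \<longleftrightarrow> \<alpha> 0 (2 * X + 1) \<subseteq> ids 0 t \<and> A X = V ` \<alpha> 0 (2 * X + 1)"
| "agree t V W \<alpha> a b A B (ES_var F) \<longleftrightarrow> \<alpha> 1 (2 * F + 1) \<subseteq> ids 1 t \<and> B F = W ` \<alpha> 1 (2 * F + 1)"

lemma double_neq_Suc_double: "2 * (x::nat) \<noteq> Suc (2 * y)" "Suc (2 * y) \<noteq> 2 * (x::nat)"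
  by presburger+

text \<open>First-order and set variables of one kind share the function
  \<open>\<alpha> \<kappa>\<close> and are kept apart by the parity of their numbers.\<close>

lemma agree_upd:
  "agree t V W \<alpha> a b A B v \<Longrightarrow> v \<noteq> V_var x \<Longrightarrow> agree t V W (upd \<alpha> 0 (2 * x) S) (a(x := c)) b A B v"
  "agree t V W \<alpha> a b A B v \<Longrightarrow> v \<noteq> E_var x \<Longrightarrow> agree t V W (upd \<alpha> 1 (2 * x) S) a (b(x := d)) A B v"
  "agree t V W \<alpha> a b A B v \<Longrightarrow> v \<noteq> VS_var x \<Longrightarrow> agree t V W (upd \<alpha> 0 (2 * x + 1) S) a b (A(x := C)) B v"
  "agree t V W \<alpha> a b A B v \<Longrightarrow> v \<noteq> ES_var x \<Longrightarrow> agree t V W (upd \<alpha> 1 (2 * x + 1) S) a b A (B(x := E)) v"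
  by (cases v; auto simp: upd_apply double_neq_Suc_double)+

lemma sem_holds:
  assumes r: "represents t V W G lt" and "\<And>v. v \<in> free_vars \<phi> \<Longrightarrow> agree t V W \<alpha> a b A B v"
  shows "sem t \<alpha> \<phi> \<longleftrightarrow> holds G lt a b A B \<phi>"
  using assms(2)
proof (induction \<phi> arbitrary: \<alpha> a b A B)
  case (Eq_V x y)
  from Eq_V[of "V_var x"] Eq_V[of "V_var y"] obtain i j where
    "i \<in> ids 0 t" "\<alpha> 0 (2 * x) = {i}" "a x = V i" "j \<in> ids 0 t" "\<alpha> 0 (2 * y) = {j}" "a y = V j" by auto
  then show ?case using r by (auto simp: subt_def represents_def inj_on_def)
next
  case (Eq_E x y)
  from Eq_E[of "E_var x"] Eq_E[of "E_var y"] obtain i j where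
    "i \<in> ids 1 t" "\<alpha> 1 (2 * x) = {i}" "b x = W i" "j \<in> ids 1 t" "\<alpha> 1 (2 * y) = {j}" "b y = W j" by auto
  then show ?case using r by (auto simp: subt_def represents_def inj_on_def)
next
  case (Adj x y)
  from Adj[of "V_var x"] Adj[of "V_var y"] obtain i j where
    "i \<in> ids 0 t" "\<alpha> 0 (2 * x) = {i}" "a x = V i" "j \<in> ids 0 t" "\<alpha> 0 (2 * y) = {j}" "a y = V j" by auto
  then show ?case using r by (simp add: link_def represents_def)
next
  case (Inc x y)
  from Inc[of "V_var x"] Inc[of "E_var y"] obtain i j where
    "i \<in> ids 0 t" "\<alpha> 0 (2 * x) = {i}" "a x = V i" "j \<in> ids 1 t" "\<alpha> 1 (2 * y) = {j}" "b y = W j" by auto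
  then show ?case using r by (simp add: link_def represents_def)
next
  case (Less x y)
  from Less[of "V_var x"] Less[of "V_var y"] obtain i j where
    ij: "i \<in> ids 0 t" "\<alpha> 0 (2 * x) = {i}" "a x = V i" "j \<in> ids 0 t" "\<alpha> 0 (2 * y) = {j}" "a y = V j" by auto
  moreover have "(V i, V j) \<in> lt \<longleftrightarrow> ((0, i), (0, j)) \<in> bef t"
  proof -
    have inj: "inj_on V (ids 0 t)" and lt: "lt = {(V u, V w) | u w. u \<in> ids 0 t \<and> w \<in> ids 0 t \<and> ((0, u), (0, w)) \<in> bef t}"
      using r by (auto simp: represents_def)
    show ?thesis
    proof
      assume "(V i, V j) \<in> lt"
      then obtain u w where "V i = V u" "V j = V w" "u \<in> ids 0 t" "w \<in> ids 0 t" "((0, u), (0, w)) \<in> bef t"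
        unfolding lt by blast
      then show "((0, i), (0, j)) \<in> bef t"
        using inj_onD[OF inj, of i u] inj_onD[OF inj, of j w] ij(1,4) by simp
    next
      assume "((0, i), (0, j)) \<in> bef t"
      then show "(V i, V j) \<in> lt" unfolding lt using ij(1,4) by blast
    qed
  qed
  ultimately show ?case by (simp add: link_def)
next
  case (Mem_V x X)
  from Mem_V[of "V_var x"] Mem_V[of "VS_var X"] obtain i where
    "i \<in> ids 0 t" "\<alpha> 0 (2 * x) = {i}" "a x = V i" "\<alpha> 0 (2 * X + 1) \<subseteq> ids 0 t" "A X = V ` \<alpha> 0 (2 * X + 1)" by auto
  moreover from this have "subt t \<alpha> 0 (2 * x) (2 * X + 1) \<longleftrightarrow> i \<in> \<alpha> 0 (2 * X + 1)"
    by (auto simp: subt_def)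
  moreover have "inj_on V (ids 0 t)" using r by (simp add: represents_def)
  ultimately show ?case by (simp add: inj_on_image_mem_iff)
next
  case (Mem_E x X)
  from Mem_E[of "E_var x"] Mem_E[of "ES_var X"] obtain i where
    "i \<in> ids 1 t" "\<alpha> 1 (2 * x) = {i}" "b x = W i" "\<alpha> 1 (2 * X + 1) \<subseteq> ids 1 t" "B X = W ` \<alpha> 1 (2 * X + 1)" by auto
  moreover from this have "subt t \<alpha> 1 (2 * x) (2 * X + 1) \<longleftrightarrow> i \<in> \<alpha> 1 (2 * X + 1)"
    by (auto simp: subt_def)
  moreover have "inj_on W (ids 1 t)" using r by (simp add: represents_def)
  ultimately show ?case by (simp add: inj_on_image_mem_iff)
next
  case (Neg \<phi>)
  then show ?case by simp
next
  case (Conj \<phi> \<psi>)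
  have "sem t \<alpha> \<phi> \<longleftrightarrow> holds G lt a b A B \<phi>" by (rule Conj.IH) (simp add: Conj.prems)
  moreover have "sem t \<alpha> \<psi> \<longleftrightarrow> holds G lt a b A B \<psi>" by (rule Conj.IH) (simp add: Conj.prems)
  ultimately show ?case by simp
next
  case (Ex_V x \<phi>)
  have "sem t (upd \<alpha> 0 (2 * x) {i}) \<phi> \<longleftrightarrow> holds G lt (a(x := V i)) b A B \<phi>" if "i \<in> ids 0 t" for i
  proof (rule Ex_V.IH)
    fix v assume "v \<in> free_vars \<phi>"
    then show "agree t V W (upd \<alpha> 0 (2 * x) {i}) (a(x := V i)) b A B v"
      using Ex_V.prems[of v] agree_upd(1)[of t V W \<alpha> a b A B v x] that
      by (cases "v = V_var x") (auto simp: upd_apply)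
  qed
  moreover have "verts G = V ` ids 0 t" using r by (auto simp: represents_def)
  ultimately show ?case by auto
next
  case (Ex_E x \<phi>)
  have "sem t (upd \<alpha> 1 (2 * x) {i}) \<phi> \<longleftrightarrow> holds G lt a (b(x := W i)) A B \<phi>" if "i \<in> ids 1 t" for i
  proof (rule Ex_E.IH)
    fix v assume "v \<in> free_vars \<phi>"
    then show "agree t V W (upd \<alpha> 1 (2 * x) {i}) a (b(x := W i)) A B v"
      using Ex_E.prems[of v] agree_upd(2)[of t V W \<alpha> a b A B v x] that
      by (cases "v = E_var x") (auto simp: upd_apply)
  qed
  moreover have "edges G = W ` ids 1 t" using r by (auto simp: represents_def)
  ultimately show ?case by auto
next
  case (Ex_VS x \<phi>)
  have "sem t (upd \<alpha> 0 (2 * x + 1) S) \<phi> \<longleftrightarrow> holds G lt a b (A(x := V ` S)) B \<phi>" if "S \<subseteq> ids 0 t" for S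
  proof (rule Ex_VS.IH)
    fix v assume "v \<in> free_vars \<phi>"
    then show "agree t V W (upd \<alpha> 0 (2 * x + 1) S) a b (A(x := V ` S)) B v"
      using Ex_VS.prems[of v] agree_upd(3)[of t V W \<alpha> a b A B v x] that
      by (cases "v = VS_var x") (auto simp: upd_apply)
  qed
  moreover have "verts G = V ` ids 0 t" using r by (auto simp: represents_def)
  ultimately show ?case by (auto simp: subset_image_iff) 
next
  case (Ex_ES x \<phi>)
  have "sem t (upd \<alpha> 1 (2 * x + 1) S) \<phi> \<longleftrightarrow> holds G lt a b A (B(x := W ` S)) \<phi>" if "S \<subseteq> ids 1 t" for S
  proof (rule Ex_ES.IH)
    fix v assume "v \<in> free_vars \<phi>"
    then show "agree t V W (upd \<alpha> 1 (2 * x + 1) S) a b A (B(x := W ` S)) v"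
      using Ex_ES.prems[of v] agree_upd(4)[of t V W \<alpha> a b A B v x] that
      by (cases "v = ES_var x") (auto simp: upd_apply)
  qed
  moreover have "edges G = W ` ids 1 t" using r by (auto simp: represents_def)
  ultimately show ?case by (auto simp: subset_image_iff)
qed

section \<open>Bottom-up automata: complement, product and projection\<close>

text \<open>A deterministic automaton as data for the RAM, with states below
  \<open>length (acc A)\<close>. The first table is indexed by operation and two states, the second
  by kind, label code and the code of the set of variables that contain the leaf; the last component
  holds the acceptance bits.\<close>

type_synonym aut = "nat list list list \<times> nat list list list \<times> bool list"

definition acc :: "aut \<Rightarrow> bool list" where "acc A = snd (snd A)"

definition comb :: "aut \<Rightarrow> nat \<Rightarrow> nat \<Rightarrow> nat \<Rightarrow> nat" where
  "comb A j v w = look (look (look (fst A) j) v) w"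

definition base :: "aut \<Rightarrow> nat \<Rightarrow> nat \<Rightarrow> nat \<Rightarrow> nat" where
  "base A \<kappa> a m = look (look (look (fst (snd A)) \<kappa>) a) m"

fun run :: "nat \<Rightarrow> aut \<Rightarrow> asg \<Rightarrow> trm \<Rightarrow> nat" where
  "run M A \<alpha> (Lf \<kappa> i a) = base A \<kappa> a (set_encode {p. p < M \<and> i \<in> \<alpha> \<kappa> p})"
| "run M A \<alpha> (Op j s t) = comb A j (run M A \<alpha> s) (run M A \<alpha> t)"

definition wfA :: "nat \<Rightarrow> nat \<Rightarrow> aut \<Rightarrow> bool" where
  "wfA K M A \<longleftrightarrow>
     (\<forall>j v w. j \<le> K \<longrightarrow> v < length (acc A) \<longrightarrow> w < length (acc A) \<longrightarrow> comb A j v w < length (acc A)) \<and>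
     (\<forall>\<kappa> a m. \<kappa> < 3 \<longrightarrow> a < 2 ^ K \<longrightarrow> m < 2 ^ M \<longrightarrow> base A \<kappa> a m < length (acc A))"

lemma set_decode_subset: "n < 2 ^ d \<Longrightarrow> set_decode n \<subseteq> {..<d}"
proof
  fix i assume n: "n < 2 ^ d" and "i \<in> set_decode n"
  then have "n div 2 ^ i \<noteq> 0" by (auto simp: set_decode_def intro: ccontr)
  then have "2 ^ i \<le> n" by (simp add: div_eq_0_iff)
  with n have "(2::nat) ^ i < 2 ^ d" by linarith
  then show "i \<in> {..<d}" by simp
qed

lemma set_encode_less: "X \<subseteq> {..<d} \<Longrightarrow> set_encode X < 2 ^ d"
proof -
  assume "X \<subseteq> {..<d}"
  then have "set_encode X \<le> (\<Sum>i<d. 2 ^ i)"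
    unfolding set_encode_def by (intro sum_mono2) auto
  also have "\<dots> < (2::nat) ^ d" by (induction d) auto
  finally show ?thesis .
qed

lemma run_less: "wfA K M A \<Longrightarrow> ok_term K t \<Longrightarrow> run M A \<alpha> t < length (acc A)"
proof (induction t)
  case (Lf \<kappa> i a)
  have "set_encode {p. p < M \<and> i \<in> \<alpha> \<kappa> p} < 2 ^ M" by (rule set_encode_less) auto
  with Lf show ?case by (simp add: wfA_def)
qed (auto simp: wfA_def)

text \<open>Arithmetic forms of membership, insertion and deletion for sets coded as bits. The RAM
  has to compute them; the proofs only see \<open>set_decode\<close>.\<close>

definition mem :: "nat \<Rightarrow> nat \<Rightarrow> bool" where "mem i m \<longleftrightarrow> (m div 2 ^ i) mod 2 = 1"

lemma mem_iff [simp]: "mem i m \<longleftrightarrow> i \<in> set_decode m"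
  by (simp add: mem_def set_decode_def odd_iff_mod_2_eq_one)

definition ins :: "nat \<Rightarrow> nat \<Rightarrow> nat" where "ins m i = (if mem i m then m else m + 2 ^ i)"
definition del :: "nat \<Rightarrow> nat \<Rightarrow> nat" where "del m i = (if mem i m then m - 2 ^ i else m)"
definition enc :: "nat list \<Rightarrow> nat" where "enc xs = foldl ins 0 xs"

lemma set_decode_ins [simp]: "set_decode (ins m i) = insert i (set_decode m)"
  by (auto simp: ins_def set_decode_plus_power_2 add.commute[of m])

lemma set_decode_del [simp]: "set_decode (del m i) = set_decode m - {i}"
proof (cases "i \<in> set_decode m")
  case True
  have "m = set_encode (insert i (set_decode m - {i}))"
    using True by (simp add: insert_absorb)
  also have "\<dots> = 2 ^ i + set_encode (set_decode m - {i})"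
    by (rule set_encode_insert) auto
  finally have "m - 2 ^ i = set_encode (set_decode m - {i})" by linarith
  then show ?thesis using True by (simp add: del_def)
qed (simp add: del_def)

lemma set_decode_enc [simp]: "set_decode (enc xs) = set xs"
proof -
  have "set_decode (foldl ins m xs) = set_decode m \<union> set xs" for m
    by (induction xs arbitrary: m) auto
  then show ?thesis by (simp add: enc_def)
qed

lemma less_power2_iff: "n < 2 ^ d \<longleftrightarrow> set_decode n \<subseteq> {..<d}"
  using set_decode_subset set_encode_less by (metis set_decode_inverse)

definition ctab :: "(nat \<Rightarrow> nat \<Rightarrow> nat \<Rightarrow> nat) \<Rightarrow> nat \<Rightarrow> nat \<Rightarrow> nat list list list" where
  "ctab F J d = map (\<lambda>j. map (\<lambda>v. map (F j v) [0..<d]) [0..<d]) [0..<J]"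

definition btab :: "(nat \<Rightarrow> nat \<Rightarrow> nat \<Rightarrow> nat) \<Rightarrow> nat \<Rightarrow> nat \<Rightarrow> nat list list list" where
  "btab F K M = map (\<lambda>\<kappa>. map (\<lambda>a. map (F \<kappa> a) [0..<2 ^ M]) [0..<2 ^ K]) [0..<3]"

lemma comb_ctab [simp]: "j < J \<Longrightarrow> v < d \<Longrightarrow> w < d \<Longrightarrow> comb (ctab F J d, z) j v w = F j v w"
  by (simp add: comb_def ctab_def)

lemma base_btab [simp]: "\<kappa> < 3 \<Longrightarrow> a < 2 ^ K \<Longrightarrow> m < 2 ^ M \<Longrightarrow> base (c, btab F K M, z) \<kappa> a m = F \<kappa> a m"
  by (simp add: base_def btab_def)

lemma acc_simp [simp]: "acc (c, b, z) = z"
  by (simp add: acc_def)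

definition recog :: "nat \<Rightarrow> nat \<Rightarrow> aut \<Rightarrow> (trm \<Rightarrow> asg \<Rightarrow> bool) \<Rightarrow> bool" where
  "recog K M A S \<longleftrightarrow> wfA K M A \<and>
     (\<forall>t \<alpha>. ok_term K t \<longrightarrow> dist t \<longrightarrow> (look (acc A) (run M A \<alpha> t) \<longleftrightarrow> S t \<alpha>))"

definition autneg :: "aut \<Rightarrow> aut" where
  "autneg A = (fst A, fst (snd A), map (\<lambda>b. \<not> b) (snd (snd A)))"

lemma recog_neg: assumes A: "recog K M A S" shows "recog K M (autneg A) (\<lambda>t \<alpha>. \<not> S t \<alpha>)"
proof -
  have [simp]: "comb (autneg A) = comb A" "base (autneg A) = base A" "acc (autneg A) = map Not (acc A)"
    by (auto simp: autneg_def comb_def base_def acc_def fun_eq_iff)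
  have "run M (autneg A) \<alpha> t = run M A \<alpha> t" for \<alpha> t by (induction t) auto
  then show ?thesis using A run_less[of K M A]
    by (auto simp: recog_def wfA_def look_nth)
qed

text \<open>Product automaton. A pair of states is coded as \<open>v + d * w\<close>, where
  \<open>d = length (acc A)\<close> is the number of states of \<open>A\<close>, so that
  \<open>mod\<close> and \<open>div\<close> by \<open>d\<close> are the projections.\<close>

definition autconj :: "nat \<Rightarrow> nat \<Rightarrow> aut \<Rightarrow> aut \<Rightarrow> aut" where
  "autconj K M A B = (ctab (\<lambda>j v w. comb A j (v mod length (acc A)) (w mod length (acc A))
      + length (acc A) * comb B j (v div length (acc A)) (w div length (acc A)))
      (Suc K) (length (acc A) * length (acc B)),
     btab (\<lambda>\<kappa> a m. base A \<kappa> a m + length (acc A) * base B \<kappa> a m) K M,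
     map (\<lambda>v. look (acc A) (v mod length (acc A)) \<and> look (acc B) (v div length (acc A)))
       [0..<length (acc A) * length (acc B)])"

lemma pair_less: "(v::nat) < d \<Longrightarrow> w < e \<Longrightarrow> v + d * w < d * e"
proof -
  assume "v < d" "w < e"
  then have "v + d * w < d * Suc w" by simp
  also have "\<dots> \<le> d * e" using \<open>w < e\<close> by (intro mult_left_mono) auto
  finally show ?thesis .
qed

lemma pair_div: "x < d \<Longrightarrow> (x + d * y) div d = (y::nat)"
  using div_mult_self2[of d x y] by simp

lemma recog_conj:
  assumes A: "recog K M A S" and B: "recog K M B T"
  shows "recog K M (autconj K M A B) (\<lambda>t \<alpha>. S t \<alpha> \<and> T t \<alpha>)"
proof -
  let ?C = "autconj K M A B" and ?d = "length (acc A)" and ?e = "length (acc B)"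
  have wA: "wfA K M A" and wB: "wfA K M B" using A B by (auto simp: recog_def)
  have len: "length (acc ?C) = ?d * ?e" by (simp add: autconj_def)
  have comb: "comb ?C j v w = comb A j (v mod ?d) (w mod ?d) + ?d * comb B j (v div ?d) (w div ?d)"
    if "j \<le> K" "v < ?d * ?e" "w < ?d * ?e" for j v w
    using that by (simp add: autconj_def)
  have base: "base ?C \<kappa> a m = base A \<kappa> a m + ?d * base B \<kappa> a m"
    if "\<kappa> < 3" "a < 2 ^ K" "m < 2 ^ M" for \<kappa> a m
    using that by (simp add: autconj_def)
  have wC: "wfA K M ?C"
    unfolding wfA_def len
  proof (intro conjI allI impI)
    fix j v w :: nat assume a: "j \<le> K" "v < ?d * ?e" "w < ?d * ?e"
    then have "v mod ?d < ?d" "w mod ?d < ?d" by (auto intro!: mod_less_divisor intro: gr0I)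
    moreover have "v div ?d < ?e" "w div ?d < ?e"
      using a less_mult_imp_div_less[of v ?e ?d] less_mult_imp_div_less[of w ?e ?d]
      by (simp_all add: mult.commute)
    ultimately show "comb ?C j v w < ?d * ?e"
      using wA wB a(1) unfolding comb[OF a] wfA_def by (intro pair_less) blast+
  next
    fix \<kappa> a m :: nat assume "\<kappa> < 3" "a < 2 ^ K" "m < (2::nat) ^ M"
    then show "base ?C \<kappa> a m < ?d * ?e"
      using wA wB unfolding wfA_def by (subst base) (auto intro!: pair_less)
  qed
  have run: "run M ?C \<alpha> t = run M A \<alpha> t + ?d * run M B \<alpha> t" if "ok_term K t" for t \<alpha>
    using that
  proof (induction t)
    case (Lf \<kappa> i a)
    have "set_encode {p. p < M \<and> i \<in> \<alpha> \<kappa> p} < 2 ^ M" by (rule set_encode_less) auto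
    with Lf show ?case by (simp add: base)
  next
    case (Op j s t)
    have "run M A \<alpha> s < ?d" "run M B \<alpha> s < ?e" "run M A \<alpha> t < ?d" "run M B \<alpha> t < ?e"
      using Op.prems by (auto intro: run_less wA wB)
    with Op show ?case by (simp add: comb pair_less pair_div)
  qed
  show ?thesis
    unfolding recog_def
  proof (intro conjI allI impI wC)
    fix t \<alpha> assume t: "ok_term K t" "dist t"
    have l: "run M A \<alpha> t < ?d" "run M B \<alpha> t < ?e" using t by (auto intro: run_less wA wB)
    have "look (acc ?C) (run M ?C \<alpha> t) \<longleftrightarrow> look (acc A) (run M A \<alpha> t) \<and> look (acc B) (run M B \<alpha> t)"
      using l pair_less[OF l] run[OF t(1)] by (simp add: autconj_def pair_div)
    then show "look (acc ?C) (run M ?C \<alpha> t) \<longleftrightarrow> S t \<alpha> \<and> T t \<alpha>"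
      using A B t by (simp add: recog_def)
  qed
qed

definition bits :: "nat \<Rightarrow> nat \<Rightarrow> nat list" where "bits d m = filter (\<lambda>i. mem i m) [0..<d]"

lemma set_bits [simp]: "m < 2 ^ d \<Longrightarrow> set (bits d m) = set_decode m"
  using set_decode_subset[of m d] by (auto simp: bits_def)

definition allpairs :: "(nat \<Rightarrow> nat \<Rightarrow> nat) \<Rightarrow> nat list \<Rightarrow> nat list \<Rightarrow> nat list" where
  "allpairs f xs ys = foldl (\<lambda>a x. map (f x) ys @ a) [] xs"

lemma set_allpairs [simp]: "set (allpairs f xs ys) = {f x y | x y. x \<in> set xs \<and> y \<in> set ys}"
proof -
  have "set (foldl (\<lambda>a x. map (f x) ys @ a) zs xs) = {f x y | x y. x \<in> set xs \<and> y \<in> set ys} \<union> set zs" for zs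
    by (induction xs arbitrary: zs) auto
  then show ?thesis by (simp add: allpairs_def)
qed

text \<open>Projection and subset construction in one. A state is the bit code of a set of states of
  \<open>A\<close>; a leaf of kind \<open>\<kappa>\<close> guesses whether it belongs to the
  quantified set by clearing or setting bit \<open>p\<close>.\<close>

definition autex :: "nat \<Rightarrow> nat \<Rightarrow> nat \<Rightarrow> nat \<Rightarrow> aut \<Rightarrow> aut" where
  "autex K M \<kappa> p A = (ctab (\<lambda>j v w. enc (allpairs (comb A j) (bits (length (acc A)) v) (bits (length (acc A)) w)))
      (Suc K) (2 ^ length (acc A)),
     btab (\<lambda>\<kappa>' a m. enc (if \<kappa>' = \<kappa> then [base A \<kappa>' a (del m p), base A \<kappa>' a (ins m p)] else [base A \<kappa>' a m])) K M,
     map (\<lambda>v. list_ex (\<lambda>s. look (acc A) s) (bits (length (acc A)) v)) [0..<2 ^ length (acc A)])"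

text \<open>A leaf asks of a set only whether it contains the leaf itself, so what lies outside the
  term is invisible. For kind 2 this would fail, since such leaves carry a number that
  \<open>ids\<close> does not list.\<close>

lemma run_upd_cong:
  assumes "\<kappa> < 2" "S \<inter> ids \<kappa> t = S' \<inter> ids \<kappa> t"
  shows "run M A (upd \<alpha> \<kappa> p S) t = run M A (upd \<alpha> \<kappa> p S') t"
  using assms(2)
proof (induction t)
  case (Lf \<kappa>' i a)
  have "{q. q < M \<and> i \<in> upd \<alpha> \<kappa> p S \<kappa>' q} = {q. q < M \<and> i \<in> upd \<alpha> \<kappa> p S' \<kappa>' q}"
    using Lf assms(1) by (auto simp: upd_apply split: if_splits)
  then show ?case by simp
next
  case (Op j s t)
  then have "S \<inter> ids \<kappa> s = S' \<inter> ids \<kappa> s" "S \<inter> ids \<kappa> t = S' \<inter> ids \<kappa> t" by auto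
  with Op show ?case by simp
qed

text \<open>The two sides of an \<open>Op\<close> term have disjoint elements, so one set for the
  whole term amounts to independent choices on the sides. Hence the bit set reached is the set of
  states that \<open>A\<close> reaches for some \<open>X\<close>.\<close>

lemma recog_ex:
  assumes A: "recog K M A S" and \<kappa>: "\<kappa> < 2" and p: "p < M"
  shows "recog K M (autex K M \<kappa> p A) (\<lambda>t \<alpha>. \<exists>X\<subseteq>ids \<kappa> t. S t (upd \<alpha> \<kappa> p X))"
proof -
  let ?C = "autex K M \<kappa> p A" and ?d = "length (acc A)"
  have wA: "wfA K M A" using A by (auto simp: recog_def)
  have len: "length (acc ?C) = 2 ^ ?d" by (simp add: autex_def)
  have comb: "set_decode (comb ?C j v w) = {comb A j s t | s t. s \<in> set_decode v \<and> t \<in> set_decode w}"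
    if "j \<le> K" "v < 2 ^ ?d" "w < 2 ^ ?d" for j v w
    using that by (simp add: autex_def)
  have base: "set_decode (base ?C \<kappa>' a m) =
      (if \<kappa>' = \<kappa> then {base A \<kappa> a (del m p), base A \<kappa> a (ins m p)} else {base A \<kappa>' a m})"
    if "\<kappa>' < 3" "a < 2 ^ K" "m < 2 ^ M" for \<kappa>' a m
    using that by (auto simp: autex_def)
  have delins: "del m p < 2 ^ M" "ins m p < 2 ^ M" if "m < 2 ^ M" for m
    using that p by (auto simp: less_power2_iff)
  have wC: "wfA K M ?C"
    unfolding wfA_def len
  proof (intro conjI allI impI)
    fix j v w :: nat assume a: "j \<le> K" "v < 2 ^ ?d" "w < (2::nat) ^ ?d"
    then show "comb ?C j v w < 2 ^ ?d"
      using wA set_decode_subset[OF a(2)] set_decode_subset[OF a(3)] a(1)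
      unfolding less_power2_iff[of "comb _ _ _ _"] comb[OF a] wfA_def lessThan_def by blast
  next
    fix \<kappa>' a m :: nat assume a: "\<kappa>' < 3" "a < 2 ^ K" "m < (2::nat) ^ M"
    then show "base ?C \<kappa>' a m < 2 ^ ?d"
      using wA base[OF a] delins[OF a(3)] by (subst less_power2_iff) (auto simp: wfA_def)
  qed
  have run: "set_decode (run M ?C \<alpha> t) = {run M A (upd \<alpha> \<kappa> p X) t | X. X \<subseteq> ids \<kappa> t}"
    if "ok_term K t" "dist t" for t \<alpha>
    using that
  proof (induction t)
    case (Lf \<kappa>' i a)
    let ?m = "set_encode {q. q < M \<and> i \<in> \<alpha> \<kappa>' q}"
    have m: "?m < 2 ^ M" by (rule set_encode_less) auto
    have dm: "set_decode ?m = {q. q < M \<and> i \<in> \<alpha> \<kappa>' q}" by (rule set_encode_inverse) simp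
    show ?case
    proof (cases "\<kappa>' = \<kappa>")
      case True
      have "{q. q < M \<and> i \<in> upd \<alpha> \<kappa> p {} \<kappa> q} = set_decode (del ?m p)"
        using True by (auto simp: dm upd_apply split: if_splits)
      then have "set_encode {q. q < M \<and> i \<in> upd \<alpha> \<kappa> p {} \<kappa> q} = del ?m p"
        by (simp only: set_decode_inverse)
      then have 0: "run M A (upd \<alpha> \<kappa> p {}) (Lf \<kappa>' i a) = base A \<kappa> a (del ?m p)"
        using True by (simp only: run.simps)
      have "{q. q < M \<and> i \<in> upd \<alpha> \<kappa> p {i} \<kappa> q} = set_decode (ins ?m p)"
        using True p by (auto simp: dm upd_apply split: if_splits)
      then have "set_encode {q. q < M \<and> i \<in> upd \<alpha> \<kappa> p {i} \<kappa> q} = ins ?m p"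
        by (simp only: set_decode_inverse)
      then have 1: "run M A (upd \<alpha> \<kappa> p {i}) (Lf \<kappa>' i a) = base A \<kappa> a (ins ?m p)"
        using True by (simp only: run.simps)
      have "{run M A (upd \<alpha> \<kappa> p X) (Lf \<kappa>' i a) | X. X \<subseteq> ids \<kappa> (Lf \<kappa>' i a)}
        = {run M A (upd \<alpha> \<kappa> p {}) (Lf \<kappa>' i a), run M A (upd \<alpha> \<kappa> p {i}) (Lf \<kappa>' i a)}"
        using True \<kappa> by (auto simp: subset_singleton_iff simp del: run.simps)
      then show ?thesis unfolding 0 1 using Lf True m base by auto
    next
      case False
      then have "run M A (upd \<alpha> \<kappa> p X) (Lf \<kappa>' i a) = base A \<kappa>' a ?m" for X
        by (simp add: upd_apply)
      then show ?thesis using Lf False m base by auto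
    qed
  next
    case (Op j s t)
    have l: "run M ?C \<alpha> s < 2 ^ ?d" "run M ?C \<alpha> t < 2 ^ ?d"
      using run_less[OF wC] Op.prems len by auto
    have IH: "set_decode (run M ?C \<alpha> s) = {run M A (upd \<alpha> \<kappa> p X) s | X. X \<subseteq> ids \<kappa> s}"
      "set_decode (run M ?C \<alpha> t) = {run M A (upd \<alpha> \<kappa> p X) t | X. X \<subseteq> ids \<kappa> t}"
      using Op by auto
    have disj: "ids \<kappa> s \<inter> ids \<kappa> t = {}" using dist_ids[OF Op.prems(2)] .
    have "set_decode (run M ?C \<alpha> (Op j s t)) =
       {comb A j (run M A (upd \<alpha> \<kappa> p X) s) (run M A (upd \<alpha> \<kappa> p Y) t) | X Y. X \<subseteq> ids \<kappa> s \<and> Y \<subseteq> ids \<kappa> t}"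
      using Op.prems comb[OF _ l] unfolding run.simps by (auto simp: IH)
    also have "\<dots> = {run M A (upd \<alpha> \<kappa> p X) (Op j s t) | X. X \<subseteq> ids \<kappa> (Op j s t)}"
    proof (intro set_eqI iffI)
      fix v assume "v \<in> {comb A j (run M A (upd \<alpha> \<kappa> p X) s) (run M A (upd \<alpha> \<kappa> p Y) t) | X Y. X \<subseteq> ids \<kappa> s \<and> Y \<subseteq> ids \<kappa> t}"
      then obtain X Y where v: "v = comb A j (run M A (upd \<alpha> \<kappa> p X) s) (run M A (upd \<alpha> \<kappa> p Y) t)"
        and XY: "X \<subseteq> ids \<kappa> s" "Y \<subseteq> ids \<kappa> t" by blast
      have "run M A (upd \<alpha> \<kappa> p X) s = run M A (upd \<alpha> \<kappa> p (X \<union> Y)) s"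
        "run M A (upd \<alpha> \<kappa> p Y) t = run M A (upd \<alpha> \<kappa> p (X \<union> Y)) t"
        using XY disj by (intro run_upd_cong \<kappa>; blast)+
      then show "v \<in> {run M A (upd \<alpha> \<kappa> p X) (Op j s t) | X. X \<subseteq> ids \<kappa> (Op j s t)}"
        using XY v by auto
    next
      fix v assume "v \<in> {run M A (upd \<alpha> \<kappa> p X) (Op j s t) | X. X \<subseteq> ids \<kappa> (Op j s t)}"
      then obtain X where v: "v = run M A (upd \<alpha> \<kappa> p X) (Op j s t)" and X: "X \<subseteq> ids \<kappa> (Op j s t)" by blast
      have "run M A (upd \<alpha> \<kappa> p X) s = run M A (upd \<alpha> \<kappa> p (X \<inter> ids \<kappa> s)) s"
        "run M A (upd \<alpha> \<kappa> p X) t = run M A (upd \<alpha> \<kappa> p (X \<inter> ids \<kappa> t)) t"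
        by (intro run_upd_cong \<kappa>; blast)+
      then show "v \<in> {comb A j (run M A (upd \<alpha> \<kappa> p X) s) (run M A (upd \<alpha> \<kappa> p Y) t) | X Y. X \<subseteq> ids \<kappa> s \<and> Y \<subseteq> ids \<kappa> t}"
        using v by auto
    qed
    finally show ?case .
  qed
  show ?thesis
    unfolding recog_def
  proof (intro conjI allI impI wC)
    fix t \<alpha> assume t: "ok_term K t" "dist t"
    have l: "run M ?C \<alpha> t < 2 ^ ?d" using run_less[OF wC t(1)] len by simp
    have "look (acc ?C) (run M ?C \<alpha> t) \<longleftrightarrow> (\<exists>s\<in>set_decode (run M ?C \<alpha> t). look (acc A) s)"
      using l by (simp add: autex_def list_ex_iff del: mem_iff)
    also have "\<dots> \<longleftrightarrow> (\<exists>X\<subseteq>ids \<kappa> t. S t (upd \<alpha> \<kappa> p X))"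
      unfolding run[OF t] using A t unfolding recog_def by auto
    finally show "look (acc ?C) (run M ?C \<alpha> t) \<longleftrightarrow> (\<exists>X\<subseteq>ids \<kappa> t. S t (upd \<alpha> \<kappa> p X))" .
  qed
qed

section \<open>From formulas to automata\<close>

definition index :: "'q list \<Rightarrow> 'q \<Rightarrow> nat" where
  "index qs q = (LEAST i. i < length qs \<and> qs ! i = q)"

lemma index: assumes "q \<in> set qs" shows "index qs q < length qs" "qs ! index qs q = q"
proof -
  obtain i where "i < length qs \<and> qs ! i = q" using assms by (auto simp: in_set_conv_nth)
  then have "index qs q < length qs \<and> qs ! index qs q = q"
    unfolding index_def by (rule LeastI)
  then show "index qs q < length qs" "qs ! index qs q = q" by auto
qed

text \<open>The tables of the automata for atomic formulas do not depend on the formula but for the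
  variable numbers. They are therefore program constants, and nothing about their computation has to
  be proved; the states may come from an arbitrary finite set, enumerated by \<open>qs\<close>.\<close>

definition atomdat :: "nat \<Rightarrow> 'q list \<Rightarrow> (nat \<Rightarrow> 'q \<Rightarrow> 'q \<Rightarrow> 'q) \<Rightarrow> (bool \<Rightarrow> bool \<Rightarrow> nat \<Rightarrow> 'q) \<Rightarrow> ('q \<Rightarrow> bool) \<Rightarrow> aut" where
  "atomdat K qs F L P = (ctab (\<lambda>j v w. index qs (F j (qs ! v) (qs ! w))) (Suc K) (length qs),
     map (\<lambda>x. map (\<lambda>y. map (\<lambda>a. index qs (L (x = 1) (y = 1) a)) [0..<2 ^ K]) [0..<2]) [0..<2],
     map P qs)"

text \<open>The leaf table of the constant \<open>A\<close> is indexed by two bits, membership in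
  either variable, and the label code. Re-indexing it by kind, label code and variable set is the
  only step that depends on the variable numbers, and the only one to be computed.\<close>

definition atom :: "nat \<Rightarrow> nat \<Rightarrow> aut \<Rightarrow> nat \<Rightarrow> nat \<Rightarrow> nat \<Rightarrow> nat \<Rightarrow> aut" where
  "atom K M A \<kappa> p \<kappa>' q = (fst A,
     btab (\<lambda>k a m. base A (if k = \<kappa> \<and> mem p m then 1 else 0) (if k = \<kappa>' \<and> mem q m then 1 else 0) a) K M,
     snd (snd A))"

fun arun :: "(nat \<Rightarrow> 'q \<Rightarrow> 'q \<Rightarrow> 'q) \<Rightarrow> (bool \<Rightarrow> bool \<Rightarrow> nat \<Rightarrow> 'q) \<Rightarrow> nat \<Rightarrow> nat \<Rightarrow> nat \<Rightarrow> nat \<Rightarrow> asg \<Rightarrow> trm \<Rightarrow> 'q" where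
  "arun F L \<kappa> p \<kappa>' q \<alpha> (Lf k i a) = L (k = \<kappa> \<and> i \<in> \<alpha> k p) (k = \<kappa>' \<and> i \<in> \<alpha> k q) a"
| "arun F L \<kappa> p \<kappa>' q \<alpha> (Op j s t) = F j (arun F L \<kappa> p \<kappa>' q \<alpha> s) (arun F L \<kappa> p \<kappa>' q \<alpha> t)"

lemma base_atomdat: "a < 2 ^ K \<Longrightarrow> base (atomdat K qs F L P) (if X then 1 else 0) (if Y then 1 else 0) a = index qs (L X Y a)"
  by (cases X; cases Y) (simp_all add: atomdat_def base_def)

text \<open>Thanks to this, an atomic automaton is verified on \<open>arun\<close> with structured
  states; the numbering of the states by \<open>index\<close> stays hidden here.\<close>

lemma recog_atom:
  assumes F: "\<And>j q r. j \<le> K \<Longrightarrow> q \<in> set qs \<Longrightarrow> r \<in> set qs \<Longrightarrow> F j q r \<in> set qs"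
    and L: "\<And>x y a. a < 2 ^ K \<Longrightarrow> L x y a \<in> set qs"
    and p: "p < M" "q < M"
    and S: "\<And>t \<alpha>. ok_term K t \<Longrightarrow> dist t \<Longrightarrow> P (arun F L \<kappa> p \<kappa>' q \<alpha> t) \<longleftrightarrow> S t \<alpha>"
  shows "recog K M (atom K M (atomdat K qs F L P) \<kappa> p \<kappa>' q) S"
proof -
  let ?A = "atom K M (atomdat K qs F L P) \<kappa> p \<kappa>' q"
  have acc: "acc ?A = map P qs" by (simp add: atom_def atomdat_def)
  have comb: "comb ?A j v w = index qs (F j (qs ! v) (qs ! w))"
    if "j \<le> K" "v < length qs" "w < length qs" for j v w
    using that by (simp add: atom_def atomdat_def)
  have base: "base ?A k a m = index qs (L (k = \<kappa> \<and> mem p m) (k = \<kappa>' \<and> mem q m) a)"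
    if "k < 3" "a < 2 ^ K" "m < 2 ^ M" for k a m
    using that unfolding atom_def base_btab[OF that] by (rule_tac base_atomdat)
  have w: "wfA K M ?A"
    unfolding wfA_def acc by (auto simp: comb base intro!: index F L)
  have run: "run M ?A \<alpha> t < length qs \<and> qs ! run M ?A \<alpha> t = arun F L \<kappa> p \<kappa>' q \<alpha> t" if "ok_term K t" for t \<alpha>
    using that
  proof (induction t)
    case (Lf k i a)
    let ?m = "set_encode {r. r < M \<and> i \<in> \<alpha> k r}"
    have "?m < 2 ^ M" by (rule set_encode_less) auto
    moreover have "set_decode ?m = {r. r < M \<and> i \<in> \<alpha> k r}" by (rule set_encode_inverse) simp
    ultimately have "run M ?A \<alpha> (Lf k i a) = index qs (L (k = \<kappa> \<and> i \<in> \<alpha> k p) (k = \<kappa>' \<and> i \<in> \<alpha> k q) a)"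
      using Lf p by (simp add: base)
    then show ?case using Lf by (simp only: arun.simps) (simp add: index L)
  next
    case (Op j s t)
    then have "F j (arun F L \<kappa> p \<kappa>' q \<alpha> s) (arun F L \<kappa> p \<kappa>' q \<alpha> t) \<in> set qs"
      by (intro F) (auto simp: in_set_conv_nth)
    then show ?case using Op by (simp add: comb index)
  qed
  show ?thesis
    unfolding recog_def using w run S by (simp add: acc look_nth)
qed

section \<open>Automata for inclusion, singletons, order and adjacency\<close>

definition listof :: "'q set \<Rightarrow> 'q list" where "listof X = (SOME l. set l = X)"

lemma set_listof [simp]: "finite X \<Longrightarrow> set (listof X) = X"
  unfolding listof_def by (rule someI_ex) (rule finite_list)

definition subdat :: "nat \<Rightarrow> aut" where
  "subdat K = atomdat K [False, True] (\<lambda>_. (\<and>)) (\<lambda>x y _. x \<longrightarrow> y) (\<lambda>b. b)"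

lemma recog_sub:
  assumes "\<kappa> < 2" "p < M" "q < M"
  shows "recog K M (atom K M (subdat K) \<kappa> p \<kappa> q) (\<lambda>t \<alpha>. subt t \<alpha> \<kappa> p q)"
  unfolding subdat_def
proof (rule recog_atom)
  fix t \<alpha>
  show "arun (\<lambda>_. (\<and>)) (\<lambda>x y _. x \<longrightarrow> y) \<kappa> p \<kappa> q \<alpha> t \<longleftrightarrow> subt t \<alpha> \<kappa> p q"
    using assms(1) by (induction t) (auto simp: subt_def)
qed (use assms in auto)

text \<open>A counter capped at 2 tells exactly one member from none and from several.
  \<open>autex1\<close> uses it to confine a set quantifier to singletons.\<close>

definition singdat :: "nat \<Rightarrow> aut" where
  "singdat K = atomdat K [0, 1, 2] (\<lambda>_ m n. min 2 (m + n)) (\<lambda>x _ _. of_bool x) (\<lambda>n :: nat. n = 1)"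

lemma recog_sing:
  assumes "\<kappa> < 2" "p < M"
  shows "recog K M (atom K M (singdat K) \<kappa> p \<kappa> p) (\<lambda>t \<alpha>. card (ids \<kappa> t \<inter> \<alpha> \<kappa> p) = 1)"
  unfolding singdat_def
proof (rule recog_atom)
  fix t \<alpha> assume "dist t"
  then have "arun (\<lambda>_ m n. min 2 (m + n)) (\<lambda>x _ _. of_bool x) \<kappa> p \<kappa> p \<alpha> t = min 2 (card (ids \<kappa> t \<inter> \<alpha> \<kappa> p))"
  proof (induction t)
    case (Lf k i a)
    then show ?case using assms(1) by (cases "k = \<kappa>") auto
  next
    case (Op j s t)
    have "ids \<kappa> (Op j s t) \<inter> \<alpha> \<kappa> p = (ids \<kappa> s \<inter> \<alpha> \<kappa> p) \<union> (ids \<kappa> t \<inter> \<alpha> \<kappa> p)" by auto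
    moreover have "card ((ids \<kappa> s \<inter> \<alpha> \<kappa> p) \<union> (ids \<kappa> t \<inter> \<alpha> \<kappa> p)) = card (ids \<kappa> s \<inter> \<alpha> \<kappa> p) + card (ids \<kappa> t \<inter> \<alpha> \<kappa> p)"
      using dist_ids[OF Op.prems] by (intro card_Un_disjoint) auto
    ultimately show ?case using Op by simp
  qed
  then show "arun (\<lambda>_ m n. min 2 (m + n)) (\<lambda>x _ _. of_bool x) \<kappa> p \<kappa> p \<alpha> t = (1::nat) \<longleftrightarrow> card (ids \<kappa> t \<inter> \<alpha> \<kappa> p) = 1"
    by auto
qed (use assms in auto)

text \<open>The components say that a pair in order was found, that the first variable has a member,
  and that the second has one. A new pair arises exactly with the first on the left and the second
  on the right.\<close>

definition lessF :: "nat \<Rightarrow> bool \<times> bool \<times> bool \<Rightarrow> bool \<times> bool \<times> bool \<Rightarrow> bool \<times> bool \<times> bool" where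
  "lessF j v w = (fst v \<or> fst w \<or> fst (snd v) \<and> snd (snd w), fst (snd v) \<or> fst (snd w), snd (snd v) \<or> snd (snd w))"

definition lessdat :: "nat \<Rightarrow> aut" where
  "lessdat K = atomdat K (listof UNIV) lessF (\<lambda>x y _. (False, x, y)) fst"

lemma recog_less:
  assumes "\<kappa> < 2" "\<kappa>' < 2" "p < M" "q < M"
  shows "recog K M (atom K M (lessdat K) \<kappa> p \<kappa>' q) (\<lambda>t \<alpha>. link (bef t) \<alpha> \<kappa> p \<kappa>' q)"
  unfolding lessdat_def
proof (rule recog_atom)
  fix t \<alpha>
  have "arun lessF (\<lambda>x y _. (False, x, y)) \<kappa> p \<kappa>' q \<alpha> t =
    (link (bef t) \<alpha> \<kappa> p \<kappa>' q, ids \<kappa> t \<inter> \<alpha> \<kappa> p \<noteq> {}, ids \<kappa>' t \<inter> \<alpha> \<kappa>' q \<noteq> {})"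
  proof (induction t)
    case (Op j s t)
    have "link (bef (Op j s t)) \<alpha> \<kappa> p \<kappa>' q \<longleftrightarrow> link (bef s) \<alpha> \<kappa> p \<kappa>' q \<or> link (bef t) \<alpha> \<kappa> p \<kappa>' q \<or>
       (ids \<kappa> s \<inter> \<alpha> \<kappa> p \<noteq> {} \<and> ids \<kappa>' t \<inter> \<alpha> \<kappa>' q \<noteq> {})"
      by (auto simp: link_def ids_def)
    with Op show ?case by (auto simp: lessF_def)
  qed (use assms in \<open>auto simp: link_def\<close>)
  then show "fst (arun lessF (\<lambda>x y _. (False, x, y)) \<kappa> p \<kappa>' q \<alpha> t) \<longleftrightarrow> link (bef t) \<alpha> \<kappa> p \<kappa>' q"
    by simp
qed (use assms in auto)

type_synonym adjstate = "bool \<times> bool \<times> bool \<times> nat set \<times> nat set"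

text \<open>The state records whether a linked pair was found, whether each variable has a member,
  and which labels those members still carry. \<open>Op j\<close> links the labelled elements on the
  left with everything on the right in both directions, whence two clauses with
  \<open>j\<close>.\<close>

fun adjF :: "nat \<Rightarrow> adjstate \<Rightarrow> adjstate \<Rightarrow> adjstate" where
  "adjF j (d, x, y, X, Y) (d', x', y', X', Y') =
     (d \<or> d' \<or> j \<in> X \<and> y' \<or> j \<in> Y \<and> x', x \<or> x', y \<or> y', (X - {j}) \<union> X', (Y - {j}) \<union> Y')"

definition adjL :: "bool \<Rightarrow> bool \<Rightarrow> nat \<Rightarrow> adjstate" where
  "adjL x y a = (False, x, y, if x then set_decode a else {}, if y then set_decode a else {})"

definition adjQ :: "nat \<Rightarrow> adjstate set" where
  "adjQ K = UNIV \<times> UNIV \<times> UNIV \<times> Pow {..<K} \<times> Pow {..<K}"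

definition adjdat :: "nat \<Rightarrow> aut" where
  "adjdat K = atomdat K (listof (adjQ K)) adjF adjL fst"

definition labs :: "trm \<Rightarrow> asg \<Rightarrow> nat \<Rightarrow> nat \<Rightarrow> nat set" where
  "labs t \<alpha> \<kappa> p = (\<Union>u\<in>ids \<kappa> t \<inter> \<alpha> \<kappa> p. lab t (\<kappa>, u))"

lemma recog_adj:
  assumes "\<kappa> < 2" "\<kappa>' < 2" "p < M" "q < M"
  shows "recog K M (atom K M (adjdat K) \<kappa> p \<kappa>' q) (\<lambda>t \<alpha>. link (adjt t) \<alpha> \<kappa> p \<kappa>' q)"
  unfolding adjdat_def
proof (rule recog_atom)
  have Q: "set (listof (adjQ K)) = adjQ K" by (rule set_listof) (auto simp: adjQ_def)
  show "adjF j q r \<in> set (listof (adjQ K))"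
    if "q \<in> set (listof (adjQ K))" "r \<in> set (listof (adjQ K))" for j q r
    using that unfolding Q by (cases q; cases r) (auto simp: adjQ_def)
  show "adjL x y a \<in> set (listof (adjQ K))" if "a < 2 ^ K" for x y a
    using set_decode_subset[OF that] unfolding Q by (auto simp: adjQ_def adjL_def)
  fix t \<alpha> assume "dist t"
  then have "arun adjF adjL \<kappa> p \<kappa>' q \<alpha> t =
    (link (adjt t) \<alpha> \<kappa> p \<kappa>' q, ids \<kappa> t \<inter> \<alpha> \<kappa> p \<noteq> {}, ids \<kappa>' t \<inter> \<alpha> \<kappa>' q \<noteq> {}, labs t \<alpha> \<kappa> p, labs t \<alpha> \<kappa>' q)"
  proof (induction t)
    case (Lf k i a)
    then show ?case using assms by (auto simp: link_def adjL_def labs_def)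
  next
    case (Op j s t)
    have 1: "link (adjt (Op j s t)) \<alpha> \<kappa> p \<kappa>' q \<longleftrightarrow> link (adjt s) \<alpha> \<kappa> p \<kappa>' q \<or> link (adjt t) \<alpha> \<kappa> p \<kappa>' q \<or>
       (j \<in> labs s \<alpha> \<kappa> p \<and> ids \<kappa>' t \<inter> \<alpha> \<kappa>' q \<noteq> {}) \<or> (j \<in> labs s \<alpha> \<kappa>' q \<and> ids \<kappa> t \<inter> \<alpha> \<kappa> p \<noteq> {})"
      unfolding link_def labs_def ids_def by auto
    have 2: "labs (Op j s t) \<alpha> k r = (labs s \<alpha> k r - {j}) \<union> labs t \<alpha> k r" for k r
      using Op.prems unfolding labs_def ids_def by (auto split: if_splits)
    have 3: "(ids k (Op j s t) \<inter> \<alpha> k r \<noteq> {}) = (ids k s \<inter> \<alpha> k r \<noteq> {} \<or> ids k t \<inter> \<alpha> k r \<noteq> {})" for k r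
      by auto
    show ?case unfolding 1 2 3 using Op by simp
  qed
  then show "fst (arun adjF adjL \<kappa> p \<kappa>' q \<alpha> t) \<longleftrightarrow> link (adjt t) \<alpha> \<kappa> p \<kappa>' q"
    by simp
qed (use assms in auto)

section \<open>Translation of whole formulas\<close>

definition atomaut :: "nat \<Rightarrow> nat \<Rightarrow> nat \<Rightarrow> nat \<Rightarrow> nat \<Rightarrow> aut" where
  "atomaut K M c x y = (if c = 0 then atom K M (subdat K) 0 (2 * x) 0 (2 * y)
     else if c = 1 then atom K M (subdat K) 1 (2 * x) 1 (2 * y)
     else if c = 2 then atom K M (adjdat K) 0 (2 * x) 0 (2 * y)
     else if c = 3 then atom K M (adjdat K) 0 (2 * x) 1 (2 * y)
     else if c = 4 then atom K M (lessdat K) 0 (2 * x) 0 (2 * y)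
     else if c = 5 then atom K M (subdat K) 0 (2 * x) 0 (2 * y + 1)
     else atom K M (subdat K) 1 (2 * x) 1 (2 * y + 1))"

definition autex1 :: "nat \<Rightarrow> nat \<Rightarrow> nat \<Rightarrow> nat \<Rightarrow> aut \<Rightarrow> aut" where
  "autex1 K M \<kappa> p A = autex K M \<kappa> p (autconj K M (atom K M (singdat K) \<kappa> p \<kappa> p) A)"

primrec aut :: "nat \<Rightarrow> nat \<Rightarrow> mso2 \<Rightarrow> aut" where
  "aut K M (Eq_V x y) = atomaut K M 0 x y"
| "aut K M (Eq_E x y) = atomaut K M 1 x y"
| "aut K M (Adj x y) = atomaut K M 2 x y"
| "aut K M (Inc x y) = atomaut K M 3 x y"
| "aut K M (Less x y) = atomaut K M 4 x y"
| "aut K M (Mem_V x y) = atomaut K M 5 x y"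
| "aut K M (Mem_E x y) = atomaut K M 6 x y"
| "aut K M (Neg \<phi>) = autneg (aut K M \<phi>)"
| "aut K M (Conj \<phi> \<psi>) = autconj K M (aut K M \<phi>) (aut K M \<psi>)"
| "aut K M (Ex_V x \<phi>) = autex1 K M 0 (2 * x) (aut K M \<phi>)"
| "aut K M (Ex_E x \<phi>) = autex1 K M 1 (2 * x) (aut K M \<phi>)"
| "aut K M (Ex_VS x \<phi>) = autex K M 0 (2 * x + 1) (aut K M \<phi>)"
| "aut K M (Ex_ES x \<phi>) = autex K M 1 (2 * x + 1) (aut K M \<phi>)"

text \<open>Formulas have no representation on the heap; the program works on tokens in prefix order
  instead, one padded triple per node, with the opcodes of \<open>formula_code\<close>.\<close>

primrec flat :: "mso2 \<Rightarrow> (nat \<times> nat \<times> nat) list" where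
  "flat (Eq_V x y) = [(0, x, y)]"
| "flat (Eq_E x y) = [(1, x, y)]"
| "flat (Adj x y) = [(2, x, y)]"
| "flat (Inc x y) = [(3, x, y)]"
| "flat (Less x y) = [(4, x, y)]"
| "flat (Mem_V x y) = [(5, x, y)]"
| "flat (Mem_E x y) = [(6, x, y)]"
| "flat (Neg \<phi>) = (7, 0, 0) # flat \<phi>"
| "flat (Conj \<phi> \<psi>) = (8, 0, 0) # flat \<phi> @ flat \<psi>"
| "flat (Ex_V x \<phi>) = (9, x, 0) # flat \<phi>"
| "flat (Ex_E x \<phi>) = (10, x, 0) # flat \<phi>"
| "flat (Ex_VS x \<phi>) = (11, x, 0) # flat \<phi>"
| "flat (Ex_ES x \<phi>) = (12, x, 0) # flat \<phi>"

text \<open>Any upper bound on the variable numbers will do for \<open>M\<close>, and a sum is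
  simpler than a maximum. The initial 2 leaves room for the odd numbers
  \<open>2 * X + 1\<close>.\<close>

definition tokbound :: "(nat \<times> nat \<times> nat) list \<Rightarrow> nat" where
  "tokbound ts = foldl (\<lambda>s t. s + (2 * fst (snd t) + 2 * snd (snd t))) 2 ts"

lemma tokbound_ge: "t \<in> set ts \<Longrightarrow> 2 * fst (snd t) + 2 * snd (snd t) + 2 \<le> tokbound ts"
proof -
  have mono: "s \<le> foldl (\<lambda>s t. s + (2 * fst (snd t) + 2 * snd (snd t))) s ts" for s and ts :: "(nat \<times> nat \<times> nat) list"
  proof (induction ts arbitrary: s)
    case (Cons a ts)
    from Cons[of "s + (2 * fst (snd a) + 2 * snd (snd a))"] show ?case by simp
  qed simp
  have "t \<in> set ts \<Longrightarrow> 2 * fst (snd t) + 2 * snd (snd t) + s \<le> foldl (\<lambda>s t. s + (2 * fst (snd t) + 2 * snd (snd t))) s ts" for s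
  proof (induction ts arbitrary: s)
    case (Cons a ts)
    then show ?case
    proof (cases "t = a")
      case True
      then show ?thesis using mono[of "s + (2 * fst (snd a) + 2 * snd (snd a))" ts] by simp
    next
      case False
      then have "t \<in> set ts" using Cons.prems by simp
      from Cons.IH[OF this, of "s + (2 * fst (snd a) + 2 * snd (snd a))"] show ?thesis by simp
    qed
  qed simp
  from this[of 2] show "t \<in> set ts \<Longrightarrow> ?thesis" by (simp add: tokbound_def)
qed

text \<open>A first-order quantifier is a set quantifier over the product with the counting
  automaton: the subsets of \<open>ids \<kappa> t\<close> of cardinality 1 are the singletons of its
  elements.\<close>

lemma recog_ex1:
  assumes A: "recog K M A S" and \<kappa>: "\<kappa> < 2" and p: "p < M"
  shows "recog K M (autex1 K M \<kappa> p A) (\<lambda>t \<alpha>. \<exists>i\<in>ids \<kappa> t. S t (upd \<alpha> \<kappa> p {i}))"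
proof -
  have "recog K M (autex1 K M \<kappa> p A) (\<lambda>t \<alpha>. \<exists>X\<subseteq>ids \<kappa> t. card (ids \<kappa> t \<inter> upd \<alpha> \<kappa> p X \<kappa> p) = 1 \<and> S t (upd \<alpha> \<kappa> p X))"
    unfolding autex1_def by (rule recog_ex[OF recog_conj[OF recog_sing[OF \<kappa> p] A] \<kappa> p])
  moreover have "(\<exists>X\<subseteq>ids \<kappa> t. card (ids \<kappa> t \<inter> upd \<alpha> \<kappa> p X \<kappa> p) = 1 \<and> S t (upd \<alpha> \<kappa> p X)) \<longleftrightarrow>
      (\<exists>i\<in>ids \<kappa> t. S t (upd \<alpha> \<kappa> p {i}))" (is "?l \<longleftrightarrow> ?r") for t \<alpha>
  proof
    assume ?l
    then obtain X where X: "X \<subseteq> ids \<kappa> t" "card (ids \<kappa> t \<inter> X) = 1" "S t (upd \<alpha> \<kappa> p X)"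
      by (auto simp: upd_apply)
    then obtain i where "X = {i}" by (auto simp: Int_absorb1 card_1_singleton_iff)
    with X show ?r by auto
  next
    assume ?r
    then obtain i where "i \<in> ids \<kappa> t" "S t (upd \<alpha> \<kappa> p {i})" by blast
    then show ?l by (intro exI[of _ "{i}"]) (auto simp: upd_apply)
  qed
  ultimately show ?thesis by (simp only:)
qed

lemma recog_aut:
  assumes "\<forall>t\<in>set (flat \<phi>). 2 * fst (snd t) + 2 * snd (snd t) + 2 \<le> M"
  shows "recog K M (aut K M \<phi>) (\<lambda>t \<alpha>. sem t \<alpha> \<phi>)"
  using assms
proof (induction \<phi>)
  case (Conj \<phi> \<psi>)
  then show ?case by (auto intro!: recog_conj)
qed (auto simp: atomaut_def intro!: recog_sub recog_adj recog_less recog_neg recog_ex recog_ex1)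

definition autstep :: "nat \<Rightarrow> nat \<Rightarrow> aut list \<Rightarrow> nat \<times> nat \<times> nat \<Rightarrow> aut list" where
  "autstep K M s t = (if fst t < 7 then atomaut K M (fst t) (fst (snd t)) (snd (snd t)) # s
     else if fst t = 7 then autneg (hd s) # tl s
     else if fst t = 8 then autconj K M (hd s) (hd (tl s)) # tl (tl s)
     else if fst t = 9 then autex1 K M 0 (2 * fst (snd t)) (hd s) # tl s
     else if fst t = 10 then autex1 K M 1 (2 * fst (snd t)) (hd s) # tl s
     else if fst t = 11 then autex K M 0 (2 * fst (snd t) + 1) (hd s) # tl s
     else autex K M 1 (2 * fst (snd t) + 1) (hd s) # tl s)"

lemma foldl_autstep: "foldl (autstep K M) s (rev (flat \<phi>)) = aut K M \<phi> # s"
  by (induction \<phi> arbitrary: s) (auto simp: autstep_def)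

text \<open>The formula is given by its tokens in reverse order: prefix notation read backwards is
  evaluated by a stack.\<close>

definition build :: "nat \<Rightarrow> (nat \<times> nat \<times> nat) list \<Rightarrow> aut" where
  "build K ts = hd (foldl (autstep K (tokbound ts)) [] ts)"

lemma recog_build: "recog K (tokbound (rev (flat \<phi>))) (build K (rev (flat \<phi>))) (\<lambda>t \<alpha>. sem t \<alpha> \<phi>)"
  unfolding build_def foldl_autstep list.sel
  by (rule recog_aut, rule ballI, rule tokbound_ge) simp

section \<open>Computability of the translation\<close>

text \<open>With the flag \<open>False\<close> the length conditions in the rules for
  \<open>PC\<close> are vacuous, so the constant measure 0 serves throughout.\<close>

abbreviation cmp :: "('a::rep \<Rightarrow> 'b::rep) \<Rightarrow> bool" where
  "cmp \<equiv> PC False (\<lambda>_. True) (\<lambda>_. 0)"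

lemma cmp1: "cmp g \<Longrightarrow> PC False D Z f \<Longrightarrow> PC False D Z (\<lambda>x. g (f x))"
  by (rule PC_comp) auto

lemma cmp2: "cmp (\<lambda>y. h (fst y) (snd y)) \<Longrightarrow> PC False D Z f \<Longrightarrow> PC False D Z g \<Longrightarrow>
    PC False D Z (\<lambda>x. h (f x) (g x))"
  using cmp1[of "\<lambda>y. h (fst y) (snd y)" D Z "\<lambda>x. (f x, g x)"] by (simp add: PC_Pair)

lemma cmp3: "cmp (\<lambda>y. h (fst y) (fst (snd y)) (snd (snd y))) \<Longrightarrow> PC False D Z f \<Longrightarrow> PC False D Z g \<Longrightarrow>
    PC False D Z k \<Longrightarrow> PC False D Z (\<lambda>x. h (f x) (g x) (k x))"
  using cmp1[of "\<lambda>y. h (fst y) (fst (snd y)) (snd (snd y))" D Z "\<lambda>x. (f x, g x, k x)"] by (simp add: PC_Pair)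

lemma cmp4: "cmp (\<lambda>y. h (fst y) (fst (snd y)) (fst (snd (snd y))) (snd (snd (snd y)))) \<Longrightarrow>
    PC False D Z f \<Longrightarrow> PC False D Z g \<Longrightarrow> PC False D Z k \<Longrightarrow> PC False D Z l \<Longrightarrow>
    PC False D Z (\<lambda>x. h (f x) (g x) (k x) (l x))"
  using cmp1[of "\<lambda>y. h (fst y) (fst (snd y)) (fst (snd (snd y))) (snd (snd (snd y)))" D Z "\<lambda>x. (f x, g x, k x, l x)"]
  by (simp add: PC_Pair)

named_theorems cmp_rules

lemma cmp_mult [cmp_rules]: "PC False D Z f \<Longrightarrow> PC False D Z g \<Longrightarrow> PC False D Z (\<lambda>x. f x * g x :: nat)"
proof (rule cmp2[where h="(*)"])
  have "foldl (\<lambda>a _. a + m) s [0..<n] = s + m * n" for m s n :: nat by (induction n) auto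
  then have eq: "(\<lambda>y. fst y * snd y) = (\<lambda>y. foldl (\<lambda>a _. a + fst y) (0::nat) [0..<snd y])" by auto
  show "cmp (\<lambda>y. fst y * snd y :: nat)" unfolding eq by (intro PC_rules) simp_all
qed

lemma cmp_power [cmp_rules]: "PC False D Z f \<Longrightarrow> PC False D Z (\<lambda>x. 2 ^ f x :: nat)"
proof (rule cmp1[where g="(^) 2"])
  have "foldl (\<lambda>a _. a + a) s [0..<n] = s * 2 ^ n" for s n :: nat by (induction n) auto
  then have eq: "((^) 2) = (\<lambda>y. foldl (\<lambda>a _. a + a) (1::nat) [0..<y])" by auto
  show "cmp (((^) 2) :: nat \<Rightarrow> nat)" unfolding eq by (intro PC_rules) simp_all
qed

text \<open>Division by repeated subtraction: after \<open>i\<close> rounds the first component is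
  \<open>min i (n div d)\<close>, so any number of rounds not below the quotient suffices.\<close>

lemma divmod_fold: "k \<le> n \<Longrightarrow> n div d \<le> k \<Longrightarrow> d > 0 \<Longrightarrow>
  foldl (\<lambda>s _. if d \<le> snd s then (fst s + 1, snd s - d) else s) (0, n) [0..<k] = (n div d, n mod d)" for n d k :: nat
proof -
  assume d: "d > 0" and "k \<le> n" "n div d \<le> k"
  have "foldl (\<lambda>s _. if d \<le> snd s then (fst s + 1, snd s - d) else s) (0, n) [0..<k] =
     (min k (n div d), n - d * min k (n div d))" for k
  proof (induction k)
    case (Suc k)
    show ?case
    proof (cases "Suc k \<le> n div d")
      case True
      then have "d * Suc k \<le> n" using div_times_less_eq_dividend[of n d]
        by (metis le_trans mult.commute mult_le_mono1)
      then show ?thesis using Suc True by (simp add: min_def) linarith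
    next
      case False
      then have m: "min k (n div d) = n div d" "min (Suc k) (n div d) = n div d" by auto
      have "n - d * (n div d) < d" using d by (simp add: minus_mult_div_eq_mod)
      then show ?thesis using Suc unfolding m by simp
    qed
  qed simp
  then show ?thesis using \<open>n div d \<le> k\<close> by (simp add: min_absorb2 minus_mult_div_eq_mod)
qed

lemma cmp_divmod: "cmp (\<lambda>y. (fst y div snd y, fst y mod snd y :: nat))"
proof -
  \<comment> \<open>With divisor 0 the fold would merely count its rounds; the values
    \<open>x div 0 = 0\<close> and \<open>x mod 0 = x\<close> are returned directly.\<close>
  have eq: "(\<lambda>y. (fst y div snd y, fst y mod snd y :: nat)) =
    (\<lambda>y. if snd y = 0 then (0, fst y) else
       foldl (\<lambda>s _. if snd y \<le> snd s then (fst s + 1, snd s - snd y) else s) (0, fst y) [0..<fst y])"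
    by (auto simp: fun_eq_iff divmod_fold)
  show ?thesis unfolding eq by (intro PC_rules) simp_all
qed

lemma cmp_div [cmp_rules]: "PC False D Z f \<Longrightarrow> PC False D Z g \<Longrightarrow> PC False D Z (\<lambda>x. f x div g x :: nat)"
  using PC_fst[OF cmp2[OF cmp_divmod]] by simp

lemma cmp_mod [cmp_rules]: "PC False D Z f \<Longrightarrow> PC False D Z g \<Longrightarrow> PC False D Z (\<lambda>x. f x mod g x :: nat)"
  using PC_snd[OF cmp2[OF cmp_divmod]] by simp

lemma cmp_mem [cmp_rules]: "PC False D Z f \<Longrightarrow> PC False D Z g \<Longrightarrow> PC False D Z (\<lambda>x. mem (f x) (g x))"
  by (rule cmp2[of mem]) (auto simp only: mem_def intro!: PC_rules cmp_rules)

lemma cmp_ins [cmp_rules]: "PC False D Z f \<Longrightarrow> PC False D Z g \<Longrightarrow> PC False D Z (\<lambda>x. ins (f x) (g x))"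
  by (rule cmp2[of ins]) (auto simp only: ins_def intro!: PC_rules cmp_rules)

lemma cmp_del [cmp_rules]: "PC False D Z f \<Longrightarrow> PC False D Z g \<Longrightarrow> PC False D Z (\<lambda>x. del (f x) (g x))"
  by (rule cmp2[of del]) (auto simp only: del_def intro!: PC_rules cmp_rules)

lemma cmp_enc [cmp_rules]: "PC False D Z f \<Longrightarrow> PC False D Z (\<lambda>x. enc (f x))"
  by (rule cmp1[of enc], unfold enc_def, intro PC_rules cmp_rules) simp_all

lemma cmp_bits [cmp_rules]: "PC False D Z f \<Longrightarrow> PC False D Z g \<Longrightarrow> PC False D Z (\<lambda>x. bits (f x) (g x))"
  by (rule cmp2[of bits], unfold bits_def, intro PC_rules cmp_rules) simp_all

lemma cmp_acc [cmp_rules]: "PC False D Z f \<Longrightarrow> PC False D Z (\<lambda>x. acc (f x))"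
  by (rule cmp1[of acc], unfold acc_def, intro PC_rules cmp_rules)

lemma cmp_comb [cmp_rules]: "PC False D Z f \<Longrightarrow> PC False D Z g \<Longrightarrow> PC False D Z k \<Longrightarrow> PC False D Z l \<Longrightarrow>
    PC False D Z (\<lambda>x. comb (f x) (g x) (k x) (l x))"
  by (rule cmp4[of comb], unfold comb_def, intro PC_rules cmp_rules) simp_all

lemma cmp_base [cmp_rules]: "PC False D Z f \<Longrightarrow> PC False D Z g \<Longrightarrow> PC False D Z k \<Longrightarrow> PC False D Z l \<Longrightarrow>
    PC False D Z (\<lambda>x. base (f x) (g x) (k x) (l x))"
  by (rule cmp4[of base], unfold base_def, intro PC_rules cmp_rules) simp_all

lemma cmp_autneg [cmp_rules]: "PC False D Z f \<Longrightarrow> PC False D Z (\<lambda>x. autneg (f x))"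
  by (rule cmp1[of autneg], unfold autneg_def, intro PC_rules cmp_rules) simp_all

lemma cmp_autconj [cmp_rules]: "PC False D Z f \<Longrightarrow> PC False D Z g \<Longrightarrow> PC False D Z k \<Longrightarrow>
    PC False D Z (\<lambda>x. autconj K (f x) (g x) (k x))"
  by (rule cmp3[of "autconj K"], unfold autconj_def ctab_def btab_def, intro PC_rules cmp_rules) simp_all

lemma cmp_autex [cmp_rules]: "PC False D Z f \<Longrightarrow> PC False D Z g \<Longrightarrow> PC False D Z k \<Longrightarrow>
    PC False D Z (\<lambda>x. autex K (f x) \<kappa> (g x) (k x))"
  by (rule cmp3[of "\<lambda>M p A. autex K M \<kappa> p A"], unfold autex_def ctab_def btab_def allpairs_def, intro PC_rules cmp_rules) simp_all

lemma cmp_atom [cmp_rules]: "PC False D Z f \<Longrightarrow> PC False D Z g \<Longrightarrow> PC False D Z k \<Longrightarrow>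
    PC False D Z (\<lambda>x. atom K (f x) A \<kappa> (g x) \<kappa>' (k x))"
  by (rule cmp3[of "\<lambda>M p q. atom K M A \<kappa> p \<kappa>' q"], unfold atom_def btab_def, intro PC_rules cmp_rules) simp_all

lemma cmp_autex1 [cmp_rules]: "PC False D Z f \<Longrightarrow> PC False D Z g \<Longrightarrow> PC False D Z k \<Longrightarrow>
    PC False D Z (\<lambda>x. autex1 K (f x) \<kappa> (g x) (k x))"
  unfolding autex1_def by (intro PC_rules cmp_rules)

lemma cmp_atomaut [cmp_rules]: "PC False D Z f \<Longrightarrow> PC False D Z g \<Longrightarrow> PC False D Z k \<Longrightarrow> PC False D Z l \<Longrightarrow>
    PC False D Z (\<lambda>x. atomaut K (f x) (g x) (k x) (l x))"
  by (rule cmp4[of "atomaut K"], unfold atomaut_def, intro PC_rules cmp_rules)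

lemma cmp_autstep [cmp_rules]: "PC False D Z f \<Longrightarrow> PC False D Z g \<Longrightarrow> PC False D Z k \<Longrightarrow>
    PC False D Z (\<lambda>x. autstep K (f x) (g x) (k x))"
  by (rule cmp3[of "autstep K"], unfold autstep_def, intro PC_rules cmp_rules)

lemma cmp_build: "cmp (build K)"
  unfolding build_def tokbound_def by (intro PC_rules cmp_rules) simp_all

section \<open>Parsing the input word\<close>

text \<open>The state consists of the number of formulas still to be read, the number of arguments
  the current opcode still lacks, that opcode, its first argument, and the reversed tokens and
  remaining input. \<open>Conj\<close> raises the first counter, a completed atom lowers it; once it
  is 0, everything goes to the remaining input.\<close>

definition pstep :: "nat \<times> nat \<times> nat \<times> nat \<times> (nat \<times> nat \<times> nat) list \<times> nat list \<Rightarrow> nat \<Rightarrow>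
    nat \<times> nat \<times> nat \<times> nat \<times> (nat \<times> nat \<times> nat) list \<times> nat list" where
  "pstep s e = (if fst s = 0 then (0, 0, 0, 0, fst (snd (snd (snd (snd s)))), e # snd (snd (snd (snd (snd s)))))
     else if fst (snd s) = 0 then
       (if e < 7 then (fst s, 2, e, 0, fst (snd (snd (snd (snd s)))), [])
        else if e = 7 then (fst s, 0, 0, 0, (7, 0, 0) # fst (snd (snd (snd (snd s)))), [])
        else if e = 8 then (fst s + 1, 0, 0, 0, (8, 0, 0) # fst (snd (snd (snd (snd s)))), [])
        else (fst s, 1, e, 0, fst (snd (snd (snd (snd s)))), []))
     else if fst (snd s) = 2 then (fst s, 1, fst (snd (snd s)), e, fst (snd (snd (snd (snd s)))), [])
     else if fst (snd (snd s)) < 7 then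
       (fst s - 1, 0, 0, 0, (fst (snd (snd s)), fst (snd (snd (snd s))), e) # fst (snd (snd (snd (snd s)))), [])
     else (fst s, 0, 0, 0, (fst (snd (snd s)), e, 0) # fst (snd (snd (snd (snd s)))), []))"

lemma foldl_pstep: "foldl pstep (Suc n, 0, 0, 0, ts, []) (formula_code \<phi>) = (n, 0, 0, 0, rev (flat \<phi>) @ ts, [])"
  by (induction \<phi> arbitrary: n ts) (auto simp: pstep_def)

lemma foldl_pstep0: "foldl pstep (0, 0, 0, 0, ts, us) ys = (0, 0, 0, 0, ts, rev ys @ us)"
  by (induction ys arbitrary: us) (auto simp: pstep_def)

definition estep :: "bool \<times> nat \<times> (nat \<times> nat) list \<Rightarrow> nat \<Rightarrow> bool \<times> nat \<times> (nat \<times> nat) list" where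
  "estep s e = (if fst s then (False, 0, (fst (snd s), e) # snd (snd s)) else (True, e, snd (snd s)))"

lemma foldl_estep: "foldl estep (False, 0, ps) (concat (map (\<lambda>(i, j). [i, j]) es)) = (False, 0, rev es @ ps)"
  by (induction es arbitrary: ps) (auto simp: estep_def)

definition parse :: "nat list \<Rightarrow> (nat \<times> nat \<times> nat) list \<times> nat list" where
  "parse xs = snd (snd (snd (snd (foldl pstep (1, 0, 0, 0, [], []) xs))))"

lemma parse: "parse (formula_code \<phi> @ ys) = (rev (flat \<phi>), rev ys)"
  using foldl_pstep[of 0 "[]" \<phi>] by (simp add: parse_def foldl_pstep0)

definition pgraph :: "nat list \<Rightarrow> nat \<times> (nat \<times> nat) list" where
  "pgraph ys = (hd (rev ys), rev (snd (snd (foldl estep (False, 0, []) (tl (tl (rev ys)))))))"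

lemma pgraph: "pgraph (rev (n # m # concat (map (\<lambda>(i, j). [i, j]) es))) = (n, es)"
  by (simp add: pgraph_def foldl_estep)

lemma PC_parse: "PC True (\<lambda>_. True) length parse"
  unfolding parse_def pstep_def by (intro PC_rules) simp_all

lemma PC_pgraph: "PC True (\<lambda>_. True) length pgraph"
proof -
  have len: "length (snd (snd (foldl estep s xs))) \<le> length (snd (snd s)) + length xs" for s xs
  proof (induction xs arbitrary: s)
    case (Cons x xs)
    have "length (snd (snd (estep s x))) \<le> Suc (length (snd (snd s)))" by (simp add: estep_def)
    then show ?case using Cons[of "estep s x"] by simp
  qed simp
  have len': "length (snd (snd (foldl estep (False, 0, []) (tl (tl (rev xs)))))) \<le> length xs" for xs
    using len[of "(False, 0, [])" "tl (tl (rev xs))"] by simp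
  show ?thesis
    unfolding pgraph_def estep_def by (intro PC_rules) (use len'[unfolded estep_def] in simp_all)
qed

section \<open>From tree decompositions to elimination orders\<close>

lemma converse_first_step:
  assumes "(u, v) \<in> R\<^sup>*" "u \<noteq> v" obtains z where "(u, z) \<in> R"
  using assms by (metis converse_rtranclE)

definition tpath :: "'v graph \<Rightarrow> 'v list \<Rightarrow> bool" where
  "tpath T p \<longleftrightarrow> set p \<subseteq> verts T \<and> distinct p \<and> (\<forall>i. Suc i < length p \<longrightarrow> {p ! i, p ! Suc i} \<in> edges T)"

text \<open>The first vertex of a longest path is a leaf: a second neighbour would either prolong
  the path or, lying on it, close a cycle.\<close>

lemma tree_leaf:
  assumes T: "is_tree T" and ab: "a \<in> verts T" "b \<in> verts T" "a \<noteq> b"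
  obtains t s where "t \<in> verts T" "s \<in> verts T" "t \<noteq> s" "{t, s} \<in> edges T"
    "\<forall>e\<in>edges T. t \<in> e \<longrightarrow> e = {t, s}"
proof -
  have fin: "finite (verts T)" and wf: "\<And>e. e \<in> edges T \<Longrightarrow> e \<subseteq> verts T \<and> card e = 2"
    and con: "\<And>u v. u \<in> verts T \<Longrightarrow> v \<in> verts T \<Longrightarrow> (u, v) \<in> {(x, y). {x, y} \<in> edges T}\<^sup>*"
    and acyc: "\<nexists>c. is_cycle T c"
    using T by (auto simp: is_tree_def wf_graph_def connected_graph_def)
  have ne: "{x, y} \<in> edges T \<Longrightarrow> x \<noteq> y \<and> x \<in> verts T \<and> y \<in> verts T" for x y
    using wf[of "{x, y}"] by auto
  obtain z where "{a, z} \<in> edges T" using converse_first_step[OF con[OF ab(1,2)] ab(3)] by auto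
  then have p0: "tpath T [a, z]" using ne[of a z] by (auto simp: tpath_def less_Suc_eq)
  have "length p \<le> card (verts T)" if "tpath T p" for p
    using that fin by (metis tpath_def card_mono distinct_card)
  then have "\<forall>p. tpath T p \<longrightarrow> length p < Suc (card (verts T))" by (simp add: less_Suc_eq_le)
  from ex_has_greatest_nat[of "tpath T", OF p0 this]
  obtain p where p: "tpath T p" and max: "\<And>q. tpath T q \<Longrightarrow> length q \<le> length p" by blast
  from max[OF p0] obtain x y r where pxy: "p = x # y # r" by (cases p rule: list.exhaust; cases "tl p") auto
  have xy: "{x, y} \<in> edges T" using p unfolding tpath_def pxy by force
  show ?thesis
  proof (rule that[of x y])
    show "x \<in> verts T" "y \<in> verts T" "x \<noteq> y" "{x, y} \<in> edges T" using ne[OF xy] xy by auto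
    have "e = {x, y}" if e: "e \<in> edges T" "x \<in> e" for e
    proof -
      from e obtain w where w: "e = {x, w}" using wf[OF e(1)] by (auto simp: card_2_iff)
      show "e = {x, y}"
      proof (rule ccontr)
        assume "e \<noteq> {x, y}"
        then have "w \<noteq> y" "w \<noteq> x" using w e ne[of x w] by auto
        show False
        proof (cases "w \<in> set p")
          case False
          have "tpath T (w # p)"
            unfolding tpath_def
          proof (intro conjI allI impI)
            show "set (w # p) \<subseteq> verts T" using p ne[of x w] w e by (auto simp: tpath_def)
            show "distinct (w # p)" using p False by (auto simp: tpath_def)
            fix i assume "Suc i < length (w # p)"
            then show "{(w # p) ! i, (w # p) ! Suc i} \<in> edges T"
              using p e w by (cases i) (auto simp: tpath_def pxy insert_commute)
          qed
          from max[OF this] show False by simp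
        next
          case True
          then obtain i where i: "i < length p" "p ! i = w" by (auto simp: in_set_conv_nth)
          \<comment> \<open>\<open>w\<close> is neither of the first two vertices, so the closed
            part has at least three vertices, as \<open>is_cycle\<close> demands.\<close>
          then have "i \<noteq> 0" "i \<noteq> 1" using \<open>w \<noteq> y\<close> \<open>w \<noteq> x\<close> pxy by (auto intro: ccontr)
          then have i2: "2 \<le> i" by linarith
          let ?c = "take (Suc i) p"
          have len: "length ?c = Suc i" using i by simp
          have "is_cycle T ?c"
            unfolding is_cycle_def len
          proof (intro conjI allI impI)
            show "3 \<le> Suc i" using i2 by simp
            show "distinct ?c" using p by (simp add: tpath_def)
            fix j assume j: "j < Suc i"
            show "{?c ! j, ?c ! (Suc j mod Suc i)} \<in> edges T"
            proof (cases "j = i")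
              case True
              moreover have "?c ! i = w" using i by simp
              moreover have "?c ! 0 = x" using pxy by simp
              ultimately show ?thesis using e w by (simp add: insert_commute)
            next
              case False
              then have "Suc j < Suc i" using j by simp
              then show ?thesis using p i by (simp add: tpath_def)
            qed
          qed
          then show False using acyc by blast
        qed
      qed
    qed
    then show "\<forall>e\<in>edges T. x \<in> e \<longrightarrow> e = {x, y}" by blast
  qed
qed

text \<open>A walk enters and leaves \<open>t\<close> via \<open>s\<close>, so the detour through
  \<open>t\<close> can be cut out.\<close>

lemma connected_remove_leaf:
  assumes con: "connected_graph H" and leaf: "\<And>e. e \<in> edges H \<Longrightarrow> t \<in> e \<Longrightarrow> e = {t, s}"
    and "t \<noteq> s" and ne: "verts H - {t} \<noteq> {}"
  shows "connected_graph (induced_subgraph H (- {t}))"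
  unfolding connected_graph_def
proof (intro conjI ballI)
  let ?R = "{(x, y). {x, y} \<in> edges H}" and ?R' = "{(x, y). {x, y} \<in> edges (induced_subgraph H (- {t}))}"
  show "verts (induced_subgraph H (- {t})) \<noteq> {}" using ne by (auto simp: induced_subgraph_def)
  fix u v assume "u \<in> verts (induced_subgraph H (- {t}))" "v \<in> verts (induced_subgraph H (- {t}))"
  then have u: "u \<in> verts H" "u \<noteq> t" and v: "v \<in> verts H" "v \<noteq> t" by (auto simp: induced_subgraph_def)
  \<comment> \<open>While the walk stands at \<open>t\<close>, the invariant keeps \<open>s\<close>
    as the place reached.\<close>
  have "(u, x) \<in> ?R\<^sup>* \<Longrightarrow> (x \<noteq> t \<longrightarrow> (u, x) \<in> ?R'\<^sup>*) \<and> (x = t \<longrightarrow> (u, s) \<in> ?R'\<^sup>*)" for x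
  proof (induction rule: rtrancl_induct)
    case base
    then show ?case using u by auto
  next
    case (step x y)
    then have xy: "{x, y} \<in> edges H" by simp
    consider "x = t" | "y = t" | "x \<noteq> t" "y \<noteq> t" by blast
    then show ?case
    proof cases
      case 1
      with leaf[OF xy] \<open>t \<noteq> s\<close> have "y = s" by (auto simp: doubleton_eq_iff)
      with 1 step.IH \<open>t \<noteq> s\<close> show ?thesis by auto
    next
      case 2
      with leaf[OF xy] \<open>t \<noteq> s\<close> have "x = s" by (auto simp: doubleton_eq_iff)
      with 2 step.IH \<open>t \<noteq> s\<close> show ?thesis by auto
    next
      case 3
      then have "(x, y) \<in> ?R'" using xy by (auto simp: induced_subgraph_def)
      with 3 step.IH show ?thesis by (auto intro: rtrancl_into_rtrancl)
    qed
  qed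
  moreover have "(u, v) \<in> ?R\<^sup>*" using con u v by (auto simp: connected_graph_def)
  ultimately show "(u, v) \<in> ?R'\<^sup>*" using v by blast
qed

lemma tree_remove_leaf:
  assumes T: "is_tree T" and leaf: "\<And>e. e \<in> edges T \<Longrightarrow> t \<in> e \<Longrightarrow> e = {t, s}"
    and s: "t \<noteq> s" "s \<in> verts T"
  shows "is_tree (induced_subgraph T (- {t}))"
  unfolding is_tree_def
proof (intro conjI notI)
  show "wf_graph (induced_subgraph T (- {t}))"
    using T by (auto simp: is_tree_def wf_graph_def induced_subgraph_def)
  show "connected_graph (induced_subgraph T (- {t}))"
    by (rule connected_remove_leaf[OF _ leaf s(1)]) (use T s in \<open>auto simp: is_tree_def\<close>)
  assume "\<exists>c. is_cycle (induced_subgraph T (- {t})) c"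
  then obtain c where "is_cycle (induced_subgraph T (- {t})) c" by blast
  then have "is_cycle T c" by (simp add: is_cycle_def induced_subgraph_def)
  with T show False by (auto simp: is_tree_def)
qed

text \<open>A chordal supergraph \<open>F\<close> of \<open>G\<close> with a proper \<open>K\<close>-colouring \<open>\<chi>\<close> and a perfect
  elimination order given by \<open>\<rho>\<close>; the colour of a vertex is the slot it occupies in the
  separators of the dynamic program.\<close>

definition elim_cert :: "nat \<Rightarrow> 'v graph \<Rightarrow> ('v \<Rightarrow> nat) \<Rightarrow> ('v \<Rightarrow> nat) \<Rightarrow> ('v \<times> 'v) set \<Rightarrow> bool" where
  "elim_cert K G \<rho> \<chi> F \<longleftrightarrow> inj_on \<rho> (verts G) \<and> (\<forall>v\<in>verts G. \<chi> v < K) \<and> sym F \<and>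
     F \<subseteq> verts G \<times> verts G \<and> (\<forall>u v. {u, v} \<in> edges G \<longrightarrow> (u, v) \<in> F) \<and>
     (\<forall>u v. (u, v) \<in> F \<longrightarrow> \<chi> u \<noteq> \<chi> v) \<and>
     (\<forall>u v w. (u, v) \<in> F \<longrightarrow> (u, w) \<in> F \<longrightarrow> \<rho> u < \<rho> v \<longrightarrow> \<rho> u < \<rho> w \<longrightarrow> v \<noteq> w \<longrightarrow> (v, w) \<in> F)"

section \<open>Certificates from tree decompositions\<close>

text \<open>The case of a single bag: in a complete graph any enumeration serves both as elimination
  order and as colouring.\<close>

lemma elim_cert_complete:
  assumes "wf_graph G" "card (verts G) \<le> K"
  shows "\<exists>\<rho> \<chi>. elim_cert K G \<rho> \<chi> {(u, v). u \<in> verts G \<and> v \<in> verts G \<and> u \<noteq> v}"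
proof -
  have fin: "finite (verts G)" using assms by (auto simp: wf_graph_def)
  obtain h where h: "bij_betw h (verts G) {0..<card (verts G)}"
    using ex_bij_betw_finite_nat[OF fin] by blast
  have "elim_cert K G h h {(u, v). u \<in> verts G \<and> v \<in> verts G \<and> u \<noteq> v}"
    unfolding elim_cert_def
  proof (intro conjI allI impI ballI)
    show inj: "inj_on h (verts G)" using h by (simp add: bij_betw_def)
    show "h v < K" if "v \<in> verts G" for v using bij_betwE[OF h] assms(2) that by fastforce
    show "(u, v) \<in> {(u, v). u \<in> verts G \<and> v \<in> verts G \<and> u \<noteq> v}" if "{u, v} \<in> edges G" for u v
      using that assms(1) by (auto simp: wf_graph_def)
    show "h u \<noteq> h v" if "(u, v) \<in> {(u, v). u \<in> verts G \<and> v \<in> verts G \<and> u \<noteq> v}" for u v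
      using that inj by (auto dest: inj_onD)
  qed (auto simp: sym_def)
  then show ?thesis by blast
qed

lemma td_elim_cert:
  assumes "tree_decomposition G T \<beta>" "wf_graph G" "\<forall>t\<in>verts T. card (\<beta> t) \<le> K"
  shows "\<exists>\<rho> \<chi> F. elim_cert K G \<rho> \<chi> F \<and> (\<forall>t\<in>verts T. \<forall>u\<in>\<beta> t. \<forall>v\<in>\<beta> t. u \<noteq> v \<longrightarrow> (u, v) \<in> F)"
  using assms
proof (induction "card (verts T)" arbitrary: G T rule: less_induct)
  case less
  have T: "is_tree T" and bags: "(\<Union>t\<in>verts T. \<beta> t) = verts G"
    and edge: "\<And>e. e \<in> edges G \<Longrightarrow> \<exists>t\<in>verts T. e \<subseteq> \<beta> t"
    and con: "\<And>v. v \<in> verts G \<Longrightarrow> connected_graph (induced_subgraph T {t. v \<in> \<beta> t})"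
    using less.prems(1) by (auto simp: tree_decomposition_def)
  have finT: "finite (verts T)" and neT: "verts T \<noteq> {}"
    using T by (auto simp: is_tree_def wf_graph_def connected_graph_def)
  have wfT: "\<And>e. e \<in> edges T \<Longrightarrow> e \<subseteq> verts T \<and> card e = 2"
    using T by (auto simp: is_tree_def wf_graph_def)
  have finG: "finite (verts G)" using less.prems(2) by (auto simp: wf_graph_def)
  show ?case
  proof (cases "\<exists>a b. a \<in> verts T \<and> b \<in> verts T \<and> a \<noteq> b")
    case False
    then obtain t where t: "verts T = {t}" using neT by blast
    have "card (verts G) \<le> K" using bags less.prems(3) t by auto
    from elim_cert_complete[OF less.prems(2) this] obtain \<rho> \<chi> where
      "elim_cert K G \<rho> \<chi> {(u, v). u \<in> verts G \<and> v \<in> verts G \<and> u \<noteq> v}" by blast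
    then show ?thesis using bags t by blast
  next
    case True
    then obtain a b where ab: "a \<in> verts T" "b \<in> verts T" "a \<noteq> b" by blast
    obtain t s where t: "t \<in> verts T" and s: "s \<in> verts T" "t \<noteq> s" "{t, s} \<in> edges T"
      and "\<forall>e\<in>edges T. t \<in> e \<longrightarrow> e = {t, s}"
      by (rule tree_leaf[OF T ab])
    then have leaf: "\<And>e. e \<in> edges T \<Longrightarrow> t \<in> e \<Longrightarrow> e = {t, s}" by blast
    define U where "U = \<beta> t - \<beta> s"
    define G' where "G' = induced_subgraph G (- U)"
    define T' where "T' = induced_subgraph T (- {t})"
    have bsub: "\<beta> x \<subseteq> verts G" if "x \<in> verts T" for x using bags that by blast
    \<comment> \<open>The bags holding \<open>v\<close> form a connected subtree; from
      \<open>t\<close> it could continue only to \<open>s\<close>, whose bag lacks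
      \<open>v\<close>.\<close>
    have only: "v \<notin> \<beta> x" if "v \<in> U" "x \<in> verts T" "x \<noteq> t" for v x
    proof
      assume "v \<in> \<beta> x"
      let ?H = "induced_subgraph T {t. v \<in> \<beta> t}"
      have "connected_graph ?H" using con bsub[OF t] that by (auto simp: U_def)
      moreover have "t \<in> verts ?H" "x \<in> verts ?H"
        using t that \<open>v \<in> \<beta> x\<close> by (auto simp: U_def induced_subgraph_def)
      ultimately have tx: "(t, x) \<in> {(x, y). {x, y} \<in> edges ?H}\<^sup>*" by (simp add: connected_graph_def)
      have txne: "t \<noteq> x" using that by auto
      obtain z where "(t, z) \<in> {(x, y). {x, y} \<in> edges ?H}"
        by (rule converse_first_step[OF tx txne])
      then have "{t, z} \<in> edges T" "v \<in> \<beta> z" by (auto simp: induced_subgraph_def)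
      with leaf[of "{t, z}"] s(2) have "z = s" by (auto simp: doubleton_eq_iff)
      with \<open>v \<in> \<beta> z\<close> \<open>v \<in> U\<close> show False by (simp add: U_def)
    qed
    have vT': "verts T' = verts T - {t}" by (auto simp: T'_def induced_subgraph_def)
    have vG': "verts G' = verts G - U" by (auto simp: G'_def induced_subgraph_def)
    have other: "\<exists>x\<in>verts T'. v \<in> \<beta> x" if "v \<in> verts G'" for v
    proof -
      have "v \<in> (\<Union>t\<in>verts T. \<beta> t)" unfolding bags using that vG' by simp
      then obtain x where x: "x \<in> verts T" "v \<in> \<beta> x" by auto
      show ?thesis
      proof (cases "x = t")
        case True
        then have "v \<in> \<beta> s" using that x vG' by (auto simp: U_def)
        then show ?thesis using s vT' by auto
      qed (use x vT' in auto)
    qed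
    have td': "tree_decomposition G' T' \<beta>"
      unfolding tree_decomposition_def
    proof (intro conjI ballI)
      show "is_tree T'" unfolding T'_def by (rule tree_remove_leaf[OF T leaf s(2,1)])
      show "(\<Union>t\<in>verts T'. \<beta> t) = verts G'"
      proof (intro equalityI subsetI)
        fix v assume "v \<in> (\<Union>t\<in>verts T'. \<beta> t)"
        then obtain x where "x \<in> verts T" "x \<noteq> t" "v \<in> \<beta> x" using vT' by auto
        then show "v \<in> verts G'" using only[of v x] bsub[of x] vG' by auto
      next
        fix v assume "v \<in> verts G'"
        from other[OF this] show "v \<in> (\<Union>t\<in>verts T'. \<beta> t)" by auto
      qed
    next
      fix e assume "e \<in> edges G'"
      then have e: "e \<in> edges G" "e \<inter> U = {}" by (auto simp: G'_def induced_subgraph_def)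
      obtain x where x: "x \<in> verts T" "e \<subseteq> \<beta> x" using edge[OF e(1)] by blast
      show "\<exists>t\<in>verts T'. e \<subseteq> \<beta> t"
      proof (cases "x = t")
        case True
        then have "e \<subseteq> \<beta> s" using e x by (auto simp: U_def)
        then show ?thesis using s vT' by auto
      qed (use x vT' in auto)
    next
      fix v assume v: "v \<in> verts G'"
      let ?H = "induced_subgraph T {t. v \<in> \<beta> t}"
      have "connected_graph (induced_subgraph ?H (- {t}))"
      proof (rule connected_remove_leaf[OF _ _ s(2)])
        show "connected_graph ?H" using con v vG' by simp
        show "e = {t, s}" if "e \<in> edges ?H" "t \<in> e" for e using leaf that by (auto simp: induced_subgraph_def)
        show "verts ?H - {t} \<noteq> {}" using other[OF v] vT' by (auto simp: induced_subgraph_def)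
      qed
      moreover have "induced_subgraph ?H (- {t}) = induced_subgraph T' {t. v \<in> \<beta> t}"
        by (auto simp: induced_subgraph_def T'_def)
      ultimately show "connected_graph (induced_subgraph T' {t. v \<in> \<beta> t})" by simp
    qed
    have wf': "wf_graph G'" using less.prems(2) by (auto simp: wf_graph_def G'_def induced_subgraph_def)
    have "card (verts T') < card (verts T)" unfolding vT' using t finT by (intro psubset_card_mono) auto
    from less.hyps[OF this td' wf'] obtain \<rho>' \<chi>' F' where
      cert: "elim_cert K G' \<rho>' \<chi>' F'" and clique: "\<And>x u v. x \<in> verts T' \<Longrightarrow> u \<in> \<beta> x \<Longrightarrow> v \<in> \<beta> x \<Longrightarrow> u \<noteq> v \<Longrightarrow> (u, v) \<in> F'"
      using less.prems(3) vT' by auto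
    have inj': "inj_on \<rho>' (verts G')" and col': "\<And>v. v \<in> verts G' \<Longrightarrow> \<chi>' v < K" and sym': "\<And>u v. (u, v) \<in> F' \<Longrightarrow> (v, u) \<in> F'"
      and sub': "\<And>u v. (u, v) \<in> F' \<Longrightarrow> u \<in> verts G' \<and> v \<in> verts G'"
      and edge': "\<And>u v. {u, v} \<in> edges G' \<Longrightarrow> (u, v) \<in> F'"
      and prop': "\<And>u v. (u, v) \<in> F' \<Longrightarrow> \<chi>' u \<noteq> \<chi>' v"
      and chord': "\<And>u v w. (u, v) \<in> F' \<Longrightarrow> (u, w) \<in> F' \<Longrightarrow> \<rho>' u < \<rho>' v \<Longrightarrow> \<rho>' u < \<rho>' w \<Longrightarrow> v \<noteq> w \<Longrightarrow> (v, w) \<in> F'"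
      using cert unfolding elim_cert_def sym_def by blast+
    have sT': "s \<in> verts T'" using s vT' by auto
    let ?B = "\<beta> t \<inter> \<beta> s"
    have finb: "finite (\<beta> t)" using bsub[OF t] finG finite_subset by blast
    have UB: "\<beta> t = U \<union> ?B" "U \<inter> ?B = {}" by (auto simp: U_def)
    \<comment> \<open>Counting colours: the bag has at most \<open>K\<close> vertices, so at least
      \<open>card U\<close> colours are left after those used on \<open>?B\<close> are taken
      away.\<close>
    have "card U + card ?B \<le> K"
      using less.prems(3) t finb card_Un_disjoint[of U ?B] UB by (metis finite_Un)
    moreover have "card (\<chi>' ` ?B) \<le> card ?B" using finb by (intro card_image_le) auto
    moreover have "K - card (\<chi>' ` ?B) \<le> card ({..<K} - \<chi>' ` ?B)"
      using diff_card_le_card_Diff[of "\<chi>' ` ?B" "{..<K}"] finb by simp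
    ultimately have "card U \<le> card ({..<K} - \<chi>' ` ?B)" by linarith
    moreover have finU: "finite U" using finb by (simp add: U_def)
    ultimately obtain g where g: "g ` U \<subseteq> {..<K} - \<chi>' ` ?B" "inj_on g U"
      using card_le_inj[of U "{..<K} - \<chi>' ` ?B"] by auto
    obtain h where h: "bij_betw h U {0..<card U}"
      using ex_bij_betw_finite_nat[OF finU] by blast
    have hU: "h u < card U" if "u \<in> U" for u using h that by (auto simp: bij_betw_def)
    \<comment> \<open>\<open>h\<close> numbers \<open>U\<close> below \<open>card U\<close>; all
      older ranks are shifted above that.\<close>
    define \<rho> where "\<rho> v = (if v \<in> U then h v else card U + \<rho>' v)" for v
    define \<chi> where "\<chi> v = (if v \<in> U then g v else \<chi>' v)" for v
    define F where "F = F' \<union> {(u, v). u \<in> \<beta> t \<and> v \<in> \<beta> t \<and> u \<noteq> v}"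
    \<comment> \<open>Two vertices of \<open>\<beta> t\<close> outside \<open>U\<close> both lie in
      \<open>\<beta> s\<close>, which is already a clique of \<open>F'\<close>.\<close>
    have F_old: "(u, v) \<in> F'" if "(u, v) \<in> F" "u \<notin> U" "v \<notin> U" for u v
      using that clique[OF sT', of u v] by (auto simp: F_def U_def)
    have F_new: "u \<in> \<beta> t \<and> v \<in> \<beta> t \<and> u \<noteq> v" if "(u, v) \<in> F" "u \<in> U \<or> v \<in> U" for u v
      using that sub'[of u v] vG' by (auto simp: F_def)
    have g_new: "g u \<noteq> \<chi>' v" if "u \<in> U" "v \<in> \<beta> t" "v \<notin> U" for u v
      using that g(1) by (auto simp: U_def)
    have "elim_cert K G \<rho> \<chi> F"
      unfolding elim_cert_def
    proof (intro conjI allI impI ballI)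
      show "inj_on \<rho> (verts G)"
      proof (rule inj_onI)
        fix x y assume xy: "x \<in> verts G" "y \<in> verts G" "\<rho> x = \<rho> y"
        show "x = y"
        proof (cases "x \<in> U")
          case True
          then have yU: "y \<in> U" using xy(3) hU[OF True] by (auto simp: \<rho>_def split: if_splits)
          have "inj_on h U" using h by (simp add: bij_betw_def)
          then show ?thesis using xy True yU by (auto simp: \<rho>_def dest: inj_onD)
        next
          case False
          then have "y \<notin> U" using xy(3) hU[of y] by (auto simp: \<rho>_def split: if_splits)
          with False show ?thesis using xy inj' vG' by (auto simp: \<rho>_def dest: inj_onD)
        qed
      qed
      show "\<chi> v < K" if "v \<in> verts G" for v
        using that g(1) col'[of v] vG' by (auto simp: \<chi>_def)
      show "sym F" using sym' by (auto simp: sym_def F_def)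
      show "F \<subseteq> verts G \<times> verts G" using sub' vG' bsub[OF t] by (auto simp: F_def)
    next
      fix u v assume uv: "{u, v} \<in> edges G"
      show "(u, v) \<in> F"
      proof (cases "u \<in> U \<or> v \<in> U")
        case True
        obtain x where x: "x \<in> verts T" "{u, v} \<subseteq> \<beta> x" using edge[OF uv] by blast
        then have "x = t" using True only by blast
        moreover have "u \<noteq> v" using uv less.prems(2) by (auto simp: wf_graph_def)
        ultimately show ?thesis using x by (auto simp: F_def)
      next
        case False
        then have "{u, v} \<in> edges G'" using uv by (auto simp: G'_def induced_subgraph_def)
        then show ?thesis using edge' by (auto simp: F_def)
      qed
    next
      fix u v assume uv: "(u, v) \<in> F"
      show "\<chi> u \<noteq> \<chi> v"
      proof (cases "u \<in> U \<or> v \<in> U")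
        case True
        from F_new[OF uv this] show ?thesis
          using g_new[of u v] g_new[of v u] g(2) True by (auto simp: \<chi>_def dest: inj_onD)
      next
        case False
        then show ?thesis using prop'[OF F_old[OF uv]] by (simp add: \<chi>_def)
      qed
    next
      fix u v w assume a: "(u, v) \<in> F" "(u, w) \<in> F" "\<rho> u < \<rho> v" "\<rho> u < \<rho> w" "v \<noteq> w"
      show "(v, w) \<in> F"
      proof (cases "u \<in> U")
        case True
        then show ?thesis using F_new[OF a(1)] F_new[OF a(2)] a(5) by (auto simp: F_def)
      next
        case False
        then have vw: "v \<notin> U" "w \<notin> U" using a(3,4) hU[of v] hU[of w] by (auto simp: \<rho>_def split: if_splits)
        have "(v, w) \<in> F'"
          by (rule chord'[OF F_old[OF a(1)] F_old[OF a(2)]]) (use a False vw in \<open>auto simp: \<rho>_def\<close>)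
        then show ?thesis by (simp add: F_def)
      qed
    qed
    moreover have "(u, v) \<in> F" if "x \<in> verts T" "u \<in> \<beta> x" "v \<in> \<beta> x" "u \<noteq> v" for x u v
      using that clique[of x u v] vT' by (cases "x = t") (auto simp: F_def)
    ultimately show ?thesis by blast
  qed
qed

lemma treewidth_elim_cert:
  assumes wf: "wf_graph G" and tw: "treewidth G \<le> k"
  shows "\<exists>\<rho> \<chi> F. elim_cert (Suc k) G \<rho> \<chi> F"
proof -
  \<comment> \<open>The least width is attained only if some decomposition exists; the one with a
    single bag shows this.\<close>
  let ?T = "\<lparr>verts = {0}, edges = {}\<rparr> :: nat graph"
  have "is_tree ?T"
    by (auto simp: is_tree_def wf_graph_def connected_graph_def is_cycle_def) force
  then have "tree_decomposition G ?T (\<lambda>_. verts G)"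
    using wf by (auto simp: tree_decomposition_def wf_graph_def connected_graph_def induced_subgraph_def)
  then have "\<exists>k T \<beta>. tree_decomposition G T \<beta> \<and> width T \<beta> = k" by blast
  then have "\<exists>T \<beta>. tree_decomposition G T \<beta> \<and> width T \<beta> = treewidth G"
    unfolding treewidth_def by (rule LeastI_ex)
  then obtain T \<beta> where td: "tree_decomposition G T \<beta>" and w: "width T \<beta> = treewidth G" by blast
  have fin: "finite (verts T)"
    using td by (auto simp: tree_decomposition_def is_tree_def wf_graph_def)
  have "card (\<beta> t) \<le> Suc k" if "t \<in> verts T" for t
  proof -
    have "card (\<beta> t) \<le> Max ((\<lambda>t. card (\<beta> t)) ` verts T)" using fin that by (intro Max_ge) auto
    \<comment> \<open>Truncated subtraction does no harm: the largest bag has at most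
      \<open>width T \<beta> + 1\<close> vertices in any case.\<close>
    then show ?thesis using w tw unfolding width_def by linarith
  qed
  then show ?thesis using td_elim_cert[OF td wf, of "Suc k"] by blast
qed

section \<open>The dynamic program\<close>

definition adjb :: "(nat \<times> nat) list \<Rightarrow> nat \<Rightarrow> nat \<Rightarrow> bool" where
  "adjb es i j \<longleftrightarrow> list_ex (\<lambda>e. fst e = i \<and> snd e = j \<or> fst e = j \<and> snd e = i) es"

text \<open>The root \<open>v\<close> is offered in every round, so the iteration can start from the
  empty list.\<close>

definition reach :: "nat \<Rightarrow> (nat \<times> nat) list \<Rightarrow> nat list \<Rightarrow> nat \<Rightarrow> nat list \<Rightarrow> nat list" where
  "reach n es S v C = filter (\<lambda>u. u \<notin> set S \<and> (u = v \<or> list_ex (\<lambda>w. adjb es w u) C)) [0..<n]"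

definition comp :: "nat \<Rightarrow> (nat \<times> nat) list \<Rightarrow> nat list \<Rightarrow> nat \<Rightarrow> nat list" where
  "comp n es S v = foldl (\<lambda>C _. reach n es S v C) [] [0..<n]"

text \<open>The code is built from the low end; the second component is the current power of two,
  obtained by doubling.\<close>

definition labP :: "(nat \<Rightarrow> bool) \<Rightarrow> nat list \<Rightarrow> nat" where
  "labP P S = fst (foldl (\<lambda>m s. (if P s then fst m + snd m else fst m, snd m + snd m)) (0, 1) S)"

definition vlab :: "(nat \<times> nat) list \<Rightarrow> nat list \<Rightarrow> nat \<Rightarrow> nat" where
  "vlab es S b = labP (\<lambda>s. adjb es b s) S"

definition elab :: "nat list \<Rightarrow> nat \<times> nat \<Rightarrow> nat" where
  "elab S e = labP (\<lambda>s. s = fst e \<or> s = snd e) S"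

type_synonym table = "((nat list \<times> nat) \<times> nat) list"

text \<open>Table values are successors of automaton states; 0 means that nothing is known yet.\<close>

definition lookup :: "table \<Rightarrow> nat list \<Rightarrow> nat \<Rightarrow> nat" where
  "lookup T S v = foldl (\<lambda>r t. if snd (fst t) = v \<and> fst (fst t) = S then snd t else r) 0 T"

text \<open>The state pairs the vertices covered so far with a value shifted by 1. Each component is
  joined once, by plain concatenation, and an unknown entry makes the result 0 for good. The start
  value belongs to the leaf without element.\<close>

definition joinall :: "aut \<Rightarrow> nat \<Rightarrow> nat \<Rightarrow> (nat \<times> nat) list \<Rightarrow> table \<Rightarrow> nat list \<Rightarrow> nat list \<Rightarrow> nat list \<times> nat" where
  "joinall A K n es T S Z = foldl (\<lambda>s u. if u \<in> set (fst s) then s else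
      (filter (\<lambda>w. w \<in> set (fst s) \<or> w \<in> set (comp n es S u)) [0..<n],
       if snd s = 0 \<or> lookup T S u = 0 then 0 else Suc (comb A K (snd s - 1) (lookup T S u - 1))))
     ([], Suc (base A 2 0 0)) Z"

text \<open>Selects the edges of the component that are still missing, those from \<open>b\<close>
  to the outside. The edges from \<open>b\<close> into the component were built together with the
  smaller components.\<close>

definition addedges :: "aut \<Rightarrow> nat \<Rightarrow> (nat \<times> nat) list \<Rightarrow> nat list \<Rightarrow> nat list \<Rightarrow> nat \<Rightarrow> nat \<Rightarrow> nat" where
  "addedges A K es S C b x = foldl (\<lambda>v e. if fst e = b \<and> snd e \<notin> set C \<or> snd e = b \<and> fst e \<notin> set C
     then comb A K v (base A 1 (elab S e) 0) else v) x es"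

text \<open>The component of \<open>v\<close> is taken apart at its vertex \<open>b\<close>, which moves into slot \<open>j\<close>; the old
  occupant of that slot must not matter for the component. The number \<open>n\<close> marks an empty slot.\<close>

definition attempt :: "aut \<Rightarrow> nat \<Rightarrow> nat \<Rightarrow> (nat \<times> nat) list \<Rightarrow> table \<Rightarrow> nat list \<Rightarrow> nat \<Rightarrow> nat \<Rightarrow> nat \<Rightarrow> nat" where
  "attempt A K n es T S v j b =
    (if b \<in> set (comp n es S v) \<and> \<not> list_ex (\<lambda>c. adjb es c (look S j)) (comp n es S v) \<and>
        snd (joinall A K n es T (S[j := b]) (filter (\<lambda>u. u \<noteq> b) (comp n es S v))) \<noteq> 0
     then Suc (comb A j (addedges A K es (S[j := b]) (comp n es S v) b
         (snd (joinall A K n es T (S[j := b]) (filter (\<lambda>u. u \<noteq> b) (comp n es S v))) - 1))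
       (base A 0 (vlab es (S[j := n]) b) 0))
     else 0)"

definition search :: "aut \<Rightarrow> nat \<Rightarrow> nat \<Rightarrow> (nat \<times> nat) list \<Rightarrow> table \<Rightarrow> nat list \<Rightarrow> nat \<Rightarrow> nat" where
  "search A K n es T S v = foldl (\<lambda>r j. foldl (\<lambda>r b. if r \<noteq> 0 then r else attempt A K n es T S v j b) r [0..<n]) 0 [0..<K]"

primrec tuples :: "nat \<Rightarrow> nat \<Rightarrow> nat list list" where
  "tuples 0 n = [[]]"
| "tuples (Suc k) n = foldl (\<lambda>a S. map (\<lambda>i. i # S) [0..<Suc n] @ a) [] (tuples k n)"

definition init :: "nat \<Rightarrow> nat \<Rightarrow> table" where
  "init K n = foldl (\<lambda>a S. map (\<lambda>v. ((S, v), 0)) [0..<n] @ a) [] (tuples K n)"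

definition next_table :: "aut \<Rightarrow> nat \<Rightarrow> nat \<Rightarrow> (nat \<times> nat) list \<Rightarrow> table \<Rightarrow> table" where
  "next_table A K n es T = map (\<lambda>t. (fst t, if snd t = 0 then search A K n es T (fst (fst t)) (snd (fst t)) else snd t)) T"

definition table :: "aut \<Rightarrow> nat \<Rightarrow> nat \<Rightarrow> (nat \<times> nat) list \<Rightarrow> table" where
  "table A K n es = foldl (\<lambda>T _. next_table A K n es T) (init K n) [0..<n]"

text \<open>At the root every slot holds the empty mark \<open>n\<close>, and all components of the
  graph are joined.\<close>

definition total :: "aut \<Rightarrow> nat \<Rightarrow> nat \<Rightarrow> (nat \<times> nat) list \<Rightarrow> nat" where
  "total A K n es = snd (joinall A K n es (table A K n es) (map (\<lambda>_. n) [0..<K]) [0..<n])"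

definition decide :: "aut \<Rightarrow> nat \<Rightarrow> nat \<Rightarrow> (nat \<times> nat) list \<Rightarrow> bool" where
  "decide A K n es \<longleftrightarrow> look (acc A) (total A K n es - 1)"

definition valid :: "nat \<Rightarrow> (nat \<times> nat) list \<Rightarrow> bool" where
  "valid n es \<longleftrightarrow> (\<forall>e\<in>set es. fst e < n \<and> snd e < n \<and> fst e \<noteq> snd e)"

section \<open>Components of a graph without a separator\<close>

lemma adjb_iff: "adjb es i j \<longleftrightarrow> (i, j) \<in> set es \<or> (j, i) \<in> set es"
  by (force simp: adjb_def list_ex_iff)

lemma adjb_sym: "adjb es i j \<longleftrightarrow> adjb es j i"
  by (auto simp: adjb_iff)

lemma adjb_valid: "valid n es \<Longrightarrow> adjb es i j \<Longrightarrow> i < n \<and> j < n \<and> i \<noteq> j"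
  by (auto simp: adjb_iff valid_def)

lemma set_reach: "set (reach n es S v C) = {u. u < n \<and> u \<notin> set S \<and> (u = v \<or> (\<exists>w\<in>set C. adjb es w u))}"
  by (auto simp: reach_def list_ex_iff)

text \<open>As long as the stages grow, stage \<open>i\<close> has at least \<open>i\<close>
  elements; after \<open>n\<close> rounds it is therefore either stable or consists of all
  \<open>n\<close> vertices, which is stable too.\<close>

lemma comp_fixpoint: "set (reach n es S v (comp n es S v)) = set (comp n es S v)"
proof -
  define C where "C i = foldl (\<lambda>C _. reach n es S v C) [] [0..<i]" for i :: nat
  have C: "C 0 = []" "C (Suc i) = reach n es S v (C i)" for i by (simp_all add: C_def)
  have mono: "set D \<subseteq> set E \<Longrightarrow> set (reach n es S v D) \<subseteq> set (reach n es S v E)" for D E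
    by (auto simp: set_reach)
  have inc: "set (C i) \<subseteq> set (C (Suc i))" for i
    by (induction i) (auto simp: C intro: mono[THEN subsetD])
  have bound: "set (C i) \<subseteq> {..<n}" for i by (cases i) (auto simp: C set_reach)
  have "i \<le> card (set (C i)) \<or> set (C i) = set (C (Suc i))" for i
  proof (induction i)
    case (Suc i)
    show ?case
    proof (cases "set (C i) = set (C (Suc i))")
      case True
      then have "set (C (Suc i)) = set (C (Suc (Suc i)))"
        using mono[of "C i" "C (Suc i)"] mono[of "C (Suc i)" "C i"] unfolding C(2) by blast
      then show ?thesis by simp
    next
      case False
      then have "set (C i) \<subset> set (C (Suc i))" using inc by blast
      then have "card (set (C i)) < card (set (C (Suc i)))" by (intro psubset_card_mono) auto
      then show ?thesis using Suc False by linarith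
    qed
  qed simp
  from this[of n] have "set (C n) = set (C (Suc n))"
  proof
    assume n: "n \<le> card (set (C n))"
    then have "set (C n) = {..<n}" using bound[of n] by (intro card_seteq) auto
    then show ?thesis using inc[of n] bound[of "Suc n"] by blast
  qed
  then show ?thesis by (simp add: C comp_def C_def)
qed

text \<open>The induction principle for components: a property of \<open>v\<close> that is preserved
  along edges avoiding \<open>S\<close> holds throughout the component.\<close>

lemma comp_least:
  assumes "v \<in> X" "\<And>x y. x \<in> X \<Longrightarrow> adjb es x y \<Longrightarrow> y < n \<Longrightarrow> y \<notin> set S \<Longrightarrow> y \<in> X"
  shows "set (comp n es S v) \<subseteq> X"
proof -
  have "set (foldl (\<lambda>C _. reach n es S v C) [] [0..<i]) \<subseteq> X" for i :: nat
    using assms by (induction i) (auto simp: set_reach)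
  then show ?thesis by (simp add: comp_def)
qed

lemma comp_sub: "u \<in> set (comp n es S v) \<Longrightarrow> u < n \<and> u \<notin> set S"
  using comp_fixpoint[of n es S v] by (auto simp: set_reach)

lemma comp_self: "v < n \<Longrightarrow> v \<notin> set S \<Longrightarrow> v \<in> set (comp n es S v)"
  using comp_fixpoint[of n es S v] by (auto simp: set_reach)

lemma comp_closed: "w \<in> set (comp n es S v) \<Longrightarrow> adjb es w u \<Longrightarrow> u < n \<Longrightarrow> u \<notin> set S \<Longrightarrow> u \<in> set (comp n es S v)"
  using comp_fixpoint[of n es S v] by (auto simp: set_reach)

lemma comp_mono: "u \<in> set (comp n es S v) \<Longrightarrow> set (comp n es S u) \<subseteq> set (comp n es S v)"
  by (rule comp_least) (auto intro: comp_closed)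

lemma comp_root:
  assumes "u \<in> set (comp n es S v)" shows "v \<in> set (comp n es S v)"
proof (rule ccontr)
  assume "v \<notin> set (comp n es S v)"
  then have "\<not> (v < n \<and> v \<notin> set S)" using comp_self by blast
  moreover have "set (foldl (\<lambda>C _. reach n es S v C) [] [0..<i]) = {}" if "\<not> (v < n \<and> v \<notin> set S)" for i :: nat
    using that by (induction i) (auto simp: set_reach)
  ultimately show False using assms by (simp add: comp_def)
qed

text \<open>The vertices whose own component leads back to \<open>v\<close> form a closed set
  containing \<open>v\<close>, so \<open>comp_least\<close> applies.\<close>

lemma comp_sym: assumes "u \<in> set (comp n es S v)" shows "v \<in> set (comp n es S u)"
proof -
  let ?X = "{x. x < n \<and> x \<notin> set S \<and> v \<in> set (comp n es S x)}"
  have v: "v < n" "v \<notin> set S" using comp_root[OF assms] comp_sub by blast+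
  have "set (comp n es S v) \<subseteq> ?X"
  proof (rule comp_least)
    show "v \<in> ?X" using v comp_self by simp
    fix x y assume x: "x \<in> ?X" and y: "adjb es x y" "y < n" "y \<notin> set S"
    have "y \<in> set (comp n es S y)" using y by (intro comp_self)
    then have "x \<in> set (comp n es S y)" using comp_closed[of y n es S y x] x y adjb_sym by blast
    then show "y \<in> ?X" using comp_mono[of x n es S y] x y by blast
  qed
  then show ?thesis using assms by blast
qed

lemma comp_eq: "u \<in> set (comp n es S v) \<Longrightarrow> set (comp n es S u) = set (comp n es S v)"
  using comp_mono comp_sym by blast

lemma labP:
  shows "set_decode (labP P S) = {j. j < length S \<and> P (S ! j)}" "labP P S < 2 ^ length S"
proof -
  let ?f = "\<lambda>m s. (if P s then fst m + snd m else fst m, snd m + snd m :: nat)"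
  have *: "snd (foldl ?f (0, 1) S) = 2 ^ length S \<and>
    set_decode (fst (foldl ?f (0, 1) S)) = {j. j < length S \<and> P (S ! j)}"
  proof (induction S rule: rev_induct)
    case (snoc s S)
    let ?m = "foldl ?f (0, 1) S"
    have IH: "snd ?m = 2 ^ length S" "set_decode (fst ?m) = {j. j < length S \<and> P (S ! j)}" using snoc by auto
    have "length S \<notin> set_decode (fst ?m)" unfolding IH by simp
    from set_decode_plus_power_2[OF this]
    have "set_decode (fst ?m + 2 ^ length S) = insert (length S) {j. j < length S \<and> P (S ! j)}"
      unfolding IH(2) by (simp only: add.commute)
    then show ?case using IH by (auto simp: nth_append less_Suc_eq)
  qed simp
  then show 1: "set_decode (labP P S) = {j. j < length S \<and> P (S ! j)}" by (simp add: labP_def)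
  show "labP P S < 2 ^ length S" unfolding less_power2_iff 1 by auto
qed

section \<open>Terms that realise parts of the graph\<close>

text \<open>What \<open>adjt\<close> of the finished term has to be: adjacency of vertices and
  incidence in both directions, for the entire graph.\<close>

definition rel :: "(nat \<times> nat) list \<Rightarrow> ((nat \<times> nat) \<times> (nat \<times> nat)) set" where
  "rel es = {((0, u), (0, w)) | u w. adjb es u w} \<union>
     {((0, u), (1, e)) | u e. e < length es \<and> (u = fst (es ! e) \<or> u = snd (es ! e))} \<union>
     {((1, e), (0, u)) | u e. e < length es \<and> (u = fst (es ! e) \<or> u = snd (es ! e))}"

lemma rel_iff [simp]:
  "((0, u), (0, w)) \<in> rel es \<longleftrightarrow> adjb es u w"
  "((0, u), (Suc 0, e)) \<in> rel es \<longleftrightarrow> e < length es \<and> (u = fst (es ! e) \<or> u = snd (es ! e))"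
  "((Suc 0, e), (0, u)) \<in> rel es \<longleftrightarrow> e < length es \<and> (u = fst (es ! e) \<or> u = snd (es ! e))"
  "((Suc 0, e), (Suc 0, e')) \<notin> rel es"
  by (auto simp: rel_def)

lemma rel_sym: "(x, y) \<in> rel es \<Longrightarrow> (y, x) \<in> rel es"
  by (auto simp: rel_def adjb_sym)

text \<open>The part of the graph that is built by the time the component \<open>C\<close> has been processed.\<close>

definition elts :: "(nat \<times> nat) list \<Rightarrow> nat set \<Rightarrow> (nat \<times> nat) set" where
  "elts es C = {(0, u) | u. u \<in> C} \<union> {(1, e) | e. e < length es \<and> (fst (es ! e) \<in> C \<or> snd (es ! e) \<in> C)}"

lemma elts_iff [simp]:
  "(0, u) \<in> elts es C \<longleftrightarrow> u \<in> C"
  "(Suc 0, e) \<in> elts es C \<longleftrightarrow> e < length es \<and> (fst (es ! e) \<in> C \<or> snd (es ! e) \<in> C)"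
  by (auto simp: elts_def)

lemma eltsE: assumes "x \<in> elts es C"
  obtains u where "x = (0, u)" "u \<in> C" | e where "x = (1, e)" "e < length es" "fst (es ! e) \<in> C \<or> snd (es ! e) \<in> C"
  using assms by (auto simp: elts_def)

lemma elts_Un: "elts es (C \<union> D) = elts es C \<union> elts es D"
  by (auto simp: elts_def)

text \<open>The labels record the links into the separator. If \<open>X\<close> belongs to a
  component of the graph without \<open>S\<close>, these are all links that leave \<open>X\<close>,
  so nothing else about \<open>X\<close> matters later.\<close>

definition good :: "nat \<Rightarrow> (nat \<times> nat) list \<Rightarrow> nat list \<Rightarrow> (nat \<times> nat) set \<Rightarrow> trm \<Rightarrow> bool" where
  "good K es S X t \<longleftrightarrow> ok_term K t \<and> dist t \<and> elems t = X \<and>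
     (\<forall>x\<in>X. lab t x = {j. j < K \<and> (x, (0, S ! j)) \<in> rel es}) \<and> adjt t = rel es \<inter> X \<times> X"

lemma good_empty: "good K es S {} (Lf 2 0 0)"
  by (simp add: good_def)

lemma good_edge: "e < length es \<Longrightarrow> length S = K \<Longrightarrow> good K es S {(1, e)} (Lf 1 e (elab S (es ! e)))"
  using labP[of "\<lambda>s. s = fst (es ! e) \<or> s = snd (es ! e)" S] by (auto simp: good_def elab_def)

text \<open>No label equals \<open>K\<close>, so \<open>Op K\<close> neither creates links nor
  removes labels; this is right because \<open>X\<close> and \<open>Y\<close> are unrelated.\<close>

lemma good_join:
  assumes s: "good K es S X s" and t: "good K es S Y t" and "X \<inter> Y = {}" and "rel es \<inter> X \<times> Y = {}"
  shows "good K es S (X \<union> Y) (Op K s t)"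
proof -
  have "rel es \<inter> Y \<times> X = {}" using assms(4) rel_sym by blast
  moreover have "K \<notin> lab s x" if "x \<in> X" for x using s that by (auto simp: good_def)
  ultimately show ?thesis using assms by (auto simp: good_def)
qed

text \<open>With \<open>b\<close> in slot \<open>j\<close>, the label \<open>j\<close> marks the
  elements related to \<open>b\<close>, so \<open>Op j\<close> creates exactly the links between
  \<open>b\<close> and \<open>X\<close>. It then drops the label, in accordance with
  \<open>S\<close>, since nothing in \<open>X\<close> is related to the old occupant
  \<open>S ! j\<close>.\<close>

lemma good_intern:
  assumes t: "good K es (S[j := b]) X t" and S: "length S = K" and j: "j < K" and b: "(0, b) \<notin> X"
    and X: "\<And>y. y \<in> X \<Longrightarrow> (y, (0, S ! j)) \<notin> rel es" and nb: "\<not> adjb es b (S ! j)"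
    and v: "valid n es"
  shows "good K es S (insert (0, b) X) (Op j t (Lf 0 b (vlab es (S[j := n]) b)))"
proof -
  \<comment> \<open>\<open>n\<close> lies beyond all vertices and is adjacent to nothing, hence its
    use as the mark of an empty slot.\<close>
  have bb: "\<not> adjb es b b" "\<not> adjb es b n" using adjb_valid[OF v] by blast+
  have "set_decode (vlab es (S[j := n]) b) = {i. i < K \<and> adjb es b (S[j := n] ! i)}"
    using S by (simp add: vlab_def labP)
  also have "\<dots> = {i. i < K \<and> adjb es b (S ! i)}"
    using S j bb nb by (auto simp: nth_list_update)
  finally have lb: "set_decode (vlab es (S[j := n]) b) = {i. i < K \<and> adjb es b (S ! i)}" .
  have lt: "vlab es (S[j := n]) b < 2 ^ K" using labP(2)[of _ "S[j := n]"] S by (simp add: vlab_def)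
  have lab_t: "lab t x = {i. i < K \<and> (x, (0, S[j := b] ! i)) \<in> rel es}" if "x \<in> X" for x
    using t that by (simp add: good_def)
  have lab: "lab t x - {j} = {i. i < K \<and> (x, (0, S ! i)) \<in> rel es}" if "x \<in> X" for x
    unfolding lab_t[OF that] using S j X[OF that] by (auto simp: nth_list_update split: if_splits)
  have jlab: "j \<in> lab t x \<longleftrightarrow> (x, (0, b)) \<in> rel es" if "x \<in> X" for x
    unfolding lab_t[OF that] using S j by simp
  have el: "elems t = X" and ad: "adjt t = rel es \<inter> X \<times> X" and ok: "ok_term K t" "dist t"
    using t by (auto simp: good_def)
  have "adjt (Op j t (Lf 0 b (vlab es (S[j := n]) b))) = rel es \<inter> insert (0, b) X \<times> insert (0, b) X"
    using jlab bb rel_sym by (auto simp: el ad)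
  moreover have "lab (Op j t (Lf 0 b (vlab es (S[j := n]) b))) x = {i. i < K \<and> (x, (0, S ! i)) \<in> rel es}"
    if "x \<in> insert (0, b) X" for x
    using that lab b lb by (auto simp: el)
  ultimately show ?thesis
    using ok lt b j unfolding good_def by (auto simp: el)
qed

section \<open>Soundness of table entries\<close>

text \<open>The empty assignment is as good as any, because the formula to be decided is a
  sentence.\<close>

abbreviation val :: "nat \<Rightarrow> aut \<Rightarrow> trm \<Rightarrow> nat" where "val M A \<equiv> run M A (\<lambda>_ _. {})"

text \<open>Only some term is claimed to exist: which one, and so which order of the vertices,
  depends on the search. Neither elimination order nor colouring occurs.\<close>

definition sound :: "nat \<Rightarrow> aut \<Rightarrow> nat \<Rightarrow> nat \<Rightarrow> (nat \<times> nat) list \<Rightarrow> table \<Rightarrow> bool" where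
  "sound M A K n es T \<longleftrightarrow> (\<forall>S v x. ((S, v), Suc x) \<in> set T \<longrightarrow>
     (\<exists>t. good K es S (elts es (set (comp n es S v))) t \<and> val M A t = x))"

lemma lookup_in: "lookup T S v \<noteq> 0 \<Longrightarrow> ((S, v), lookup T S v) \<in> set T"
proof -
  have "foldl (\<lambda>r t. if snd (fst t) = v \<and> fst (fst t) = S then snd t else r) r T = r \<or>
    ((S, v), foldl (\<lambda>r t. if snd (fst t) = v \<and> fst (fst t) = S then snd t else r) r T) \<in> set T" for r
  proof (induction T arbitrary: r)
    case (Cons t T)
    then show ?case using Cons[of "if snd (fst t) = v \<and> fst (fst t) = S then snd t else r"]
      by (cases t) (auto split: if_splits)
  qed simp
  from this[of 0] show "lookup T S v \<noteq> 0 \<Longrightarrow> ?thesis" by (simp add: lookup_def)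
qed

text \<open>\<open>lookup\<close> returns the last matching entry, so all entries under the key have
  to be known to be nonzero.\<close>

lemma lookup_nonzero:
  assumes "((S, v), y) \<in> set T" "\<And>x. ((S, v), x) \<in> set T \<Longrightarrow> x \<noteq> 0" shows "lookup T S v \<noteq> 0"
proof -
  let ?f = "\<lambda>r t. if snd (fst t) = v \<and> fst (fst t) = S then snd t else r"
  have *: "foldl ?f r T \<noteq> 0" if "\<And>x. ((S, v), x) \<in> set T \<Longrightarrow> x \<noteq> 0" "r \<noteq> 0 \<or> (\<exists>y. ((S, v), y) \<in> set T)" for r
    using that
  proof (induction T arbitrary: r)
    case (Cons t T)
    obtain S' v' x where t: "t = ((S', v'), x)" by (cases t) auto
    show ?case
      unfolding foldl_Cons
      by (rule Cons.IH) (use Cons.prems in \<open>auto simp: t\<close>)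
  qed simp
  show ?thesis unfolding lookup_def by (rule *) (use assms in auto)
qed

text \<open>Distinct components of the graph without \<open>S\<close> share no edge, so
  concatenating their terms realises the relation on the union. The conditions on \<open>Z\<close>
  say that it is a union of components.\<close>

lemma joinall_sound:
  assumes T: "sound M A K n es T" and v: "valid n es" and S: "length S = K"
    and Z: "set Z \<subseteq> {..<n} - set S" "\<And>u. u \<in> set Z \<Longrightarrow> set (comp n es S u) \<subseteq> set Z"
    and nz: "snd (joinall A K n es T S Z) \<noteq> 0"
  shows "\<exists>t. good K es S (elts es (set Z)) t \<and> val M A t = snd (joinall A K n es T S Z) - 1"
proof -
  let ?f = "\<lambda>s u. if u \<in> set (fst s) then s else
      (filter (\<lambda>w. w \<in> set (fst s) \<or> w \<in> set (comp n es S u)) [0..<n],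
       if snd s = 0 \<or> lookup T S u = 0 then 0 else Suc (comb A K (snd s - 1) (lookup T S u - 1)))"
  \<comment> \<open>The covered set is a union of components, so a vertex outside it starts a
    component disjoint from it.\<close>
  let ?I = "\<lambda>s. set (fst s) \<subseteq> {..<n} \<and> (\<forall>x\<in>set (fst s). x \<notin> set S \<and> set (comp n es S x) \<subseteq> set (fst s)) \<and>
     (snd s \<noteq> 0 \<longrightarrow> (\<exists>t. good K es S (elts es (set (fst s))) t \<and> val M A t = snd s - 1))"
  have step: "?I (?f s u)" if I: "?I s" and u: "u < n" "u \<notin> set S" for s u
  proof (cases "u \<in> set (fst s)")
    case False
    let ?C = "set (comp n es S u)"
    have "?C \<subseteq> {..<n}" using comp_sub by blast
    moreover have "set (fst s) \<subseteq> {..<n}" using I by blast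
    moreover have "set (fst (?f s u)) = {w. w < n \<and> (w \<in> set (fst s) \<or> w \<in> ?C)}" using False by auto
    ultimately have cov: "set (fst (?f s u)) = set (fst s) \<union> ?C" by blast
    have disj: "w \<notin> ?C" if "w \<in> set (fst s)" for w
    proof
      assume "w \<in> ?C"
      then have "u \<in> set (comp n es S w)" by (rule comp_sym)
      with I that False show False by blast
    qed
    have closed: "y \<in> set (fst s)" if "x \<in> set (fst s)" "adjb es x y" "y < n" "y \<notin> set S" for x y
    proof -
      have "x < n" "x \<notin> set S" using I that by auto
      then have "y \<in> set (comp n es S x)" using comp_closed[OF comp_self] that by blast
      then show ?thesis using I that by blast
    qed
    show ?thesis
    proof (intro conjI ballI impI)
      show "set (fst (?f s u)) \<subseteq> {..<n}" using False by auto
    next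
      fix x assume x: "x \<in> set (fst (?f s u))"
      then show "x \<notin> set S" using I comp_sub unfolding cov by blast
      show "set (comp n es S x) \<subseteq> set (fst (?f s u))"
        using x I comp_mono unfolding cov by blast
    next
      assume nz: "snd (?f s u) \<noteq> 0"
      then have "snd s \<noteq> 0" and l: "lookup T S u \<noteq> 0" using False by (auto split: if_splits)
      then obtain t1 where t1: "good K es S (elts es (set (fst s))) t1" "val M A t1 = snd s - 1" using I by blast
      obtain x where x: "lookup T S u = Suc x" using l by (cases "lookup T S u") auto
      have "((S, u), Suc x) \<in> set T" using lookup_in[OF l] x by simp
      then have "\<exists>t. good K es S (elts es ?C) t \<and> val M A t = lookup T S u - 1"
        using T x unfolding sound_def by simp
      then obtain t2 where t2: "good K es S (elts es ?C) t2" "val M A t2 = lookup T S u - 1" by (elim exE conjE)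
      \<comment> \<open>An edge touching both sides would place its ends in one component; the edge
        elements are thus disjoint as well.\<close>
      have edge: False if e: "e < length es" "fst (es ! e) \<in> set (fst s) \<or> snd (es ! e) \<in> set (fst s)"
        "fst (es ! e) \<in> ?C \<or> snd (es ! e) \<in> ?C" for e
      proof -
        let ?p = "fst (es ! e)" and ?q = "snd (es ! e)"
        have "adjb es ?p ?q" "adjb es ?q ?p" using e(1) by (auto simp: adjb_iff)
        from e(3) show False
        proof
          assume p: "?p \<in> ?C"
          then have "?q \<in> set (fst s)" using e(2) disj by blast
          from closed[OF this \<open>adjb es ?q ?p\<close>] p show False using comp_sub disj by blast
        next
          assume q: "?q \<in> ?C"
          then have "?p \<in> set (fst s)" using e(2) disj by blast
          from closed[OF this \<open>adjb es ?p ?q\<close>] q show False using comp_sub disj by blast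
        qed
      qed
      have norel: "(x, y) \<notin> rel es" if x: "x \<in> elts es (set (fst s))" and y: "y \<in> elts es ?C" for x y
      proof
        assume r: "(x, y) \<in> rel es"
        show False using x
        proof (cases rule: eltsE)
          case p: (1 p)
          show False using y
          proof (cases rule: eltsE)
            case (1 q)
            then show False using r p closed[of p q] comp_sub[of q n es S u] disj[of q] by simp
          next
            case (2 e)
            then have "fst (es ! e) \<in> set (fst s) \<or> snd (es ! e) \<in> set (fst s)" using r p by auto
            then show False using edge 2 by blast
          qed
        next
          case e: (2 e)
          show False using y
          proof (cases rule: eltsE)
            case (1 q)
            then have "fst (es ! e) \<in> ?C \<or> snd (es ! e) \<in> ?C" using r e by auto
            then show False using edge e by blast
          next
            case (2 e')
            then show False using r e by simp
          qed
        qed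
      qed
      have "good K es S (elts es (set (fst s)) \<union> elts es ?C) (Op K t1 t2)"
      proof (rule good_join[OF t1(1) t2(1)])
        show d: "elts es (set (fst s)) \<inter> elts es ?C = {}"
          using disj edge by (auto elim!: eltsE)
        show "rel es \<inter> elts es (set (fst s)) \<times> elts es ?C = {}"
          using norel by auto
      qed
      then show "\<exists>t. good K es S (elts es (set (fst (?f s u)))) t \<and> val M A t = snd (?f s u) - 1"
        unfolding cov elts_Un using t1(2) t2(2) False nz by (intro exI[of _ "Op K t1 t2"]) auto
    qed
  qed (use I in simp)
  have cover_step: "set (fst s) \<union> {u} \<subseteq> set (fst (?f s u)) \<and> set (fst (?f s u)) \<subseteq> {..<n}"
    if "set (fst s) \<subseteq> {..<n}" "u < n" "u \<notin> set S" for s u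
    using that comp_self[of u n S es] by auto
  have within_step: "set (fst (?f s u)) \<subseteq> set Z" if "set (fst s) \<subseteq> set Z" "u \<in> set Z" for s u
    using that Z(2)[of u] by auto
  define f where "f = ?f"
  have step: "?I (f s u)" if "?I s" "u < n" "u \<notin> set S" for s u
    unfolding f_def by (rule step[OF that])
  have cover_step: "set (fst s) \<union> {u} \<subseteq> set (fst (f s u)) \<and> set (fst (f s u)) \<subseteq> {..<n}"
    if "set (fst s) \<subseteq> {..<n}" "u < n" "u \<notin> set S" for s u
    unfolding f_def by (rule cover_step[OF that])
  have within_step: "set (fst (f s u)) \<subseteq> set Z" if "set (fst s) \<subseteq> set Z" "u \<in> set Z" for s u
    unfolding f_def by (rule within_step[OF that])
  have covers: "set (fst s) \<union> set Z' \<subseteq> set (fst (foldl f s Z'))" if "set Z' \<subseteq> {..<n} - set S" "set (fst s) \<subseteq> {..<n}" for s Z'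
    using that
  proof (induction Z' arbitrary: s)
    case (Cons u Z')
    then have u: "u < n" "u \<notin> set S" "set Z' \<subseteq> {..<n} - set S" by auto
    note st = cover_step[OF Cons.prems(2) u(1,2)]
    have "set (fst (f s u)) \<union> set Z' \<subseteq> set (fst (foldl f (f s u) Z'))"
      by (rule Cons.IH) (use u st in auto)
    then show ?case using st by auto
  qed simp
  have within: "set (fst (foldl f s Z')) \<subseteq> set Z" if "set Z' \<subseteq> set Z" "set (fst s) \<subseteq> set Z" for s Z'
    using that
  proof (induction Z' arbitrary: s)
    case (Cons u Z')
    have "set (fst (f s u)) \<subseteq> set Z" by (rule within_step) (use Cons.prems in auto)
    then show ?case using Cons.IH[of "f s u"] Cons.prems(1) by auto
  qed simp
  have inv: "?I (foldl f s Z')" if "?I s" "set Z' \<subseteq> {..<n} - set S" for s Z'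
    using that
  proof (induction Z' arbitrary: s)
    case (Cons u Z')
    have "?I (f s u)" by (rule step) (use Cons.prems in auto)
    then show ?case using Cons.IH[of "f s u"] Cons.prems(2) by simp
  qed simp
  let ?s0 = "([], Suc (base A 2 0 0))"
  have "elts es {} = {}" by (simp add: elts_def)
  then have I: "?I (foldl f ?s0 Z)"
    by (intro inv[OF _ Z(1)]) (auto intro!: exI[of _ "Lf 2 0 0"] good_empty)
  have eq: "set (fst (foldl f ?s0 Z)) = set Z"
    using covers[OF Z(1), of ?s0] within[of Z ?s0] by auto
  have j: "joinall A K n es T S Z = foldl f ?s0 Z" by (simp add: joinall_def f_def)
  show ?thesis using I nz unfolding j eq by blast
qed

text \<open>None of the new edges has an end in \<open>C - {b}\<close>, so each is unrelated to
  everything collected before it and plain concatenation applies.\<close>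

lemma addedges_sound:
  assumes t: "good K es S (elts es (C - {b})) t" and "val M A t = x" and S: "length S = K" and C: "set C' = C"
  shows "\<exists>t'. good K es S (elts es (C - {b}) \<union> {(1, e) | e. e < length es \<and>
      (fst (es ! e) = b \<and> snd (es ! e) \<notin> C \<or> snd (es ! e) = b \<and> fst (es ! e) \<notin> C)}) t' \<and>
     val M A t' = addedges A K es S C' b x"
proof -
  let ?new = "\<lambda>e. fst (es ! e) = b \<and> snd (es ! e) \<notin> C \<or> snd (es ! e) = b \<and> fst (es ! e) \<notin> C"
  \<comment> \<open>Prefixes of \<open>es\<close> are used because an edge element is named by its
    position in the list.\<close>
  have "\<exists>t'. good K es S (elts es (C - {b}) \<union> {(1, e) | e. e < k \<and> ?new e}) t' \<and>
     val M A t' = addedges A K (take k es) S C' b x" if "k \<le> length es" for k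
    using that
  proof (induction k)
    case 0
    then show ?case using assms by (auto simp: addedges_def)
  next
    case (Suc k)
    let ?X = "elts es (C - {b}) \<union> {(1, e) | e. e < k \<and> ?new e}"
    obtain t' where t': "good K es S ?X t'" "val M A t' = addedges A K (take k es) S C' b x"
      using Suc by auto
    have take: "take (Suc k) es = take k es @ [es ! k]" using Suc.prems by (simp add: take_Suc_conv_app_nth)
    show ?case
    proof (cases "?new k")
      case True
      have g: "good K es S (?X \<union> {(1, k)}) (Op K t' (Lf 1 k (elab S (es ! k))))"
      proof (rule good_join[OF t'(1) good_edge[OF _ S]])
        show "k < length es" using Suc.prems by simp
        show "?X \<inter> {(1, k)} = {}" using True by auto
        show "rel es \<inter> ?X \<times> {(1, k)} = {}" using True by (auto elim!: eltsE)
      qed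
      have eq: "?X \<union> {(1, k)} = elts es (C - {b}) \<union> {(1, e) | e. e < Suc k \<and> ?new e}"
        using True by (auto simp: less_Suc_eq)
      have vl: "val M A (Op K t' (Lf 1 k (elab S (es ! k)))) = addedges A K (take (Suc k) es) S C' b x"
        using True t'(2) by (simp add: take addedges_def C)
      show ?thesis by (intro exI conjI, rule g[unfolded eq], rule vl)
    next
      case False
      then have eq: "{(1::nat, e) | e. e < Suc k \<and> ?new e} = {(1, e) | e. e < k \<and> ?new e}"
        by (auto simp: less_Suc_eq)
      have vl: "addedges A K (take (Suc k) es) S C' b x = addedges A K (take k es) S C' b x"
        using False by (auto simp add: take addedges_def C)
      show ?thesis unfolding eq vl using t' by (intro exI conjI)
    qed
  qed
  from this[of "length es"] show ?thesis by simp
qed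

text \<open>Once \<open>b\<close> is in the separator, the remaining components are joined, then the
  edges from \<open>b\<close> to the outside are added. These carry label \<open>j\<close>, as slot
  \<open>j\<close> holds \<open>b\<close>, so the final \<open>Op j\<close> ties the leaf of
  \<open>b\<close> to them and to everything else related to \<open>b\<close>.\<close>

lemma attempt_sound:
  assumes T: "sound M A K n es T" and v: "valid n es" and S: "length S = K" and j: "j < K"
    and a: "attempt A K n es T S v j b = Suc x"
  shows "\<exists>t. good K es S (elts es (set (comp n es S v))) t \<and> val M A t = x"
proof -
  let ?C = "set (comp n es S v)" and ?S = "S[j := b]"
  let ?Z = "filter (\<lambda>u. u \<noteq> b) (comp n es S v)"
  let ?r = "snd (joinall A K n es T ?S ?Z)"
  have b: "b \<in> ?C" and nadj: "\<And>c. c \<in> ?C \<Longrightarrow> \<not> adjb es c (S ! j)" and nz: "?r \<noteq> 0"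
    and x: "x = comb A j (addedges A K es ?S (comp n es S v) b (?r - 1)) (base A 0 (vlab es (S[j := n]) b) 0)"
    using a S j by (auto simp: attempt_def list_ex_iff look_nth split: if_splits)
  have Z: "set ?Z = ?C - {b}" by auto
  have S_sub: "set ?S \<subseteq> insert b (set S)" using set_update_subset_insert by fast
  have S_sup: "set S \<subseteq> insert (S ! j) (set ?S)"
  proof
    fix y assume "y \<in> set S"
    then obtain i where "i < length S" "S ! i = y" by (auto simp: in_set_conv_nth)
    then show "y \<in> insert (S ! j) (set ?S)"
      by (cases "i = j") (auto simp: in_set_conv_nth intro!: exI[of _ i])
  qed
  have bS: "b \<in> set ?S" using S j by (simp add: set_update_memI)
  obtain t where t: "good K es ?S (elts es (?C - {b})) t" "val M A t = ?r - 1"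
  proof -
    have "\<exists>t. good K es ?S (elts es (set ?Z)) t \<and> val M A t = ?r - 1"
    proof (rule joinall_sound[OF T v _ _ _ nz])
      show "length ?S = K" using S by simp
      show "set ?Z \<subseteq> {..<n} - set ?S" using comp_sub[of _ n es S v] S_sub by auto
      fix u assume u: "u \<in> set ?Z"
      show "set (comp n es ?S u) \<subseteq> set ?Z"
      proof (rule comp_least[OF u])
        \<comment> \<open>The two separators differ only in slot \<open>j\<close>: the new occupant
          \<open>b\<close> is forbidden, and the old one has no neighbour in the component, so no
          step leads out.\<close>
        fix y z assume yz: "y \<in> set ?Z" "adjb es y z" "z < n" "z \<notin> set ?S"
        then have "z \<noteq> b" using bS by auto
        moreover have "z \<notin> set S" using yz nadj[of y] S_sup by auto
        ultimately show "z \<in> set ?Z" using yz comp_closed[of y n es S v z] by auto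
      qed
    qed
    then show ?thesis using that unfolding Z by blast
  qed
  let ?X = "elts es (?C - {b}) \<union> {(1, e) | e. e < length es \<and>
      (fst (es ! e) = b \<and> snd (es ! e) \<notin> ?C \<or> snd (es ! e) = b \<and> fst (es ! e) \<notin> ?C)}"
  obtain t' where t': "good K es ?S ?X t'" "val M A t' = addedges A K es ?S (comp n es S v) b (?r - 1)"
    using addedges_sound[OF t, of "comp n es S v"] S by auto
  have ev: "fst (es ! e) < n \<and> snd (es ! e) < n \<and> fst (es ! e) \<noteq> snd (es ! e)
      \<and> adjb es (fst (es ! e)) (snd (es ! e)) \<and> adjb es (snd (es ! e)) (fst (es ! e))" if "e < length es" for e
    using that v by (auto simp: valid_def adjb_iff)
  have X: "insert (0, b) ?X = elts es ?C"
  proof (rule set_eqI)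
    fix z :: "nat \<times> nat"
    obtain \<kappa> i where z: "z = (\<kappa>, i)" by (cases z)
    consider "\<kappa> = 0" | "\<kappa> = 1" "i < length es" | "\<kappa> = 1" "\<not> i < length es" | "\<kappa> > 1" by linarith
    then show "z \<in> insert (0, b) ?X \<longleftrightarrow> z \<in> elts es ?C"
    proof cases
      case 2
      then show ?thesis using b ev[OF 2(2)] by (auto simp: z)
    qed (use b in \<open>auto simp: z elts_def\<close>)
  qed
  have Sj: "S ! j \<notin> ?C" using comp_sub[of "S ! j" n es S v] S j by (meson nth_mem)
  have "good K es S (insert (0, b) ?X) (Op j t' (Lf 0 b (vlab es (S[j := n]) b)))"
  proof (rule good_intern[OF t'(1) S j _ _ nadj[OF b] v])
    show "(0, b) \<notin> ?X" by auto
    fix y assume "y \<in> ?X"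
    then have "y \<in> elts es ?C" using X by blast
    then show "(y, (0, S ! j)) \<notin> rel es"
    proof (cases rule: eltsE)
      case (1 u)
      then show ?thesis using nadj by simp
    next
      case (2 e)
      then show ?thesis using ev[of e] nadj Sj by auto
    qed
  qed
  then show ?thesis unfolding X using t'(2) x by (intro exI conjI) auto
qed

section \<open>Correctness of the dynamic program\<close>

lemma foldl_first:
  fixes a :: "'x \<Rightarrow> nat"
  shows "(foldl (\<lambda>r x. if r \<noteq> 0 then r else a x) r xs \<noteq> 0 \<longleftrightarrow> r \<noteq> 0 \<or> (\<exists>x\<in>set xs. a x \<noteq> 0)) \<and>
    (foldl (\<lambda>r x. if r \<noteq> 0 then r else a x) r xs = r \<or>
      (\<exists>x\<in>set xs. foldl (\<lambda>r x. if r \<noteq> 0 then r else a x) r xs = a x))"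
proof (induction xs arbitrary: r)
  case (Cons y xs)
  show ?case using Cons.IH[of "if r \<noteq> 0 then r else a y"] by (cases "r = 0") auto
qed auto

lemma search_cases:
  fixes a :: "nat \<Rightarrow> nat \<Rightarrow> nat" and n :: nat
  defines "g \<equiv> \<lambda>r j. foldl (\<lambda>r b. if r \<noteq> 0 then r else a j b) r [0..<n]"
  shows "(foldl g r xs \<noteq> 0 \<longleftrightarrow> r \<noteq> 0 \<or> (\<exists>j\<in>set xs. \<exists>b<n. a j b \<noteq> 0)) \<and>
    (foldl g r xs = r \<or> (\<exists>j\<in>set xs. \<exists>b<n. foldl g r xs = a j b))"
proof (induction xs arbitrary: r)
  case (Cons j xs)
  have "(g r j \<noteq> 0 \<longleftrightarrow> r \<noteq> 0 \<or> (\<exists>b<n. a j b \<noteq> 0)) \<and> (g r j = r \<or> (\<exists>b<n. g r j = a j b))"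
    unfolding g_def using foldl_first[of "a j" r "[0..<n]"] by auto
  then show ?case using Cons.IH[of "g r j"] by (simp only: foldl_Cons list.set) auto
qed auto

lemma set_tuples: "set (tuples k n) = {S. length S = k \<and> set S \<subseteq> {..n}}"
proof (induction k)
  case (Suc k)
  have "set (foldl (\<lambda>a S. map (\<lambda>i. i # S) [0..<Suc n] @ a) zs xs) = {i # S | i S. i \<le> n \<and> S \<in> set xs} \<union> set zs" for zs xs
    by (induction xs arbitrary: zs) (auto simp: less_Suc_eq_le)
  then have "set (tuples (Suc k) n) = {i # S | i S. i \<le> n \<and> S \<in> set (tuples k n)}" by simp
  also have "\<dots> = {S. length S = Suc k \<and> set S \<subseteq> {..n}}"
    unfolding Suc by (auto simp: length_Suc_conv)
  finally show ?case .
qed auto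

lemma set_init: "set (init K n) = {((S, v), 0) | S v. S \<in> set (tuples K n) \<and> v < n}"
proof -
  have "set (foldl (\<lambda>a S. map (\<lambda>v. ((S, v), 0::nat)) [0..<n] @ a) zs xs) = {((S, v), 0) | S v. S \<in> set xs \<and> v < n} \<union> set zs"
    for zs and xs :: "nat list list"
    by (induction xs arbitrary: zs) auto
  then show ?thesis by (simp add: init_def)
qed

definition keyed :: "nat \<Rightarrow> nat \<Rightarrow> table \<Rightarrow> bool" where
  "keyed K n T \<longleftrightarrow> fst ` set T = {(S, v). S \<in> set (tuples K n) \<and> v < n}"

lemma keyed_init: "keyed K n (init K n)"
  by (force simp: keyed_def set_init)

lemma keyed_next_table: "keyed K n T \<Longrightarrow> keyed K n (next_table A K n es T)"
  by (auto simp: keyed_def next_table_def image_image)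

lemma next_table_entry:
  "((S, v), y) \<in> set (next_table A K n es T) \<longleftrightarrow>
     (\<exists>z. ((S, v), z) \<in> set T \<and> y = (if z = 0 then search A K n es T S v else z))"
proof
  assume "((S, v), y) \<in> set (next_table A K n es T)"
  then obtain t where t: "((S, v), y) = (fst t, if snd t = 0 then search A K n es T (fst (fst t)) (snd (fst t)) else snd t)"
    "t \<in> set T" unfolding next_table_def set_map by (rule imageE)
  obtain k z where kz: "t = (k, z)" by (cases t)
  show "\<exists>z. ((S, v), z) \<in> set T \<and> y = (if z = 0 then search A K n es T S v else z)"
    using t unfolding kz by (intro exI[of _ z]) auto
next
  assume "\<exists>z. ((S, v), z) \<in> set T \<and> y = (if z = 0 then search A K n es T S v else z)"
  then obtain z where "((S, v), z) \<in> set T" "y = (if z = 0 then search A K n es T S v else z)" by blast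
  then show "((S, v), y) \<in> set (next_table A K n es T)"
    unfolding next_table_def set_map by (intro image_eqI[of _ _ "((S, v), z)"]) simp_all
qed

lemma search_sound:
  assumes T: "sound M A K n es T" and v: "valid n es" and S: "length S = K"
    and a: "search A K n es T S v = Suc x"
  shows "\<exists>t. good K es S (elts es (set (comp n es S v))) t \<and> val M A t = x"
proof -
  have "search A K n es T S v \<noteq> 0" using a by simp
  then obtain j b where "j < K" "attempt A K n es T S v j b = Suc x"
    using search_cases[where a="attempt A K n es T S v" and r=0 and n=n and xs="[0..<K]"] a
    unfolding search_def by auto
  then show ?thesis using attempt_sound[OF T v S] by blast
qed

lemma sound_next_table:
  assumes T: "sound M A K n es T" and v: "valid n es" and k: "keyed K n T"
  shows "sound M A K n es (next_table A K n es T)"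
  unfolding sound_def
proof (intro allI impI)
  fix S v' x assume "((S, v'), Suc x) \<in> set (next_table A K n es T)"
  then obtain z where z: "((S, v'), z) \<in> set T" "Suc x = (if z = 0 then search A K n es T S v' else z)"
    unfolding next_table_entry by blast
  have "(S, v') \<in> fst ` set T" using z(1) by force
  then have S: "length S = K" using k set_tuples unfolding keyed_def by auto
  show "\<exists>t. good K es S (elts es (set (comp n es S v'))) t \<and> val M A t = x"
  proof (cases "z = 0")
    case True
    then show ?thesis using search_sound[OF T v S, of v' x] z(2) by simp
  next
    case False
    then show ?thesis using T z unfolding sound_def by simp
  qed
qed

lemma table_sound:
  assumes "valid n es"
  shows "sound M A K n es (foldl (\<lambda>T _. next_table A K n es T) (init K n) [0..<r]) \<and>
    keyed K n (foldl (\<lambda>T _. next_table A K n es T) (init K n) [0..<r])"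
proof (induction r)
  case 0
  then show ?case by (auto simp: sound_def set_init keyed_init)
next
  case (Suc r)
  then show ?case using sound_next_table[OF _ assms] keyed_next_table by simp
qed

lemma joinall_nonzero:
  assumes "\<And>u. u \<in> set Z \<Longrightarrow> lookup T S u \<noteq> 0"
  shows "snd (joinall A K n es T S Z) \<noteq> 0"
proof -
  let ?f = "\<lambda>s u. if u \<in> set (fst s) then s else
      (filter (\<lambda>w. w \<in> set (fst s) \<or> w \<in> set (comp n es S u)) [0..<n],
       if snd s = 0 \<or> lookup T S u = 0 then 0 else Suc (comb A K (snd s - 1) (lookup T S u - 1)))"
  have "snd s \<noteq> 0 \<Longrightarrow> snd (foldl ?f s Z) \<noteq> 0" for s
    using assms
  proof (induction Z arbitrary: s)
    case (Cons u Z)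
    have "snd (?f s u) \<noteq> 0" using Cons.prems(1) Cons.prems(2)[of u] by simp
    then show ?case using Cons.IH[of "?f s u"] Cons.prems(2) by simp
  qed simp
  from this[of "([], Suc (base A 2 0 0))"] show ?thesis by (simp add: joinall_def)
qed

section \<open>Completeness from the elimination certificate\<close>

text \<open>The first vertex \<open>c0\<close> of \<open>C\<close> can be deleted: its later
  neighbours are pairwise adjacent, so neither the connectedness of the piece nor its contact with
  \<open>w\<close> is lost. Repeating this leaves \<open>{u}\<close>, and then \<open>u\<close> is
  the neighbour of \<open>w\<close>. It is needed for separator vertices that touch a
  component.\<close>

lemma chordal_max:
  assumes "finite C" "u \<in> C" "\<And>x. x \<in> C \<Longrightarrow> (u, x) \<in> (F \<inter> C \<times> C)\<^sup>*" "inj_on \<rho> C"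
    and "\<And>x. x \<in> C \<Longrightarrow> \<rho> x \<le> \<rho> u" "c \<in> C" "(w, c) \<in> F" "w \<notin> C" "(\<rho> u :: nat) < \<rho> w"
    and sym: "\<And>x y. (x, y) \<in> F \<Longrightarrow> (y, x) \<in> F" and irr: "\<And>x. (x, x) \<notin> F"
    and chord: "\<And>x y z. (x, y) \<in> F \<Longrightarrow> (x, z) \<in> F \<Longrightarrow> \<rho> x < \<rho> y \<Longrightarrow> \<rho> x < \<rho> z \<Longrightarrow> y \<noteq> z \<Longrightarrow> (y, z) \<in> F"
  shows "(w, u) \<in> F"
  using assms(1-9)
proof (induction "card C" arbitrary: C c rule: less_induct)
  case less
  show ?case
  proof (cases "C = {u}")
    case True
    then show ?thesis using less.prems by simp
  next
    case False
    let ?D = "C - {u}"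
    have "?D \<noteq> {}" "finite ?D" using False less.prems by auto
    then have "Min (\<rho> ` ?D) \<in> \<rho> ` ?D" by (intro Min_in) auto
    then obtain c0 where m: "Min (\<rho> ` ?D) = \<rho> c0" and c0: "c0 \<in> ?D" by (rule imageE)
    have le: "\<rho> c0 \<le> \<rho> x" if "x \<in> ?D" for x
      using m that \<open>finite ?D\<close> Min_le[of "\<rho> ` ?D" "\<rho> x"] by simp
    have lt: "\<rho> c0 < \<rho> x" if "x \<in> C" "x \<noteq> c0" for x
    proof -
      have "\<rho> x \<noteq> \<rho> c0" using inj_onD[OF less.prems(4)] c0 that by blast
      moreover have "\<rho> c0 \<le> \<rho> x" using le less.prems(5) c0 that by (cases "x = u") auto
      ultimately show ?thesis by linarith
    qed
    let ?C = "C - {c0}"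
    have uC: "u \<in> ?C" using less.prems(2) c0 by auto
    \<comment> \<open>At the deleted vertex the invariant speaks of its neighbours instead: once one
      of them is reached all are, because they form a clique.\<close>
    have conn: "(x \<noteq> c0 \<longrightarrow> (u, x) \<in> (F \<inter> ?C \<times> ?C)\<^sup>*) \<and>
        (x = c0 \<longrightarrow> (\<forall>z\<in>?C. (c0, z) \<in> F \<longrightarrow> (u, z) \<in> (F \<inter> ?C \<times> ?C)\<^sup>*))"
      if "(u, x) \<in> (F \<inter> C \<times> C)\<^sup>*" for x
      using that
    proof (induction rule: rtrancl_induct)
      case base
      then show ?case using uC by auto
    next
      case (step x y)
      then have xy: "(x, y) \<in> F" "x \<in> C" "y \<in> C" "x \<noteq> y" using irr by auto
      show ?case
      proof (cases "y = c0")
        case True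
        have "(u, z) \<in> (F \<inter> ?C \<times> ?C)\<^sup>*" if z: "z \<in> ?C" "(c0, z) \<in> F" for z
        proof (cases "z = x")
          case True
          then show ?thesis using step.IH xy \<open>y = c0\<close> by simp
        next
          case False
          have "(x, z) \<in> F"
            by (rule chord[of c0 x z]) (use xy True z lt[of x] lt[of z] False sym in auto)
          then have "(x, z) \<in> F \<inter> ?C \<times> ?C" using xy True z by auto
          moreover have "(u, x) \<in> (F \<inter> ?C \<times> ?C)\<^sup>*" using step.IH xy True by simp
          ultimately show ?thesis by (rule rtrancl_into_rtrancl[rotated])
        qed
        then show ?thesis using True by simp
      next
        case y: False
        show ?thesis
        proof (cases "x = c0")
          case True
          then show ?thesis using step.IH xy y by simp
        next
          case False
          then have 1: "(x, y) \<in> F \<inter> ?C \<times> ?C" using xy y by auto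
          have "(u, x) \<in> (F \<inter> ?C \<times> ?C)\<^sup>*" using step.IH False by simp
          from rtrancl_into_rtrancl[OF this 1] show ?thesis using y by blast
        qed
      qed
    qed
    \<comment> \<open>If \<open>w\<close> touched the deleted vertex, it also touches a remaining
      neighbour of that vertex, by the same clique.\<close>
    obtain c' where c': "c' \<in> ?C" "(w, c') \<in> F"
    proof (cases "c = c0")
      case False
      then show ?thesis using that less.prems(6,7) by auto
    next
      case True
      have "(u, c0) \<in> (F \<inter> C \<times> C)\<^sup>*" using less.prems(3) c0 by auto
      then obtain x where x: "(x, c0) \<in> F" "x \<in> C"
        using c0 by (cases rule: rtranclE) auto
      then have xc: "x \<noteq> c0" using irr by auto
      have "\<rho> c0 < \<rho> w" using less.prems(5,9) c0 by (meson DiffD1 le_less_trans)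
      then have "(w, x) \<in> F"
        using True xc x less.prems lt[of x] sym by (intro chord[of c0 w x]) auto
      then show ?thesis using that[of x] x xc by auto
    qed
    show ?thesis
    proof (rule less.hyps[of ?C c'])
      show "card ?C < card C" using c0 less.prems(1) by (intro psubset_card_mono) auto
      show "(u, x) \<in> (F \<inter> ?C \<times> ?C)\<^sup>*" if "x \<in> ?C" for x using conn less.prems(3) that by blast
      show "inj_on \<rho> ?C" using less.prems(4) by (rule inj_on_subset) auto
    qed (use less.prems uC c' in auto)
  qed
qed

definition icert :: "nat \<Rightarrow> nat \<Rightarrow> (nat \<times> nat) list \<Rightarrow> (nat \<Rightarrow> nat) \<Rightarrow> (nat \<Rightarrow> nat) \<Rightarrow> (nat \<times> nat) set \<Rightarrow> bool" where
  "icert K n es \<rho> \<chi> F \<longleftrightarrow> inj_on \<rho> {..<n} \<and> (\<forall>v<n. \<chi> v < K) \<and> sym F \<and>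
     (\<forall>u v. adjb es u v \<longrightarrow> (u, v) \<in> F) \<and> (\<forall>u v. (u, v) \<in> F \<longrightarrow> \<chi> u \<noteq> \<chi> v) \<and>
     (\<forall>u v w. (u, v) \<in> F \<longrightarrow> (u, w) \<in> F \<longrightarrow> \<rho> u < \<rho> v \<longrightarrow> \<rho> u < \<rho> w \<longrightarrow> v \<noteq> w \<longrightarrow> (v, w) \<in> F)"

text \<open>The pairs \<open>(S, v)\<close> met when the certificate is followed from the root: every neighbour of
  the component in \<open>S\<close> sits in the slot of its colour and is eliminated later than the component.\<close>

definition compat :: "nat \<Rightarrow> nat \<Rightarrow> (nat \<times> nat) list \<Rightarrow> (nat \<Rightarrow> nat) \<Rightarrow> (nat \<Rightarrow> nat) \<Rightarrow> nat list \<Rightarrow> nat \<Rightarrow> bool" where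
  "compat K n es \<rho> \<chi> S v \<longleftrightarrow> (\<forall>i<K. \<forall>c\<in>set (comp n es S v). adjb es c (S ! i) \<longrightarrow>
     \<chi> (S ! i) = i \<and> (\<forall>x\<in>set (comp n es S v). \<rho> x < \<rho> (S ! i)))"

text \<open>A path avoiding \<open>S[j := b]\<close> could leave the old component only through the
  vacated \<open>S ! j\<close>, to which no vertex of the component is adjacent.\<close>

lemma comp_shrink:
  assumes u: "u \<in> set (comp n es S v)" "u \<noteq> b" and j: "j < length S"
    and nadj: "\<And>c. c \<in> set (comp n es S v) \<Longrightarrow> \<not> adjb es c (S ! j)"
  shows "set (comp n es (S[j := b]) u) \<subseteq> set (comp n es S v) - {b}"
proof (rule comp_least)
  show "u \<in> set (comp n es S v) - {b}" using u by simp
  fix y z assume yz: "y \<in> set (comp n es S v) - {b}" "adjb es y z" "z < n" "z \<notin> set (S[j := b])"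
  have "z \<noteq> b" using yz(4) j by (auto simp: set_update_memI)
  moreover have "z \<notin> set S"
  proof
    assume "z \<in> set S"
    then obtain i where i: "i < length S" "S ! i = z" by (auto simp: in_set_conv_nth)
    then have "i \<noteq> j" using nadj[of y] yz by auto
    then have "S[j := b] ! i = z" using i by simp
    then show False using yz(4) i by (metis length_list_update nth_mem)
  qed
  ultimately show "z \<in> set (comp n es S v) - {b}" using yz comp_closed[of y n es S v z] by auto
qed

text \<open>The component is opened at its vertex \<open>u\<close> of highest rank, which takes the
  slot of its colour. All vertices of the smaller components precede \<open>u\<close>, so
  \<open>compat\<close> holds for the new slot, and it is inherited for the others.\<close>

lemma attempt_complete:
  assumes cert: "icert K n es \<rho> \<chi> F" and S: "length S = K" "set S \<subseteq> {..n}" and v: "v < n" "v \<notin> set S"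
    and val: "valid n es" and com: "compat K n es \<rho> \<chi> S v"
    and T: "\<And>S' x. length S' = K \<Longrightarrow> set S' \<subseteq> {..n} \<Longrightarrow> x < n \<Longrightarrow> x \<notin> set S' \<Longrightarrow> compat K n es \<rho> \<chi> S' x \<Longrightarrow>
      card (set (comp n es S' x)) < card (set (comp n es S v)) \<Longrightarrow> lookup T S' x \<noteq> 0"
  shows "\<exists>j<K. \<exists>b<n. attempt A K n es T S v j b \<noteq> 0"
proof -
  let ?C = "set (comp n es S v)"
  have inj: "inj_on \<rho> {..<n}" and col: "\<And>v. v < n \<Longrightarrow> \<chi> v < K" and sym: "\<And>u v. (u, v) \<in> F \<Longrightarrow> (v, u) \<in> F"
    and adjF: "\<And>u v. adjb es u v \<Longrightarrow> (u, v) \<in> F" and proper: "\<And>u v. (u, v) \<in> F \<Longrightarrow> \<chi> u \<noteq> \<chi> v"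
    and chord: "\<And>u v w. (u, v) \<in> F \<Longrightarrow> (u, w) \<in> F \<Longrightarrow> \<rho> u < \<rho> v \<Longrightarrow> \<rho> u < \<rho> w \<Longrightarrow> v \<noteq> w \<Longrightarrow> (v, w) \<in> F"
    using cert unfolding icert_def sym_def by blast+
  have ne: "?C \<noteq> {}" using comp_self[OF v, of es] by auto
  then have "Max (\<rho> ` ?C) \<in> \<rho> ` ?C" by (intro Max_in) auto
  then obtain u where m: "Max (\<rho> ` ?C) = \<rho> u" and u: "u \<in> ?C" by (rule imageE)
  have umax: "\<rho> x \<le> \<rho> u" if "x \<in> ?C" for x
    using m that Max_ge[of "\<rho> ` ?C" "\<rho> x"] by simp
  have un: "u < n" using comp_sub[OF u] by simp
  have injC: "inj_on \<rho> ?C" using inj comp_sub by (meson inj_on_subset lessThan_iff subsetI)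
  let ?j = "\<chi> u"
  have j: "?j < K" using col un by blast
  have conn: "(u, x) \<in> (F \<inter> ?C \<times> ?C)\<^sup>*" if "x \<in> ?C" for x
  proof -
    have "set (comp n es S u) \<subseteq> {x \<in> ?C. (u, x) \<in> (F \<inter> ?C \<times> ?C)\<^sup>*}"
    proof (rule comp_least)
      show "u \<in> {x \<in> ?C. (u, x) \<in> (F \<inter> ?C \<times> ?C)\<^sup>*}" using u by simp
      fix x y assume x: "x \<in> {x \<in> ?C. (u, x) \<in> (F \<inter> ?C \<times> ?C)\<^sup>*}" and y: "adjb es x y" "y < n" "y \<notin> set S"
      have yC: "y \<in> ?C" using comp_closed[of x n es S v y] x y by simp
      then have "(x, y) \<in> F \<inter> ?C \<times> ?C" using x adjF[OF y(1)] by simp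
      then show "y \<in> {x \<in> ?C. (u, x) \<in> (F \<inter> ?C \<times> ?C)\<^sup>*}"
        using x yC by (auto intro: rtrancl_into_rtrancl)
    qed
    then show ?thesis using comp_eq[OF u] that by blast
  qed
  \<comment> \<open>An occupant of slot \<open>\<chi> u\<close> that touches the component has
    colour \<open>\<chi> u\<close> by \<open>compat\<close>; by \<open>chordal_max\<close> it is
    adjacent to \<open>u\<close> in \<open>F\<close>, against the proper colouring.\<close>
  have nadj: "\<not> adjb es c (S ! ?j)" if c: "c \<in> ?C" for c
  proof
    assume ad: "adjb es c (S ! ?j)"
    have "\<chi> (S ! ?j) = ?j" and lt: "\<rho> u < \<rho> (S ! ?j)" using com c ad j u by (auto simp: compat_def)
    moreover have "(S ! ?j, u) \<in> F"
    proof (rule chordal_max[OF _ u conn injC umax c _ _ lt sym _ chord])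
      show "(S ! ?j, c) \<in> F" using ad adjF adjb_sym by blast
      show "S ! ?j \<notin> ?C" using comp_sub[of "S ! ?j" n es S v] j S(1) by (meson nth_mem)
      show "(x, x) \<notin> F" for x using proper by blast
    qed auto
    ultimately show False using proper by blast
  qed
  let ?S = "S[?j := u]" and ?Z = "filter (\<lambda>x. x \<noteq> u) (comp n es S v)"
  have "lookup T ?S x \<noteq> 0" if x: "x \<in> set ?Z" for x
  proof (rule T)
    have shrink: "set (comp n es ?S x) \<subseteq> ?C - {u}"
      using x j S(1) by (intro comp_shrink nadj) auto
    have sub: "set ?S \<subseteq> insert u (set S)" using set_update_subset_insert by fast
    show "length ?S = K" using S by simp
    show "set ?S \<subseteq> {..n}" using sub S(2) un by auto
    show "x < n" using x comp_sub by auto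
    show "x \<notin> set ?S" using sub x comp_sub[of x n es S v] by auto
    show "card (set (comp n es ?S x)) < card ?C"
      using shrink u by (intro psubset_card_mono) auto
    show "compat K n es \<rho> \<chi> ?S x"
      unfolding compat_def
    proof (intro allI ballI impI)
      fix i c assume i: "i < K" and c: "c \<in> set (comp n es ?S x)" and ad: "adjb es c (?S ! i)"
      show "\<chi> (?S ! i) = i \<and> (\<forall>y\<in>set (comp n es ?S x). \<rho> y < \<rho> (?S ! i))"
      proof (cases "i = ?j")
        case True
        have "\<rho> y < \<rho> u" if "y \<in> set (comp n es ?S x)" for y
        proof -
          have "y \<in> ?C" "y \<noteq> u" using shrink that by auto
          then show ?thesis using umax[of y] inj_onD[OF injC, of y u] u by linarith
        qed
        then show ?thesis using True j S(1) by simp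
      next
        case False
        then have "?S ! i = S ! i" by simp
        then show ?thesis using com i c ad shrink unfolding compat_def by auto
      qed
    qed
  qed
  then have "snd (joinall A K n es T ?S ?Z) \<noteq> 0" by (rule joinall_nonzero)
  then have "attempt A K n es T S v ?j u \<noteq> 0"
    using u nadj j S(1) by (simp add: attempt_def list_ex_iff look_nth)
  then show ?thesis using j un by blast
qed

text \<open>Opening a component with at most \<open>r + 1\<close> vertices consults only smaller
  ones, settled one round before. Round 0 is vacuous, as \<open>v\<close> lies outside
  \<open>S\<close> and its component is nonempty.\<close>

lemma table_complete:
  assumes cert: "icert K n es \<rho> \<chi> F" and val: "valid n es"
    and "((S, v), y) \<in> set (foldl (\<lambda>T _. next_table A K n es T) (init K n) [0..<r])"
    and "v \<notin> set S" "compat K n es \<rho> \<chi> S v" "card (set (comp n es S v)) \<le> r"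
  shows "y \<noteq> 0"
  using assms(3-6)
proof (induction r arbitrary: S v y)
  case 0
  then have "v < n" by (auto simp: set_init)
  then have "v \<in> set (comp n es S v)" using comp_self 0 by blast
  then show ?case using 0 by auto
next
  case (Suc r)
  let ?T = "foldl (\<lambda>T _. next_table A K n es T) (init K n) [0..<r]"
  have k: "keyed K n ?T" using table_sound[OF val] by blast
  obtain z where z: "((S, v), z) \<in> set ?T" "y = (if z = 0 then search A K n es ?T S v else z)"
    using Suc.prems(1) next_table_entry[of S v y A K n es ?T] by auto
  have "(S, v) \<in> fst ` set ?T" using z(1) by force
  then have S: "length S = K" "set S \<subseteq> {..n}" "v < n" using k by (auto simp: keyed_def set_tuples)
  have "\<exists>j<K. \<exists>b<n. attempt A K n es ?T S v j b \<noteq> 0"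
  proof (rule attempt_complete[OF cert S(1,2,3) Suc.prems(2) val Suc.prems(3)])
    fix S' x assume a: "length S' = K" "set S' \<subseteq> {..n}" "x < n" "x \<notin> set S'" "compat K n es \<rho> \<chi> S' x"
      "card (set (comp n es S' x)) < card (set (comp n es S v))"
    have "(S', x) \<in> fst ` set ?T" using a k by (auto simp: keyed_def set_tuples)
    then obtain w where "((S', x), w) \<in> set ?T" by force
    then show "lookup ?T S' x \<noteq> 0"
    proof (rule lookup_nonzero)
      show "w' \<noteq> 0" if "((S', x), w') \<in> set ?T" for w'
        using Suc.IH[OF that a(4,5)] a(6) Suc.prems(4) by linarith
    qed
  qed
  then have "search A K n es ?T S v \<noteq> 0"
    using search_cases[where a="attempt A K n es ?T S v" and r=0 and n=n and xs="[0..<K]"]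
    unfolding search_def by auto
  then show ?case using z(2) by simp
qed

lemma decide_correct:
  assumes cert: "icert K n es \<rho> \<chi> F" and v: "valid n es"
  shows "\<exists>t. good K es (map (\<lambda>_. n) [0..<K]) (elts es {..<n}) t \<and> (decide A K n es \<longleftrightarrow> look (acc A) (val M A t))"
proof -
  let ?T = "table A K n es" and ?S = "map (\<lambda>_. n) [0..<K]"
  have s: "sound M A K n es ?T" and k: "keyed K n ?T" using table_sound[OF v] by (auto simp: table_def)
  have S: "length ?S = K" "set ?S \<subseteq> {n}" by auto
  have nS: "u \<notin> set ?S" if "u < n" for u using that by auto
  have "lookup ?T ?S u \<noteq> 0" if u: "u \<in> set [0..<n]" for u
  proof -
    have "(?S, u) \<in> fst ` set ?T" using u S k unfolding keyed_def set_tuples by auto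
    then obtain w where "((?S, u), w) \<in> set ?T" by force
    then show ?thesis
    proof (rule lookup_nonzero)
      have "set (comp n es ?S u) \<subseteq> {..<n}" using comp_sub by blast
      then have c: "card (set (comp n es ?S u)) \<le> n" using card_mono[of "{..<n}"] by fastforce
      \<comment> \<open>The mark \<open>n\<close> is adjacent to nothing, so with all slots empty
        there is nothing to check.\<close>
      have com: "compat K n es \<rho> \<chi> ?S u"
        using adjb_valid[OF v] by (fastforce simp: compat_def)
      show "w' \<noteq> 0" if "((?S, u), w') \<in> set ?T" for w'
        using table_complete[OF cert v that[unfolded table_def] _ com c] nS u by auto
    qed
  qed
  then have nz: "snd (joinall A K n es ?T ?S [0..<n]) \<noteq> 0" by (rule joinall_nonzero)
  have "\<exists>t. good K es ?S (elts es (set [0..<n])) t \<and> val M A t = snd (joinall A K n es ?T ?S [0..<n]) - 1"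
  proof (rule joinall_sound[OF s v S(1) _ _ nz])
    show "set [0..<n] \<subseteq> {..<n} - set ?S" by auto
    show "set (comp n es ?S u) \<subseteq> set [0..<n]" for u using comp_sub by fastforce
  qed
  moreover have "set [0..<n] = {..<n}" by auto
  ultimately show ?thesis unfolding decide_def total_def by metis
qed

section \<open>Running time\<close>

named_theorems poly_rules

lemma PC_Suc [poly_rules]: "PC b D Z f \<Longrightarrow> PC b D Z (\<lambda>x. Suc (f x))"
  using PC_add[OF _ PC_const[of b D Z 1]] by simp

text \<open>Functions of several arguments are treated as functions of nested pairs; these rules
  supply a separate function for each argument.\<close>

lemma PC_comp2:
  assumes "PC True E W (\<lambda>y. h (fst y) (snd y))" "PC True D Z f" "PC True D Z g"
    "\<And>x. D x \<Longrightarrow> E (f x, g x)" "\<And>x. D x \<Longrightarrow> W (f x, g x) \<le> Z x"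
  shows "PC True D Z (\<lambda>x. h (f x) (g x))"
  using PC_comp[OF PC_Pair[OF assms(2,3)] assms(1)] assms(4,5) by simp

lemma PC_comp3:
  assumes "PC True E W (\<lambda>y. h (fst y) (fst (snd y)) (snd (snd y)))" "PC True D Z f" "PC True D Z g" "PC True D Z k"
    "\<And>x. D x \<Longrightarrow> E (f x, g x, k x)" "\<And>x. D x \<Longrightarrow> W (f x, g x, k x) \<le> Z x"
  shows "PC True D Z (\<lambda>x. h (f x) (g x) (k x))"
  using PC_comp[OF PC_Pair[OF assms(2) PC_Pair[OF assms(3,4)]] assms(1)] assms(5,6) by simp

lemma PC_comp4:
  assumes "PC True E W (\<lambda>y. h (fst y) (fst (snd y)) (fst (snd (snd y))) (snd (snd (snd y))))"
    "PC True D Z f" "PC True D Z g" "PC True D Z k" "PC True D Z l"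
    "\<And>x. D x \<Longrightarrow> E (f x, g x, k x, l x)" "\<And>x. D x \<Longrightarrow> W (f x, g x, k x, l x) \<le> Z x"
  shows "PC True D Z (\<lambda>x. h (f x) (g x) (k x) (l x))"
  using PC_comp[OF PC_Pair[OF assms(2) PC_Pair[OF assms(3) PC_Pair[OF assms(4,5)]]] assms(1)] assms(6,7) by simp

lemma PC_comp5:
  assumes "PC True E W (\<lambda>y. h (fst y) (fst (snd y)) (fst (snd (snd y))) (fst (snd (snd (snd y)))) (snd (snd (snd (snd y)))))"
    "PC True D Z f" "PC True D Z g" "PC True D Z k" "PC True D Z l" "PC True D Z m"
    "\<And>x. D x \<Longrightarrow> E (f x, g x, k x, l x, m x)" "\<And>x. D x \<Longrightarrow> W (f x, g x, k x, l x, m x) \<le> Z x"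
  shows "PC True D Z (\<lambda>x. h (f x) (g x) (k x) (l x) (m x))"
  using PC_comp[OF PC_Pair[OF assms(2) PC_Pair[OF assms(3) PC_Pair[OF assms(4) PC_Pair[OF assms(5,6)]]]] assms(1)] assms(7,8) by simp

lemma PC_comp6:
  assumes "PC True E W (\<lambda>y. h (fst y) (fst (snd y)) (fst (snd (snd y))) (fst (snd (snd (snd y)))) (fst (snd (snd (snd (snd y))))) (snd (snd (snd (snd (snd y))))))"
    "PC True D Z f" "PC True D Z g" "PC True D Z k" "PC True D Z l" "PC True D Z m" "PC True D Z q"
    "\<And>x. D x \<Longrightarrow> E (f x, g x, k x, l x, m x, q x)" "\<And>x. D x \<Longrightarrow> W (f x, g x, k x, l x, m x, q x) \<le> Z x"
  shows "PC True D Z (\<lambda>x. h (f x) (g x) (k x) (l x) (m x) (q x))"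
  using PC_comp[OF PC_Pair[OF assms(2) PC_Pair[OF assms(3) PC_Pair[OF assms(4) PC_Pair[OF assms(5) PC_Pair[OF assms(6,7)]]]]] assms(1)] assms(8,9) by simp

section \<open>Polynomial bounds for the dynamic program\<close>

lemma PC_adjb0: "PC True (\<lambda>_. True) (\<lambda>y. length (fst y)) (\<lambda>y. adjb (fst y) (fst (snd y)) (snd (snd y)))"
  unfolding adjb_def by (intro PC_rules) simp_all

lemma PC_adjb [poly_rules]: "PC True D Z f \<Longrightarrow> PC True D Z g \<Longrightarrow> PC True D Z k \<Longrightarrow>
    (\<And>x. D x \<Longrightarrow> length (f x) \<le> Z x) \<Longrightarrow> PC True D Z (\<lambda>x. adjb (f x) (g x) (k x))"
  by (rule PC_comp3[OF PC_adjb0]) simp_all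

lemma length_reach: "length (reach n es S v C) \<le> n"
  unfolding reach_def using length_filter_le[of _ "[0..<n]"] by (metis diff_zero length_upt)

lemma length_comp: "length (comp n es S v) \<le> n"
proof (cases n)
  case (Suc m)
  then show ?thesis using length_reach by (simp add: comp_def)
qed (simp add: comp_def)

lemma PC_reach0: "PC True (\<lambda>_. True) (\<lambda>y. fst y + length (fst (snd y)) + length (fst (snd (snd y))) + length (snd (snd (snd (snd y)))))
    (\<lambda>y. reach (fst y) (fst (snd y)) (fst (snd (snd y))) (fst (snd (snd (snd y)))) (snd (snd (snd (snd y)))))"
  unfolding reach_def by (intro PC_rules poly_rules) simp_all

lemma PC_reach [poly_rules]: "PC True D Z f \<Longrightarrow> PC True D Z g \<Longrightarrow> PC True D Z k \<Longrightarrow> PC True D Z l \<Longrightarrow> PC True D Z m \<Longrightarrow>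
    (\<And>x. D x \<Longrightarrow> f x + length (g x) + length (k x) + length (m x) \<le> Z x) \<Longrightarrow>
    PC True D Z (\<lambda>x. reach (f x) (g x) (k x) (l x) (m x))"
  by (rule PC_comp5[OF PC_reach0]) simp_all

lemma PC_comp0: "PC True (\<lambda>_. True) (\<lambda>y. 2 * fst y + length (fst (snd y)) + length (fst (snd (snd y))))
    (\<lambda>y. comp (fst y) (fst (snd y)) (fst (snd (snd y))) (snd (snd (snd y))))"
  unfolding comp_def
  \<comment> \<open>The current list never exceeds \<open>n\<close> entries, so \<open>n\<close>
    enters the measure twice: as the range searched by \<open>reach\<close> and as the bound on its
    last argument.\<close>
  by (rule PC_foldl[where I="\<lambda>x C. length C \<le> fst x"]; (intro PC_rules poly_rules)?) (simp_all add: length_reach)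

lemma PC_comp' [poly_rules]: "PC True D Z f \<Longrightarrow> PC True D Z g \<Longrightarrow> PC True D Z k \<Longrightarrow> PC True D Z l \<Longrightarrow>
    (\<And>x. D x \<Longrightarrow> 2 * f x + length (g x) + length (k x) \<le> Z x) \<Longrightarrow> PC True D Z (\<lambda>x. comp (f x) (g x) (k x) (l x))"
  by (rule PC_comp4[OF PC_comp0]) simp_all

lemma PC_vlab0: "PC True (\<lambda>_. True) (\<lambda>y. length (fst y) + length (fst (snd y)))
    (\<lambda>y. vlab (fst y) (fst (snd y)) (snd (snd y)))"
  unfolding vlab_def labP_def by (intro PC_rules poly_rules) simp_all

lemma PC_vlab [poly_rules]: "PC True D Z f \<Longrightarrow> PC True D Z g \<Longrightarrow> PC True D Z k \<Longrightarrow>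
    (\<And>x. D x \<Longrightarrow> length (f x) + length (g x) \<le> Z x) \<Longrightarrow> PC True D Z (\<lambda>x. vlab (f x) (g x) (k x))"
  by (rule PC_comp3[OF PC_vlab0]) simp_all

lemma PC_elab0: "PC True (\<lambda>_. True) (\<lambda>y. length (fst y)) (\<lambda>y. elab (fst y) (snd y))"
  unfolding elab_def labP_def by (intro PC_rules poly_rules) simp_all

lemma PC_elab [poly_rules]: "PC True D Z f \<Longrightarrow> PC True D Z g \<Longrightarrow>
    (\<And>x. D x \<Longrightarrow> length (f x) \<le> Z x) \<Longrightarrow> PC True D Z (\<lambda>x. elab (f x) (g x))"
  by (rule PC_comp2[OF PC_elab0]) simp_all

lemma PC_lookup0: "PC True (\<lambda>_. True) (\<lambda>y. length (fst y) + length (fst (snd y)))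
    (\<lambda>y. lookup (fst y) (fst (snd y)) (snd (snd y)))"
  \<comment> \<open>The comparison of lists traverses its left side; the equation is turned round
    because only \<open>S\<close>, not the keys in the table, has a known length here.\<close>
  unfolding lookup_def eq_commute[of "fst (fst _)" "_ :: nat list"] by (intro PC_rules poly_rules) simp_all

lemma PC_lookup [poly_rules]: "PC True D Z f \<Longrightarrow> PC True D Z g \<Longrightarrow> PC True D Z k \<Longrightarrow>
    (\<And>x. D x \<Longrightarrow> length (f x) + length (g x) \<le> Z x) \<Longrightarrow> PC True D Z (\<lambda>x. lookup (f x) (g x) (k x))"
  by (rule PC_comp3[OF PC_lookup0]) simp_all

text \<open>Sizes of the tables, large enough to bound also the junk lists \<open>look\<close> returns outside the table.\<close>

definition table_size2 :: "nat list list \<Rightarrow> nat" where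
  "table_size2 l = length l + sum_list (map length l) + length (hd [] :: nat list)"

definition table_size3 :: "nat list list list \<Rightarrow> nat" where
  "table_size3 l = length l + sum_list (map table_size2 l) + table_size2 (hd [])"

definition aut_size :: "aut \<Rightarrow> nat" where
  "aut_size A = table_size3 (fst A) + table_size3 (fst (snd A)) + length (snd (snd A))"

lemma look_cases: "look l i \<in> set l \<or> look l i = hd []"
  by (cases "i < length l") (auto simp: look_nth, simp add: look_def)

lemma table_size2_look: "length (look l i) \<le> table_size2 l"
  using look_cases[of l i] member_le_sum_list[of "length (look l i)" "map length l"] by (auto simp: table_size2_def)

lemma table_size3_look: "table_size2 (look l i) \<le> table_size3 l"
  using look_cases[of l i] member_le_sum_list[of "table_size2 (look l i)" "map table_size2 l"] by (auto simp: table_size3_def)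

lemma table_size3_bounds: "length l \<le> table_size3 l" "length (look l i) \<le> table_size3 l" "length (look (look l i) j) \<le> table_size3 l"
proof -
  have "length (look l i) \<le> table_size2 (look l i)" by (simp add: table_size2_def)
  then show "length (look l i) \<le> table_size3 l" using table_size3_look[of l i] by linarith
  show "length (look (look l i) j) \<le> table_size3 l" using table_size2_look[of "look l i" j] table_size3_look[of l i] by linarith
qed (simp add: table_size3_def)

lemma PC_comb0: "PC True (\<lambda>_. True) (\<lambda>y. aut_size (fst y))
    (\<lambda>y. comb (fst y) (fst (snd y)) (fst (snd (snd y))) (snd (snd (snd y))))"
  unfolding comb_def by (intro PC_rules) (auto simp: aut_size_def intro: table_size3_bounds[THEN le_trans])

lemma PC_comb [poly_rules]: "PC True D Z f \<Longrightarrow> PC True D Z g \<Longrightarrow> PC True D Z k \<Longrightarrow> PC True D Z l \<Longrightarrow>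
    (\<And>x. D x \<Longrightarrow> aut_size (f x) \<le> Z x) \<Longrightarrow> PC True D Z (\<lambda>x. comb (f x) (g x) (k x) (l x))"
  by (rule PC_comp4[OF PC_comb0]) simp_all

lemma PC_base0: "PC True (\<lambda>_. True) (\<lambda>y. aut_size (fst y))
    (\<lambda>y. base (fst y) (fst (snd y)) (fst (snd (snd y))) (snd (snd (snd y))))"
  unfolding base_def by (intro PC_rules) (auto simp: aut_size_def intro: table_size3_bounds[THEN le_trans])

lemma PC_base [poly_rules]: "PC True D Z f \<Longrightarrow> PC True D Z g \<Longrightarrow> PC True D Z k \<Longrightarrow> PC True D Z l \<Longrightarrow>
    (\<And>x. D x \<Longrightarrow> aut_size (f x) \<le> Z x) \<Longrightarrow> PC True D Z (\<lambda>x. base (f x) (g x) (k x) (l x))"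
  by (rule PC_comp4[OF PC_base0]) simp_all

lemma length_filter_upt: "length (filter P [0..<n]) \<le> n"
  using length_filter_le[of P "[0..<n]"] by simp

lemma PC_joinall0: "PC True (\<lambda>_. True)
    (\<lambda>y. aut_size (fst y) + 2 * fst (snd y) + length (fst (snd (snd y))) + length (fst (snd (snd (snd y)))) +
      length (fst (snd (snd (snd (snd y))))) + length (snd (snd (snd (snd (snd y))))))
    (\<lambda>y. joinall (fst y) K (fst (snd y)) (fst (snd (snd y))) (fst (snd (snd (snd y)))) (fst (snd (snd (snd (snd y))))) (snd (snd (snd (snd (snd y))))))"
  unfolding joinall_def
  by (rule PC_foldl[where I="\<lambda>x s. length (fst s) \<le> fst (snd x)"]; (intro PC_rules poly_rules)?)
    (simp_all add: length_filter_upt, auto intro: length_comp[THEN le_trans] simp: length_filter_upt)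

lemma PC_joinall [poly_rules]: "PC True D Z f \<Longrightarrow> PC True D Z g \<Longrightarrow> PC True D Z k \<Longrightarrow> PC True D Z l \<Longrightarrow> PC True D Z m \<Longrightarrow>
    PC True D Z q \<Longrightarrow>
    (\<And>x. D x \<Longrightarrow> aut_size (f x) + 2 * g x + length (k x) + length (l x) + length (m x) + length (q x) \<le> Z x) \<Longrightarrow>
    PC True D Z (\<lambda>x. joinall (f x) K (g x) (k x) (l x) (m x) (q x))"
  by (rule PC_comp6[OF PC_joinall0]) simp_all

lemma PC_addedges0: "PC True (\<lambda>_. True)
    (\<lambda>y. aut_size (fst y) + length (fst (snd y)) + length (fst (snd (snd y))) + length (fst (snd (snd (snd y)))))
    (\<lambda>y. addedges (fst y) K (fst (snd y)) (fst (snd (snd y))) (fst (snd (snd (snd y)))) (fst (snd (snd (snd (snd y))))) (snd (snd (snd (snd (snd y))))))"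
  unfolding addedges_def by (intro PC_rules poly_rules) simp_all

lemma PC_addedges [poly_rules]: "PC True D Z f \<Longrightarrow> PC True D Z g \<Longrightarrow> PC True D Z k \<Longrightarrow> PC True D Z l \<Longrightarrow> PC True D Z m \<Longrightarrow>
    PC True D Z q \<Longrightarrow>
    (\<And>x. D x \<Longrightarrow> aut_size (f x) + length (g x) + length (k x) + length (l x) \<le> Z x) \<Longrightarrow>
    PC True D Z (\<lambda>x. addedges (f x) K (g x) (k x) (l x) (m x) (q x))"
  by (rule PC_comp6[OF PC_addedges0]) simp_all

text \<open>The factor 3: \<open>joinall\<close> asks for \<open>2 * n\<close>, and its last
  argument, a filtered component, has length at most \<open>n\<close>.\<close>

definition search_size :: "aut \<times> nat \<times> (nat \<times> nat) list \<times> table \<times> nat list \<Rightarrow> nat" where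
  "search_size y = aut_size (fst y) + 3 * fst (snd y) + length (fst (snd (snd y))) + length (fst (snd (snd (snd y)))) +
      length (snd (snd (snd (snd y))))"

lemma length_filter_comp: "length (filter P (comp n es S v)) \<le> n"
  using length_filter_le[of P "comp n es S v"] length_comp[of n es S v] by linarith

lemma PC_attempt0: "PC True (\<lambda>_. True) (\<lambda>y. search_size (fst y))
    (\<lambda>y. attempt (fst (fst y)) K (fst (snd (fst y))) (fst (snd (snd (fst y)))) (fst (snd (snd (snd (fst y)))))
       (snd (snd (snd (snd (fst y))))) (fst (snd y)) (fst (snd (snd y))) (snd (snd (snd y))))"
  unfolding attempt_def
  by (intro PC_rules poly_rules) (simp_all add: search_size_def, (auto intro!: length_comp[THEN le_trans] add_mono length_filter_comp)+)

lemma PC_search0: "PC True (\<lambda>_. True) (\<lambda>y. search_size (fst y) + K)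
    (\<lambda>y. search (fst (fst y)) K (fst (snd (fst y))) (fst (snd (snd (fst y)))) (fst (snd (snd (snd (fst y)))))
       (snd (snd (snd (snd (fst y))))) (snd y))"
proof -
  have eq: "attempt (fst (fst y)) K (fst (snd (fst y))) (fst (snd (snd (fst y)))) (fst (snd (snd (snd (fst y)))))
       (snd (snd (snd (snd (fst y))))) (snd y) j b =
     (\<lambda>z. attempt (fst (fst z)) K (fst (snd (fst z))) (fst (snd (snd (fst z)))) (fst (snd (snd (snd (fst z)))))
       (snd (snd (snd (snd (fst z))))) (fst (snd z)) (fst (snd (snd z))) (snd (snd (snd z)))) (fst y, snd y, j, b)" for y j b
    by simp
  show ?thesis
    unfolding search_def eq
    by (intro PC_rules PC_comp[OF _ PC_attempt0]) (simp_all add: search_size_def)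
qed

lemma length_tuples: "length (tuples k n) = Suc n ^ k"
proof (induction k)
  case (Suc k)
  have "length (foldl (\<lambda>a S. map (\<lambda>i. i # S) [0..<Suc n] @ a) zs xs) = Suc n * length xs + length zs" for zs xs
    by (induction xs arbitrary: zs) auto
  from this[of "[]" "tuples k n"] show ?case using Suc by simp
qed simp

lemma PC_search [poly_rules]:
  assumes "PC True D Z f" "PC True D Z g" "PC True D Z k" "PC True D Z l" "PC True D Z m" "PC True D Z q"
    and "\<And>x. D x \<Longrightarrow> aut_size (f x) + 3 * g x + length (k x) + length (l x) + length (m x) + K \<le> Z x"
  shows "PC True D Z (\<lambda>x. search (f x) K (g x) (k x) (l x) (m x) (q x))"
  using PC_comp[OF _ PC_search0[of K], of D Z "\<lambda>x. ((f x, g x, k x, l x, m x), q x)"] assms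
  by (simp add: search_size_def PC_Pair)

text \<open>The length of the tuples is fixed in the program, so induction on \<open>k\<close> gives
  one program for each \<open>k\<close>, and \<open>Suc n ^ k\<close> is a polynomial
  measure.\<close>

lemma PC_tuples0: "PC True (\<lambda>_. True) (\<lambda>n. Suc n ^ k) (tuples k)"
proof (induction k)
  case 0
  have "tuples 0 = (\<lambda>_. [[]])" by auto
  then show ?case by (simp add: PC_const)
next
  case (Suc k)
  have IH: "PC True (\<lambda>_. True) (\<lambda>n. Suc n ^ Suc k) (\<lambda>n. tuples k n)"
    by (rule PC_comp[OF PC_id Suc]) auto
  have le: "Suc n \<le> Suc n ^ k + n * Suc n ^ k" for n
    using mult_le_mono2[of 1 "Suc n ^ k" "Suc n"] by simp
  have "tuples (Suc k) = (\<lambda>n. foldl (\<lambda>a S. map (\<lambda>i. i # S) [0..<Suc n] @ a) [] (tuples k n))" by auto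
  then show ?case
    by (simp only:) (rule PC_foldl'; (intro PC_rules poly_rules IH)?; simp add: length_tuples le)
qed

lemma PC_tuples [poly_rules]: "PC True D Z f \<Longrightarrow> (\<And>x. D x \<Longrightarrow> Suc (f x) ^ k \<le> Z x) \<Longrightarrow> PC True D Z (\<lambda>x. tuples k (f x))"
  by (rule PC_comp[OF _ PC_tuples0]) simp_all

lemma PC_init [poly_rules]: "PC True D Z f \<Longrightarrow> (\<And>x. D x \<Longrightarrow> f x + Suc (f x) ^ K \<le> Z x) \<Longrightarrow> PC True D Z (\<lambda>x. init K (f x))"
proof (rule PC_comp[where g="init K" and E="\<lambda>_. True" and W="\<lambda>n. n + Suc n ^ K"])
  show "PC True (\<lambda>_. True) (\<lambda>n. n + Suc n ^ K) (init K)"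
    unfolding init_def by (intro PC_rules poly_rules) (simp_all add: length_tuples)
qed simp_all

lemma length_init: "length (init K n) = n * Suc n ^ K"
proof -
  have "length (foldl (\<lambda>a S. map (\<lambda>v. ((S, v), 0::nat)) [0..<n] @ a) zs xs) = n * length xs + length zs"
    for zs and xs :: "nat list list"
    by (induction xs arbitrary: zs) auto
  then show ?thesis by (simp add: init_def length_tuples)
qed

text \<open>In \<open>next_table\<close> the tuple passed to \<open>search\<close> comes from the
  table, and its length enters the cost; this invariant bounds it.\<close>

definition narrow :: "nat \<Rightarrow> table \<Rightarrow> bool" where
  "narrow K T \<longleftrightarrow> (\<forall>t\<in>set T. length (fst (fst t)) = K)"

lemma narrow_init: "narrow K (init K n)"
  by (auto simp: narrow_def set_init set_tuples)

lemma narrow_next_table: "narrow K T \<Longrightarrow> narrow K (next_table A K n es T)" "length (next_table A K n es T) = length T"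
  by (auto simp: narrow_def next_table_def)

lemma PC_next_table0: "PC True (\<lambda>y. narrow K (snd (snd (snd y))))
    (\<lambda>y. aut_size (fst y) + 3 * fst (snd y) + length (fst (snd (snd y))) + length (snd (snd (snd y))) + 2 * K)
    (\<lambda>y. next_table (fst y) K (fst (snd y)) (fst (snd (snd y))) (snd (snd (snd y))))"
  unfolding next_table_def by (intro PC_rules poly_rules) (auto simp: narrow_def)

lemma PC_next_table [poly_rules]: "PC True D Z f \<Longrightarrow> PC True D Z g \<Longrightarrow> PC True D Z k \<Longrightarrow> PC True D Z l \<Longrightarrow>
    (\<And>x. D x \<Longrightarrow> narrow K (l x)) \<Longrightarrow>
    (\<And>x. D x \<Longrightarrow> aut_size (f x) + 3 * g x + length (k x) + length (l x) + 2 * K \<le> Z x) \<Longrightarrow>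
    PC True D Z (\<lambda>x. next_table (f x) K (g x) (k x) (l x))"
  by (rule PC_comp4[OF PC_next_table0[of K]]) simp_all

text \<open>\<open>n * Suc n ^ K\<close> is the length of the table and \<open>Suc n ^ K\<close> the
  number of tuples; the remaining summands collect what the subprograms ask for.\<close>

definition decide_size :: "nat \<Rightarrow> aut \<times> nat \<times> (nat \<times> nat) list \<Rightarrow> nat" where
  "decide_size K y = aut_size (fst y) + 3 * fst (snd y) + length (snd (snd y)) + fst (snd y) * Suc (fst (snd y)) ^ K
     + Suc (fst (snd y)) ^ K + 2 * K"

lemma PC_table: "PC True (\<lambda>_. True) (decide_size K) (\<lambda>y. table (fst y) K (fst (snd y)) (snd (snd y)))"
  unfolding table_def
  by (rule PC_foldl[where I="\<lambda>y T. narrow K T \<and> length T = fst (snd y) * Suc (fst (snd y)) ^ K"];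
      (intro PC_rules poly_rules)?; auto simp: decide_size_def narrow_init narrow_next_table length_init)

lemma length_table: "length (table A K n es) = n * Suc n ^ K"
proof -
  have "length (foldl (\<lambda>T _. next_table A K n es T) T xs) = length T" for T and xs :: "nat list"
    by (induction xs arbitrary: T) (auto simp: narrow_next_table)
  then show ?thesis by (simp add: table_def length_init)
qed

lemma PC_total: "PC True (\<lambda>_. True) (decide_size K) (\<lambda>y. total (fst y) K (fst (snd y)) (snd (snd y)))"
  unfolding total_def
  by (intro PC_snd PC_joinall PC_table PC_rules poly_rules) (auto simp: decide_size_def length_table)

lemma PC_decide: "PC True (\<lambda>_. True) (decide_size K) (\<lambda>y. decide (fst y) K (fst (snd y)) (snd (snd y)))"
  unfolding decide_def acc_def by (intro PC_total PC_rules) (auto simp: decide_size_def aut_size_def)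

section \<open>Programs on the raw input word\<close>

definition reader :: ram where
  "reader = Seq (copy 1 0) (Seq (Set_Const 2 0) (Seq (While_Nonzero 1
     (Seq (Set_Const 3 1) (Seq (Sub 1 1 3) (Seq (Load 4 1) (cell 2 4 2 5))))) (copy 1 2)))"

text \<open>Register 0 initially holds the input length, the first address behind the input, and so
  can act as the free pointer at once; the nonempty input makes it positive. The list is built from
  its end.\<close>

lemma reader:
  fixes xs :: "nat list"
  assumes "xs \<noteq> []"
  shows "\<exists>t s. exec reader (ram_init xs) t s \<and> t \<le> 11 * length xs + 6 \<and> 0 < fst s 0 \<and> rep s (fst s 1) xs"
proof -
  let ?body = "Seq (Set_Const 3 1) (Seq (Sub 1 1 3) (Seq (Load 4 1) (cell 2 4 2 5)))"
  have loop: "\<exists>t s'. exec (While_Nonzero 1 ?body) s t s' \<and> t \<le> 11 * i + 1 \<and> 0 < fst s' 0 \<and> rep s' (fst s' 2) xs"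
    if "i \<le> length xs" "fst s 1 = i" "length xs \<le> fst s 0" "\<And>a. a < length xs \<Longrightarrow> snd s a = xs ! a"
      "rep s (fst s 2) (drop i xs)" for s i
    using that
  proof (induction i arbitrary: s)
    case 0
    have "exec (While_Nonzero 1 ?body) s 1 s" by (rule exec.While_False) (use 0 in simp)
    moreover have "0 < fst s 0" using 0 assms by (cases xs) auto
    ultimately show ?case using 0 by (intro exI[of _ 1] exI[of _ s]) simp
  next
    case (Suc i)
    let ?s1 = "((fst s)(3 := 1), snd s)"
    have e1: "exec (Set_Const 3 1) s 1 ?s1" by (rule exec_Set)
    let ?s2 = "((fst ?s1)(1 := i), snd ?s1)"
    have e2: "exec (Sub 1 1 3) ?s1 1 ?s2"
      by (rule exec_eq, rule exec_Sub) (use Suc.prems(2) in \<open>auto simp: fun_eq_iff\<close>)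
    let ?s3 = "((fst ?s2)(4 := xs ! i), snd ?s2)"
    have e3: "exec (Load 4 1) ?s2 1 ?s3"
      by (rule exec_eq, rule exec_Load) (use Suc.prems(1,4) in \<open>auto simp: fun_eq_iff\<close>)
    let ?s4 = "((fst ?s3)(0 := fst ?s3 0 + 2, 5 := 2, 2 := fst ?s3 0),
      (snd ?s3)(fst ?s3 0 := fst ?s3 4, fst ?s3 0 + 1 := fst ?s3 2))"
    have e4: "exec (cell 2 4 2 5) ?s3 7 ?s4" by (rule exec_cell) auto
    have f: "frame 0 s ?s4" by (auto simp: frame_def)
    have pos: "0 < fst s 0" using Suc.prems(3) assms by (cases xs) auto
    have "rep ?s4 (fst ?s4 2) (xs ! i # drop (Suc i) xs)"
      using rep_frame[OF Suc.prems(5) f] pos by (simp add: cell_at_def rep_nat_def)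
    then have r: "rep ?s4 (fst ?s4 2) (drop i xs)" using Suc.prems(1) by (simp add: Cons_nth_drop_Suc)
    have "\<exists>t s'. exec (While_Nonzero 1 ?body) ?s4 t s' \<and> t \<le> 11 * i + 1 \<and> 0 < fst s' 0 \<and> rep s' (fst s' 2) xs"
      by (rule Suc.IH[OF _ _ _ _ r]) (use Suc.prems in auto)
    then obtain t s' where 5: "exec (While_Nonzero 1 ?body) ?s4 t s'" "t \<le> 11 * i + 1" "0 < fst s' 0"
      "rep s' (fst s' 2) xs" by (elim exE conjE)
    have "exec (While_Nonzero 1 ?body) s (1 + (1 + (1 + (1 + 7))) + t) s'"
      by (rule exec.While_True[OF _ exec.Seq[OF e1 exec.Seq[OF e2 exec.Seq[OF e3 e4]]] 5(1)]) (use Suc.prems in simp)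
    then show ?case using 5 by (intro exI[of _ "1 + (1 + (1 + (1 + 7))) + t"] exI[of _ s']) simp
  qed
  let ?s0 = "ram_init xs"
  let ?s1 = "((fst ?s0)(1 := fst ?s0 0), snd ?s0)"
  have e1: "exec (copy 1 0) ?s0 2 ?s1" by (rule exec_copy) simp
  let ?s2 = "((fst ?s1)(2 := 0), snd ?s1)"
  have e2: "exec (Set_Const 2 0) ?s1 1 ?s2" by (rule exec_Set)
  have "\<exists>t s'. exec (While_Nonzero 1 ?body) ?s2 t s' \<and> t \<le> 11 * length xs + 1 \<and> 0 < fst s' 0 \<and> rep s' (fst s' 2) xs"
    by (rule loop) (auto simp: ram_init_def)
  then obtain t s3 where 3: "exec (While_Nonzero 1 ?body) ?s2 t s3" "t \<le> 11 * length xs + 1" "0 < fst s3 0"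
      "rep s3 (fst s3 2) xs" by (elim exE conjE)
  let ?s4 = "((fst s3)(1 := fst s3 2), snd s3)"
  have e4: "exec (copy 1 2) s3 2 ?s4" by (rule exec_copy) simp
  have f4: "frame 0 s3 ?s4" by (simp add: frame_def)
  have "exec reader ?s0 (2 + (1 + (t + 2))) ?s4"
    unfolding reader_def by (intro exec.Seq[OF e1] exec.Seq[OF e2] exec.Seq[OF 3(1)] e4)
  moreover have "rep ?s4 (fst ?s4 1) xs" using rep_frame[OF 3(4) f4] by simp
  ultimately show ?thesis using 3(2,3) by (intro exI[of _ "2 + (1 + (t + 2))"] exI[of _ ?s4]) simp
qed

lemma TC_ram:
  fixes f :: "nat list \<Rightarrow> bool"
  assumes "TC D f \<tau>"
  shows "\<exists>p. \<forall>xs. D xs \<longrightarrow> xs \<noteq> [] \<longrightarrow> (\<exists>t \<le> \<tau> xs + 11 * length xs + 8.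
    if f xs then ram_accepts_in p xs t else ram_rejects_in p xs t)"
proof -
  obtain P where P: "implements P D f \<tau>" using assms by (rule TCE)
  have "\<exists>t \<le> \<tau> xs + 11 * length xs + 8. if f xs then ram_accepts_in (Seq reader (Seq (P 1) (copy 0 1))) xs t
      else ram_rejects_in (Seq reader (Seq (P 1) (copy 0 1))) xs t" if D: "D xs" and ne: "xs \<noteq> []" for xs
  proof -
    obtain t1 s1 where 1: "exec reader (ram_init xs) t1 s1" "t1 \<le> 11 * length xs + 6" "0 < fst s1 0" "rep s1 (fst s1 1) xs"
      using reader[OF ne] by (elim exE conjE)
    have "yields (P 1) s1 1 (\<tau> xs) (\<lambda>s v. rep s v (f xs))" by (rule implementsD[OF P _ 1(3) D 1(4)]) simp
    then obtain t2 s2 where 2: "exec (P 1) s1 t2 s2" "t2 \<le> \<tau> xs" "rep s2 (fst s2 1) (f xs)" by (rule yieldsE)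
    let ?s3 = "((fst s2)(0 := fst s2 1), snd s2)"
    have e3: "exec (copy 0 1) s2 2 ?s3" by (rule exec_copy) simp
    have e: "exec (Seq reader (Seq (P 1) (copy 0 1))) (ram_init xs) (t1 + (t2 + 2)) ?s3"
      by (intro exec.Seq[OF 1(1)] exec.Seq[OF 2(1)] e3)
    have "fst ?s3 0 \<noteq> 0 \<longleftrightarrow> f xs" using 2(3) by (simp add: rep_bool_def)
    then show ?thesis
      using e 1(2) 2(2) unfolding ram_accepts_in_def ram_rejects_in_def
      by (intro exI[of _ "t1 + (t2 + 2)"]) auto
  qed
  then show ?thesis by blast
qed

section \<open>Assembly of the decision procedure\<close>

text \<open>Variable numbers count in unary towards the length, so only finitely many of them occur.
  A cost that depends on the formula itself can thus be bounded by a function of its length.\<close>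

lemma finite_formulas: "finite {\<phi>. formula_length \<phi> \<le> n}"
proof (induction n)
  case 0
  have "formula_length \<phi> > 0" for \<phi> by (cases \<phi>) auto
  then have "{\<phi>. formula_length \<phi> \<le> 0} = {}" by auto
  then show ?case by (metis finite.emptyI)
next
  case (Suc n)
  let ?F = "{\<phi>. formula_length \<phi> \<le> n}" and ?N = "{..n}"
  let ?atoms = "\<lambda>c. (\<lambda>(x, y). c x y) ` (?N \<times> ?N)" and ?qs = "\<lambda>c. (\<lambda>(x, y). c x y) ` (?N \<times> ?F)"
  have "{\<phi>. formula_length \<phi> \<le> Suc n} \<subseteq> ?atoms Eq_V \<union> ?atoms Eq_E \<union> ?atoms Adj \<union> ?atoms Inc \<union> ?atoms Less
     \<union> ?atoms Mem_V \<union> ?atoms Mem_E \<union> Neg ` ?F \<union> (\<lambda>(x, y). Conj x y) ` (?F \<times> ?F)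
     \<union> ?qs Ex_V \<union> ?qs Ex_E \<union> ?qs Ex_VS \<union> ?qs Ex_ES"
  proof
    fix \<phi> assume "\<phi> \<in> {\<phi>. formula_length \<phi> \<le> Suc n}"
    then show "\<phi> \<in> ?atoms Eq_V \<union> ?atoms Eq_E \<union> ?atoms Adj \<union> ?atoms Inc \<union> ?atoms Less
     \<union> ?atoms Mem_V \<union> ?atoms Mem_E \<union> Neg ` ?F \<union> (\<lambda>(x, y). Conj x y) ` (?F \<times> ?F)
     \<union> ?qs Ex_V \<union> ?qs Ex_E \<union> ?qs Ex_VS \<union> ?qs Ex_ES"
      by (cases \<phi>) auto
  qed
  then show ?case by (rule finite_subset) (use Suc in auto)
qed

text \<open>The order of the vertices is that of the leaves of \<open>t\<close>, transported along
  \<open>vs\<close>; \<open>dist\<close> makes it linear.\<close>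

lemma good_represents:
  assumes wf: "wf_graph G" and vs: "distinct vs" "set vs = verts G" and val: "valid (length vs) es"
    and es: "distinct (map (\<lambda>(i, j). {vs ! i, vs ! j}) es)" "set (map (\<lambda>(i, j). {vs ! i, vs ! j}) es) = edges G"
    and t: "good K es S (elts es {..<length vs}) t"
  shows "\<exists>lt. represents t ((!) vs) (\<lambda>e. {vs ! fst (es ! e), vs ! snd (es ! e)}) G lt \<and> vertex_order G lt"
proof -
  let ?n = "length vs" and ?W = "\<lambda>e. {vs ! fst (es ! e), vs ! snd (es ! e)}"
  have el: "elems t = elts es {..<?n}" and dt: "dist t" and ad: "adjt t = rel es \<inter> elts es {..<?n} \<times> elts es {..<?n}"
    using t by (auto simp: good_def)
  have ev: "fst (es ! e) < ?n \<and> snd (es ! e) < ?n" if "e < length es" for e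
    using val that by (auto simp: valid_def)
  have ids: "ids 0 t = {..<?n}" "ids 1 t = {..<length es}"
    using ev by (auto simp: ids_def el)
  have inj: "vs ! i = vs ! j \<longleftrightarrow> i = j" if "i < ?n" "j < ?n" for i j
    using that vs(1) by (simp add: nth_eq_iff_index_eq)
  have img: "(!) vs ` {..<?n} = verts G" using vs(2) by (auto simp: set_conv_nth)
  have W: "map (\<lambda>(i, j). {vs ! i, vs ! j}) es ! e = ?W e" if "e < length es" for e
    using that by (simp add: case_prod_beta)
  have injW: "inj_on ?W {..<length es}"
  proof (rule inj_onI)
    fix a b assume "a \<in> {..<length es}" "b \<in> {..<length es}" "?W a = ?W b"
    then show "a = b" using es(1) W by (metis length_map lessThan_iff nth_eq_iff_index_eq)
  qed
  have imgW: "?W ` {..<length es} = edges G"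
    unfolding es(2)[symmetric] by (force simp: set_conv_nth case_prod_beta)
  define lt where "lt = {(vs ! u, vs ! w) | u w. u \<in> ids 0 t \<and> w \<in> ids 0 t \<and> ((0, u), (0, w)) \<in> bef t}"
  have adj: "adjb es u w \<longleftrightarrow> {vs ! u, vs ! w} \<in> edges G" if "u < ?n" "w < ?n" for u w
  proof
    assume "adjb es u w"
    then show "{vs ! u, vs ! w} \<in> edges G"
      unfolding es(2)[symmetric] adjb_iff by (force simp: insert_commute)
  next
    assume "{vs ! u, vs ! w} \<in> edges G"
    then obtain i j where ij: "(i, j) \<in> set es" "{vs ! u, vs ! w} = {vs ! i, vs ! j}"
      unfolding es(2)[symmetric] by auto
    have "i < ?n" "j < ?n" using val ij(1) by (auto simp: valid_def)
    then have "u = i \<and> w = j \<or> u = j \<and> w = i"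
      using ij(2) inj that by (auto simp: doubleton_eq_iff)
    then show "adjb es u w" using ij(1) by (auto simp: adjb_iff)
  qed
  have "represents t ((!) vs) ?W G lt"
    unfolding represents_def ids
  proof (intro conjI ballI)
    show "inj_on ((!) vs) {..<?n}" using inj by (auto simp: inj_on_def)
    show "(!) vs ` {..<?n} = verts G" by (rule img)
    show "inj_on ?W {..<length es}" by (rule injW)
    show "?W ` {..<length es} = edges G" by (rule imgW)
    show "((0, u), (0, w)) \<in> adjt t \<longleftrightarrow> {vs ! u, vs ! w} \<in> edges G" if "u \<in> {..<?n}" "w \<in> {..<?n}" for u w
      using that adj by (simp add: ad)
    show "((0, u), (1, e)) \<in> adjt t \<longleftrightarrow> vs ! u \<in> ?W e" if "u \<in> {..<?n}" "e \<in> {..<length es}" for u e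
      using that ev[of e] inj[of u "fst (es ! e)"] inj[of u "snd (es ! e)"] by (auto simp: ad)
  qed (simp add: lt_def ids)
  moreover have "vertex_order G lt"
    unfolding vertex_order_def strict_linear_order_on_def
  proof (intro conjI)
    note bt = bef_strict_linear_order[OF dt]
    show "lt \<subseteq> verts G \<times> verts G" using img unfolding lt_def ids by auto
    show "trans lt"
    proof (rule transI)
      fix x y z assume "(x, y) \<in> lt" "(y, z) \<in> lt"
      then obtain u w w' v where a: "x = vs ! u" "y = vs ! w" "u < ?n" "w < ?n" "((0, u), (0, w)) \<in> bef t"
        "y = vs ! w'" "z = vs ! v" "w' < ?n" "v < ?n" "((0, w'), (0, v)) \<in> bef t"
        unfolding lt_def ids by auto
      then have "w' = w" using inj by metis
      then have "((0, u), (0, v)) \<in> bef t" using a bt(1) by (meson transD)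
      then show "(x, z) \<in> lt" unfolding lt_def ids using a by auto
    qed
    show "irrefl lt"
    proof (rule irreflI)
      fix x show "(x, x) \<notin> lt"
        using inj bt(2) unfolding lt_def ids irrefl_def by auto
    qed
    show "total_on (verts G) lt"
    proof (rule total_onI)
      fix x y assume "x \<in> verts G" "y \<in> verts G" "x \<noteq> y"
      then obtain u w where uw: "x = vs ! u" "y = vs ! w" "u < ?n" "w < ?n" unfolding img[symmetric] by auto
      then have "((0, u), (0, w)) \<in> bef t \<or> ((0, w), (0, u)) \<in> bef t"
        using \<open>x \<noteq> y\<close> bt(3)[of "(0, u)" "(0, w)"] by (auto simp: el)
      then show "(x, y) \<in> lt \<or> (y, x) \<in> lt" unfolding lt_def ids using uw by auto
    qed
  qed
  ultimately show ?thesis by blast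
qed

lemma elim_cert_icert:
  assumes cert: "elim_cert K G \<rho> \<chi> F" and vs: "distinct vs" "set vs = verts G" and val: "valid (length vs) es"
    and es: "set (map (\<lambda>(i, j). {vs ! i, vs ! j}) es) = edges G"
  shows "icert K (length vs) es (\<lambda>i. \<rho> (vs ! i)) (\<lambda>i. \<chi> (vs ! i))
    {(i, j). i < length vs \<and> j < length vs \<and> (vs ! i, vs ! j) \<in> F}"
proof -
  have inj: "inj_on \<rho> (verts G)" and col: "\<And>v. v \<in> verts G \<Longrightarrow> \<chi> v < K" and sym: "\<And>u v. (u, v) \<in> F \<Longrightarrow> (v, u) \<in> F"
    and edge: "\<And>u v. {u, v} \<in> edges G \<Longrightarrow> (u, v) \<in> F" and proper: "\<And>u v. (u, v) \<in> F \<Longrightarrow> \<chi> u \<noteq> \<chi> v"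
    and chord: "\<And>u v w. (u, v) \<in> F \<Longrightarrow> (u, w) \<in> F \<Longrightarrow> \<rho> u < \<rho> v \<Longrightarrow> \<rho> u < \<rho> w \<Longrightarrow> v \<noteq> w \<Longrightarrow> (v, w) \<in> F"
    using cert unfolding elim_cert_def sym_def by blast+
  have mem: "vs ! i \<in> verts G" if "i < length vs" for i using that vs(2) nth_mem by blast
  have inj_vs: "vs ! i = vs ! j \<longleftrightarrow> i = j" if "i < length vs" "j < length vs" for i j
    using that vs(1) by (simp add: nth_eq_iff_index_eq)
  have adj: "i < length vs \<and> j < length vs \<and> (vs ! i, vs ! j) \<in> F" if "adjb es i j" for i j
  proof -
    have "{vs ! i, vs ! j} \<in> edges G"
      using that unfolding es[symmetric] adjb_iff by (force simp: insert_commute)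
    then show ?thesis using edge adjb_valid[OF val that] by blast
  qed
  show ?thesis
    unfolding icert_def
  proof (intro conjI allI impI)
    show "inj_on (\<lambda>i. \<rho> (vs ! i)) {..<length vs}"
    proof (rule inj_onI)
      fix x y assume "x \<in> {..<length vs}" "y \<in> {..<length vs}" "\<rho> (vs ! x) = \<rho> (vs ! y)"
      then show "x = y" using inj_onD[OF inj, of "vs ! x" "vs ! y"] mem inj_vs by simp
    qed
    show "\<chi> (vs ! v) < K" if "v < length vs" for v using col mem that by blast
    show "sym {(i, j). i < length vs \<and> j < length vs \<and> (vs ! i, vs ! j) \<in> F}"
      using sym by (auto simp: sym_def)
    show "(u, v) \<in> {(i, j). i < length vs \<and> j < length vs \<and> (vs ! i, vs ! j) \<in> F}" if "adjb es u v" for u v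
      using adj[OF that] by simp
    show "\<chi> (vs ! u) \<noteq> \<chi> (vs ! v)" if "(u, v) \<in> {(i, j). i < length vs \<and> j < length vs \<and> (vs ! i, vs ! j) \<in> F}" for u v
      using proper that by blast
    show "(v, w) \<in> {(i, j). i < length vs \<and> j < length vs \<and> (vs ! i, vs ! j) \<in> F}"
      if "(u, v) \<in> {(i, j). i < length vs \<and> j < length vs \<and> (vs ! i, vs ! j) \<in> F}"
        "(u, w) \<in> {(i, j). i < length vs \<and> j < length vs \<and> (vs ! i, vs ! j) \<in> F}"
        "\<rho> (vs ! u) < \<rho> (vs ! v)" "\<rho> (vs ! u) < \<rho> (vs ! w)" "v \<noteq> w" for u v w
      using that chord[of "vs ! u" "vs ! v" "vs ! w"] inj_vs[of v w] by auto
  qed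
qed

definition model_check :: "nat \<Rightarrow> nat list \<Rightarrow> bool" where
  "model_check K xs = (let p = parse xs; g = pgraph (snd p) in decide (build K (fst p)) K (fst g) (snd g))"

lemma model_check_correct:
  fixes G :: "nat graph"
  assumes wf: "wf_graph G" and tw: "treewidth G \<le> k" and \<phi>: "sentence \<phi>" "order_invariant \<phi>"
    and code: "graph_code G ys"
  shows "model_check (Suc k) (formula_code \<phi> @ ys) \<longleftrightarrow> models_ord_inv G \<phi>"
proof -
  obtain vs es where vs: "distinct vs" "set vs = verts G" and bnd: "\<forall>(i, j)\<in>set es. i < length vs \<and> j < length vs"
    and es: "distinct (map (\<lambda>(i, j). {vs ! i, vs ! j}) es)" "set (map (\<lambda>(i, j). {vs ! i, vs ! j}) es) = edges G"
    and ys: "ys = length vs # length es # concat (map (\<lambda>(i, j). [i, j]) es)"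
    using code unfolding graph_code_def by blast
  \<comment> \<open>The coding does not forbid loops; they are excluded because edges of a
    well-formed graph have two elements.\<close>
  have val: "valid (length vs) es"
    unfolding valid_def
  proof
    fix e assume e: "e \<in> set es"
    then have "{vs ! fst e, vs ! snd e} \<in> edges G" unfolding es(2)[symmetric] by force
    then have "card {vs ! fst e, vs ! snd e} = 2" using wf by (auto simp: wf_graph_def)
    then have "fst e \<noteq> snd e" by auto
    then show "fst e < length vs \<and> snd e < length vs \<and> fst e \<noteq> snd e" using bnd e by auto
  qed
  let ?K = "Suc k" and ?ts = "rev (flat \<phi>)"
  let ?A = "build ?K ?ts" and ?M = "tokbound ?ts"
  obtain \<rho> \<chi> F where cert: "elim_cert ?K G \<rho> \<chi> F" using treewidth_elim_cert[OF wf tw] by blast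
  obtain t where t: "good ?K es (map (\<lambda>_. length vs) [0..<?K]) (elts es {..<length vs}) t"
    and dec: "decide ?A ?K (length vs) es \<longleftrightarrow> look (acc ?A) (val ?M ?A t)"
    using decide_correct[OF elim_cert_icert[OF cert vs val es(2)] val] by blast
  obtain lt where rep: "represents t ((!) vs) (\<lambda>e. {vs ! fst (es ! e), vs ! snd (es ! e)}) G lt" and ord: "vertex_order G lt"
    using good_represents[OF wf vs val es t] by blast
  have "ok_term ?K t" "dist t" using t by (auto simp: good_def)
  then have "look (acc ?A) (val ?M ?A t) \<longleftrightarrow> sem t (\<lambda>_ _. {}) \<phi>"
    using recog_build[of ?K \<phi>] unfolding recog_def by blast
  also have "\<dots> \<longleftrightarrow> satisfies G lt \<phi>"
    unfolding satisfies_def by (rule sem_holds[OF rep]) (use \<phi>(1) in \<open>simp add: sentence_def\<close>)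
  \<comment> \<open>\<open>lt\<close> is itself a witness for one direction; for the other,
    invariance exchanges a given witness for \<open>lt\<close>.\<close>
  also have "\<dots> \<longleftrightarrow> models_ord_inv G \<phi>"
    using \<phi>(2) wf ord unfolding order_invariant_def models_ord_inv_def by blast
  finally show ?thesis
    using dec by (simp add: model_check_def parse ys pgraph[simplified])
qed

text \<open>Three phases with bounds of different kinds: parsing is polynomial in the word, the
  automaton takes a time \<open>\<tau>\<close> of unknown growth in the tokens, and the decision is
  polynomial in \<open>decide_size\<close>. Starting with a formula is what keeps the parsed
  remainder no longer than the word.\<close>

lemma model_check_cost:
  "\<exists>\<tau> c d. TC (\<lambda>xs. \<exists>\<phi> ys. xs = formula_code \<phi> @ ys) (model_check K) (\<lambda>xs. c * Suc (length xs) ^ d +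
     \<tau> (fst (parse xs)) + c * Suc (decide_size K (build K (fst (parse xs)), pgraph (snd (parse xs)))) ^ d)"
proof -
  let ?D = "\<lambda>xs. \<exists>\<phi> ys. xs = formula_code \<phi> @ ys"
  have 1: "PC True ?D length parse"
    by (rule PC_comp[OF PC_id PC_parse]) simp_all
  have "PC True ?D length (\<lambda>xs. (fst (parse xs), pgraph (snd (parse xs))))"
  proof (intro PC_Pair PC_fst 1 PC_comp[OF PC_snd[OF 1] PC_pgraph])
    fix xs assume "?D xs"
    then show "length (snd (parse xs)) \<le> length xs" by (auto simp: parse)
  qed simp
  then obtain \<tau>1 c1 d1 where t1: "TC ?D (\<lambda>xs. (fst (parse xs), pgraph (snd (parse xs)))) \<tau>1"
    and b1: "\<And>xs. ?D xs \<Longrightarrow> \<tau>1 xs \<le> c1 * Suc (length xs) ^ d1"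
    unfolding PC_def polyb_def by blast
  obtain \<tau> where t: "TC (\<lambda>_. True) (build K) \<tau>" using cmp_build unfolding PC_def by blast
  have t2: "TC (\<lambda>_. True) (\<lambda>y. (build K (fst y), snd y :: nat \<times> (nat \<times> nat) list)) (\<lambda>y. \<tau> (fst y) + 15)"
    by (rule TC_mono[OF TC_Pair[OF TC_comp[OF TC_fst0 t] TC_snd0]]) simp_all
  obtain \<tau>3 c3 d3 where t3: "TC (\<lambda>_. True) (\<lambda>y. decide (fst y) K (fst (snd y)) (snd (snd y))) \<tau>3"
    and b3: "\<And>y. \<tau>3 y \<le> c3 * Suc (decide_size K y) ^ d3"
    using PC_decide[of K] unfolding PC_def polyb_def by blast
  have up: "c * Suc n ^ d \<le> (c1 + c3) * Suc n ^ (d1 + d3)" if "c \<le> c1 + c3" "d \<le> d1 + d3" for c d n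
    using that by (intro mult_mono power_increasing) auto
  have "TC ?D (model_check K) (\<lambda>xs. (c1 + c3) * Suc (length xs) ^ (d1 + d3) +
     (\<tau> (fst (parse xs)) + 15) + (c1 + c3) * Suc (decide_size K (build K (fst (parse xs)), pgraph (snd (parse xs)))) ^ (d1 + d3))"
  proof (rule TC_mono[OF TC_comp[OF TC_comp[OF t1 t2] t3]])
    fix xs assume D: "?D xs"
    let ?y = "(build K (fst (parse xs)), pgraph (snd (parse xs)))"
    have "\<tau>1 xs \<le> (c1 + c3) * Suc (length xs) ^ (d1 + d3)"
      using b1[OF D] up[of c1 d1 "length xs"] by simp
    moreover have "\<tau>3 ?y \<le> (c1 + c3) * Suc (decide_size K ?y) ^ (d1 + d3)"
      using b3[of ?y] up[of c3 d3 "decide_size K ?y"] by simp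
    ultimately show "\<tau>1 xs + (\<tau> (fst (fst (parse xs), pgraph (snd (parse xs)))) + 15) +
        \<tau>3 (build K (fst (fst (parse xs), pgraph (snd (parse xs)))), snd (fst (parse xs), pgraph (snd (parse xs))))
      \<le> (c1 + c3) * Suc (length xs) ^ (d1 + d3) + (\<tau> (fst (parse xs)) + 15) +
        (c1 + c3) * Suc (decide_size K ?y) ^ (d1 + d3)" by simp
  qed (simp_all add: model_check_def Let_def)
  then show ?thesis
    by (intro exI[of _ "\<lambda>ts. \<tau> ts + 15"] exI[of _ "c1 + c3"] exI[of _ "d1 + d3"])
qed

lemma length_graph_code:
  assumes "graph_code G ys"
  obtains es where "ys = card (verts G) # length es # concat (map (\<lambda>(i, j). [i, j]) es)"
    "length es = card (edges G)" "length ys = 2 + 2 * card (edges G)"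
proof -
  obtain vs es where vs: "distinct vs" "set vs = verts G"
    and es: "distinct (map (\<lambda>(i, j). {vs ! i, vs ! j}) es)" "set (map (\<lambda>(i, j). {vs ! i, vs ! j}) es) = edges G"
    and ys: "ys = length vs # length es # concat (map (\<lambda>(i, j). [i, j]) es)"
    using assms unfolding graph_code_def by blast
  have "length vs = card (verts G)" using vs distinct_card by metis
  moreover have "length es = card (edges G)" using es distinct_card by (metis length_map)
  moreover have "length (concat (map (\<lambda>(i, j). [i, j]) es)) = 2 * length es" by (induction es) auto
  ultimately show ?thesis using that[of es] ys by simp
qed

theorem theorem4p1:
  fixes C :: "nat graph set"
  assumes graphs: "\<And>G. G \<in> C \<Longrightarrow> wf_graph G"
    and tw: "bounded_treewidth C"
  shows "fpt (MC_ord_inv C)"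
proof -
  obtain k where k: "\<And>G. G \<in> C \<Longrightarrow> treewidth G \<le> k" using tw by (auto simp: bounded_treewidth_def)
  let ?K = "Suc k"
  obtain \<tau> c d where tc: "TC (\<lambda>xs. \<exists>\<phi> ys. xs = formula_code \<phi> @ ys) (model_check ?K) (\<lambda>xs. c * Suc (length xs) ^ d +
     \<tau> (fst (parse xs)) + c * Suc (decide_size ?K (build ?K (fst (parse xs)), pgraph (snd (parse xs)))) ^ d)"
    using model_check_cost by blast
  from TC_ram[OF tc] obtain p where p: "\<And>xs. \<exists>\<phi> ys. xs = formula_code \<phi> @ ys \<Longrightarrow> xs \<noteq> [] \<Longrightarrow>
    \<exists>t \<le> c * Suc (length xs) ^ d + \<tau> (fst (parse xs)) +
        c * Suc (decide_size ?K (build ?K (fst (parse xs)), pgraph (snd (parse xs)))) ^ d + 11 * length xs + 8.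
      if model_check ?K xs then ram_accepts_in p xs t else ram_rejects_in p xs t" by blast
  define l where "l \<phi> = length (formula_code \<phi>) + 6" for \<phi>
  \<comment> \<open>The 7 is 1 for the \<open>Suc\<close> around \<open>decide_size\<close> and 6
    for its graph-dependent summands: three times the number of vertices, the number of edges and
    two powers, each at most \<open>graph_size G ^ (?K + 1)\<close>.\<close>
  define a where "a \<phi> = aut_size (build ?K (rev (flat \<phi>))) + 2 * ?K + 7" for \<phi>
  define B where "B \<phi> = c * l \<phi> ^ d + \<tau> (rev (flat \<phi>)) + c * a \<phi> ^ d + 11 * l \<phi> + 8" for \<phi>
  \<comment> \<open>The sum dominates the cost for every formula up to the given length; no explicit
    growth rate is claimed.\<close>
  define f where "f n = sum B {\<phi>. formula_length \<phi> \<le> n}" for n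
  \<comment> \<open>The summands cover the exponents that occur: \<open>d\<close> for parsing,
    \<open>(?K + 1) * d\<close> for the dynamic program and 1 for reading the input.\<close>
  define e where "e = d + (?K + 1) * d + 1"
  have main: "\<exists>t \<le> f (formula_length \<phi>) * graph_size G ^ e.
     if models_ord_inv G \<phi> then ram_accepts_in p (formula_code \<phi> @ ys) t else ram_rejects_in p (formula_code \<phi> @ ys) t"
    if G: "G \<in> C" and \<phi>: "sentence \<phi>" "order_invariant \<phi>" and code: "graph_code G ys" for G \<phi> ys
  proof -
    let ?xs = "formula_code \<phi> @ ys" and ?g = "graph_size G"
    obtain es where ys: "ys = card (verts G) # length es # concat (map (\<lambda>(i, j). [i, j]) es)"
      and len_es: "length es = card (edges G)" and len_ys: "length ys = 2 + 2 * card (edges G)"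
      using code by (rule length_graph_code)
    have g1: "1 \<le> ?g" and gn: "Suc (card (verts G)) \<le> ?g" and gm: "card (edges G) \<le> ?g" by (auto simp: graph_size_def)
    have parse: "fst (parse ?xs) = rev (flat \<phi>)" "pgraph (snd (parse ?xs)) = (card (verts G), es)"
      by (simp_all add: parse ys pgraph[simplified])
    have pw: "x \<le> x * ?g" for x using g1 by simp
    have len: "Suc (length ?xs) \<le> l \<phi> * ?g"
    proof -
      have "Suc (length ?xs) \<le> (length (formula_code \<phi>) + 3) + 2 * ?g" using len_ys gm by simp
      also have "\<dots> \<le> (length (formula_code \<phi>) + 3) * ?g + 2 * ?g" using pw by (intro add_mono) auto
      also have "\<dots> \<le> l \<phi> * ?g" by (simp add: l_def algebra_simps)
      finally show ?thesis .
    qed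
    have decide_size: "Suc (decide_size ?K (build ?K (rev (flat \<phi>)), (card (verts G), es))) \<le> a \<phi> * ?g ^ (?K + 1)"
    proof -
      let ?n = "card (verts G)" and ?P = "?g ^ (?K + 1)"
      have P: "?g \<le> ?P" "1 \<le> ?P" "?g ^ ?K \<le> ?P" using g1 by (auto intro: power_increasing[of 1 _ ?g, simplified] power_increasing)
      have "Suc ?n ^ ?K \<le> ?g ^ ?K" using gn by (rule power_mono) simp
      then have q: "Suc ?n ^ ?K \<le> ?P" using P by linarith
      have "?n * Suc ?n ^ ?K \<le> ?g * ?g ^ ?K"
        using gn \<open>Suc ?n ^ ?K \<le> ?g ^ ?K\<close> by (intro mult_mono) auto
      then have r: "?n * Suc ?n ^ ?K \<le> ?P" by simp
      have s: "aut_size (build ?K (rev (flat \<phi>))) + 2 * ?K + 1 \<le> (aut_size (build ?K (rev (flat \<phi>))) + 2 * ?K + 1) * ?P"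
        by (metis P(2) mult.right_neutral mult_le_mono2)
      have "Suc (decide_size ?K (build ?K (rev (flat \<phi>)), (?n, es))) =
         (aut_size (build ?K (rev (flat \<phi>))) + 2 * ?K + 1) + 3 * ?n + length es + ?n * Suc ?n ^ ?K + Suc ?n ^ ?K"
        by (simp add: decide_size_def)
      also have "\<dots> \<le> (aut_size (build ?K (rev (flat \<phi>))) + 2 * ?K + 1) * ?P + 6 * ?P"
        using s q r gn gm P(1) len_es by linarith
      also have "\<dots> = a \<phi> * ?P" by (simp add: a_def algebra_simps)
      finally show ?thesis .
    qed
    have ge: "?g ^ i \<le> ?g ^ e" if "i \<le> e" for i using that g1 by (intro power_increasing) auto
    have ne: "?xs \<noteq> []" using ys by simp
    have ex: "\<exists>\<phi>' ys'. ?xs = formula_code \<phi>' @ ys'" by blast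
    obtain t where t: "t \<le> c * Suc (length ?xs) ^ d + \<tau> (rev (flat \<phi>)) +
        c * Suc (decide_size ?K (build ?K (rev (flat \<phi>)), (card (verts G), es))) ^ d + 11 * length ?xs + 8"
      and run: "if model_check ?K ?xs then ram_accepts_in p ?xs t else ram_rejects_in p ?xs t"
      using p[OF ex ne] unfolding parse by (elim exE conjE)
    have "c * Suc (length ?xs) ^ d \<le> c * (l \<phi> * ?g) ^ d" using len by (intro mult_left_mono power_mono) auto
    also have "\<dots> = c * l \<phi> ^ d * ?g ^ d" by (simp add: power_mult_distrib)
    also have "\<dots> \<le> c * l \<phi> ^ d * ?g ^ e" by (intro mult_left_mono ge) (auto simp: e_def)
    finally have 1: "c * Suc (length ?xs) ^ d \<le> c * l \<phi> ^ d * ?g ^ e" .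
    have "c * Suc (decide_size ?K (build ?K (rev (flat \<phi>)), (card (verts G), es))) ^ d \<le> c * (a \<phi> * ?g ^ (?K + 1)) ^ d"
      using decide_size by (intro mult_left_mono power_mono) auto
    also have "\<dots> = c * a \<phi> ^ d * ?g ^ ((?K + 1) * d)" by (simp only: power_mult_distrib power_mult mult.assoc)
    also have "\<dots> \<le> c * a \<phi> ^ d * ?g ^ e" by (intro mult_left_mono ge) (auto simp: e_def)
    finally have 2: "c * Suc (decide_size ?K (build ?K (rev (flat \<phi>)), (card (verts G), es))) ^ d \<le> c * a \<phi> ^ d * ?g ^ e" .
    have "11 * length ?xs \<le> 11 * (l \<phi> * ?g ^ 1)" using len by simp
    also have "\<dots> \<le> 11 * (l \<phi> * ?g ^ e)" by (intro mult_left_mono ge) (auto simp: e_def)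
    finally have 3: "11 * length ?xs \<le> 11 * l \<phi> * ?g ^ e" by simp
    have "1 \<le> ?g ^ e" using g1 by simp
    then have 4: "\<tau> (rev (flat \<phi>)) \<le> \<tau> (rev (flat \<phi>)) * ?g ^ e" "8 \<le> 8 * ?g ^ e" by simp_all
    have "t \<le> B \<phi> * ?g ^ e"
      using t 1 2 3 4 unfolding B_def add_mult_distrib by linarith
    also have "B \<phi> \<le> f (formula_length \<phi>)"
      unfolding f_def by (rule member_le_sum) (auto intro: finite_formulas)
    finally have "t \<le> f (formula_length \<phi>) * ?g ^ e" by simp
    then show ?thesis
      using run model_check_correct[OF graphs[OF G] k[OF G] \<phi> code] by auto
  qed
  show ?thesis
    unfolding fpt_def
  proof (rule exI[of _ p], rule exI[of _ f], rule exI[of _ e], intro ballI allI impI)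
    fix I xs assume "I \<in> pp_instances (MC_ord_inv C)" "pp_code (MC_ord_inv C) I xs"
    then obtain G \<phi> ys where I: "I = (G, \<phi>)" "xs = formula_code \<phi> @ ys"
      and "G \<in> C" "sentence \<phi>" "order_invariant \<phi>" "graph_code G ys" by (auto simp: MC_ord_inv_def)
    from main[OF this(3-6)]
    show "\<exists>t\<le>f (pp_param (MC_ord_inv C) I) * pp_size (MC_ord_inv C) I ^ e.
      if pp_yes (MC_ord_inv C) I then ram_accepts_in p xs t else ram_rejects_in p xs t"
      by (simp only: MC_ord_inv_def I param_problem.simps case_prod_conv)
  qed
qed

end
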